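(* The function $E(f)(t,z)$, for $f\in R_\Delta$, is smooth when $t$ varies in $V^*_{\Delta,areg}$ and $z\in U_\Delta$. More precisely, let $\mathfrak a$ be an alcove and assume that $f\in R_\Delta$ is homogeneous of degree $d$. Then, on the open set $\mathfrak a\times U_\Delta$, the function $E(f)(t,z)$ is a polynomial in $t$ of degree at most $-d-r$, with coefficients in $R(T)_\Delta$.
   Context: $V$ is a real vector space of dimension $r$ with a lattice $N$; $V_{\mathbb C}$ is its complexification; $M=N^*\subset V^*$ is the dual lattice. $\Delta\subset M$ is a finite set of non-zero elements, each indivisible in $M$. $S(V^* )$ is the ring of complex polynomial functions on $V_{\mathbb C}$ and $R_\Delta=\Delta^{-1}S(V^* )$ is the ring generated by $S(V^* )$ and the inverses of the $\alpha\in\Delta$, graded by homogeneous degree (positive or negative). $T_{\mathbb C}=V_{\mathbb C}/2i\pi N$; $R(T)$ is the ring of functions on $T_{\mathbb C}$ generated by the characters $e^m:z\mapsto e^{\langle m,z\rangle}$, $m\in M$; $R(T)_\Delta$ is the ring of rational functions on $T_{\mathbb C}$ generated by $R(T)$ and the inverses of $1-e^{-\alpha}$, $\alpha\in\Delta$, viewed as $2i\pi N$-periodic holomorphic functions on $U_\Delta=\{z\in V_{\mathbb C}:\langle\alpha,z+2i\pi n\rangle\neq0\ \forall n\in N,\ \alpha\in\Delta\}$. For $f\in R_\Delta$ and $z\in U_\Delta$, $E(f)(t,z)=\sum_{n\in N}e^{\langle t,z+2i\pi n\rangle}f(z+2i\pi n)$, a generalized function of $t\in V^*$ depending holomorphically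 on $z\in U_\Delta$. A wall of $\Delta$ is a hyperplane of $V^*$ generated by $r-1$ linearly independent elements of $\Delta$; $V^*_{\Delta,areg}$ is the complement in $V^*$ of the union of all walls and their translates by $M$; an alcove is a connected component of $V^*_{\Delta,areg}$. A polynomial of degree at most a negative number is $0$. Smoothness and equality are in the sense of generalized functions of $t$ restricted to the open set.
   Formalization: It is additionally assumed that Δ has at least one wall, i.e. contains r−1 linearly independent elements; otherwise the claim fails (e.g. r=2, Δ empty, f=1 gives a sum of Dirac masses on all of V* ). *)

theory Defs
  imports "HOL-Analysis.Analysis"
begin

text \<open>
  The real space \<open>V\<close> of dimension \<open>r = CARD('n)\<close> and its dual are both \<open>real^'n\<close>, paired by
  the dot product; the complexification of \<open>V\<close> is \<open>complex^'n\<close>.  The lattice stays arbitrary,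
  so the choice of coordinates on \<open>V\<close> is harmless.
\<close>

definition lattice_in :: "(real^'n) set \<Rightarrow> bool" where
  "lattice_in N \<longleftrightarrow>
     (\<exists>B. independent B \<and> span B = UNIV \<and>
          N = range (\<lambda>a :: real^'n \<Rightarrow> int. \<Sum>b\<in>B. of_int (a b) *\<^sub>R b))"

definition dual_lattice :: "(real^'n) set \<Rightarrow> (real^'n) set" where
  "dual_lattice N = {m. \<forall>n\<in>N. m \<bullet> n \<in> \<int>}"

definition indivisible_in :: "(real^'n) set \<Rightarrow> real^'n \<Rightarrow> bool" where
  "indivisible_in M \<alpha> \<longleftrightarrow>
     (\<forall>m\<in>M. \<forall>k::int. \<alpha> = of_int k *\<^sub>R m \<longrightarrow> \<bar>k\<bar> = 1)"

definition pairing :: "real^'n \<Rightarrow> complex^'n \<Rightarrow> complex" where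
  "pairing t z = (\<Sum>i\<in>UNIV. complex_of_real (t $ i) * z $ i)"

definition shift :: "complex^'n \<Rightarrow> real^'n \<Rightarrow> complex^'n" where
  "shift z n = z + (2 * complex_of_real pi * \<i>) *s (\<chi> i. complex_of_real (n $ i))"

inductive_set generated_algebra :: "('a \<Rightarrow> complex) set \<Rightarrow> ('a \<Rightarrow> complex) set"
  for G :: "('a \<Rightarrow> complex) set" where
  gen: "g \<in> G \<Longrightarrow> g \<in> generated_algebra G"
| const: "(\<lambda>z. c) \<in> generated_algebra G"
| add: "\<lbrakk>f \<in> generated_algebra G; g \<in> generated_algebra G\<rbrakk>
        \<Longrightarrow> (\<lambda>z. f z + g z) \<in> generated_algebra G"
| mult: "\<lbrakk>f \<in> generated_algebra G; g \<in> generated_algebra G\<rbrakk>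
        \<Longrightarrow> (\<lambda>z. f z * g z) \<in> generated_algebra G"

text \<open>
  Rational functions are represented by total functions.  Where a denominator vanishes their value
  is the arbitrary one coming from \<open>inverse 0 = 0\<close>; it is never used, since all statements about
  them only evaluate them where the denominators do not vanish.
\<close>

definition polynomial_ring :: "(complex^'n \<Rightarrow> complex) set" where
  "polynomial_ring = generated_algebra (range pairing)"

definition R_Delta :: "(real^'n) set \<Rightarrow> (complex^'n \<Rightarrow> complex) set" where
  "R_Delta \<Delta> =
     generated_algebra (polynomial_ring \<union> (\<lambda>\<alpha> z. inverse (pairing \<alpha> z)) ` \<Delta>)"

definition homogeneous_of_degree ::
    "(real^'n) set \<Rightarrow> int \<Rightarrow> (complex^'n \<Rightarrow> complex) \<Rightarrow> bool" where
  "homogeneous_of_degree \<Delta> d f \<longleftrightarrow>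
     (\<forall>z c. (\<forall>\<alpha>\<in>\<Delta>. pairing \<alpha> z \<noteq> 0) \<and> c \<noteq> 0 \<longrightarrow> f (c *s z) = c powi d * f z)"

definition R_T :: "(real^'n) set \<Rightarrow> (complex^'n \<Rightarrow> complex) set" where
  "R_T N = generated_algebra ((\<lambda>m z. exp (pairing m z)) ` dual_lattice N)"

definition R_T_Delta ::
    "(real^'n) set \<Rightarrow> (real^'n) set \<Rightarrow> (complex^'n \<Rightarrow> complex) set" where
  "R_T_Delta N \<Delta> =
     generated_algebra (R_T N \<union> (\<lambda>\<alpha> z. inverse (1 - exp (- pairing \<alpha> z))) ` \<Delta>)"

definition U_Delta :: "(real^'n) set \<Rightarrow> (real^'n) set \<Rightarrow> (complex^'n) set" where
  "U_Delta N \<Delta> = {z. \<forall>n\<in>N. \<forall>\<alpha>\<in>\<Delta>. pairing \<alpha> (shift z n) \<noteq> 0}"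

definition wall :: "(real^'n) set \<Rightarrow> (real^'n) set \<Rightarrow> bool" where
  "wall \<Delta> H \<longleftrightarrow>
     (\<exists>B. B \<subseteq> \<Delta> \<and> independent B \<and> card B + 1 = CARD('n) \<and> H = span B)"

definition areg :: "(real^'n) set \<Rightarrow> (real^'n) set \<Rightarrow> (real^'n) set" where
  "areg N \<Delta> = - (\<Union>H\<in>Collect (wall \<Delta>). \<Union>m\<in>dual_lattice N. (\<lambda>t. m + t) ` H)"

definition alcove :: "(real^'n) set \<Rightarrow> (real^'n) set \<Rightarrow> (real^'n) set \<Rightarrow> bool" where
  "alcove N \<Delta> \<aa> \<longleftrightarrow> \<aa> \<in> components (areg N \<Delta>)"

text \<open>Real differentiability classes; the definitions are meant for open sets \<open>S\<close>.\<close>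

primrec C_diff_on ::
    "nat \<Rightarrow> 'a::real_normed_vector set \<Rightarrow> ('a \<Rightarrow> 'b::real_normed_vector) \<Rightarrow> bool" where
  "C_diff_on 0 S f \<longleftrightarrow> continuous_on S f"
| "C_diff_on (Suc k) S f \<longleftrightarrow>
     (\<forall>x\<in>S. f differentiable (at x)) \<and>
     (\<forall>v. C_diff_on k S (\<lambda>x. frechet_derivative f (at x) v))"

definition smooth_on :: "'a::real_normed_vector set \<Rightarrow> ('a \<Rightarrow> 'b::real_normed_vector) \<Rightarrow> bool" where
  "smooth_on S f \<longleftrightarrow> (\<forall>k. C_diff_on k S f)"

definition test_functions :: "(real^'n) set \<Rightarrow> (real^'n \<Rightarrow> complex) set" where
  "test_functions A =
     {\<phi>. smooth_on UNIV \<phi> \<and> (\<exists>K. compact K \<and> K \<subseteq> A \<and> (\<forall>t. t \<notin> K \<longrightarrow> \<phi> t = 0))}"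

text \<open>
  Generalized functions are functionals on test functions, a locally integrable function \<open>F\<close> being
  identified with \<open>\<phi> \<mapsto> \<integral> F \<phi>\<close> for Lebesgue measure.  Equality of the two functionals does not
  depend on the normalization of the measure.
\<close>

definition gen_eq_on ::
    "(real^'n) set \<Rightarrow> ((real^'n \<Rightarrow> complex) \<Rightarrow> complex) \<Rightarrow> (real^'n \<Rightarrow> complex) \<Rightarrow> bool" where
  "gen_eq_on A T F \<longleftrightarrow> (\<forall>\<phi>\<in>test_functions A. T \<phi> = (LINT t|lborel. F t * \<phi> t))"

text \<open>
  The sum of the generalized functions \<open>e\<^bsup>\<langle>t, z + 2i\<pi>n\<rangle>\<^esup> f(z + 2i\<pi>n)\<close> of \<open>t\<close> is taken weakly,
  i.e. after pairing with a test function.  For \<open>z\<close> in \<open>U_Delta N \<Delta>\<close> the resulting series converges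
  absolutely: the integrals decay rapidly in \<open>n\<close>, while the values of \<open>f\<close> grow at most polynomially
  because \<open>\<langle>\<alpha>, z + 2i\<pi>n\<rangle>\<close> stays bounded away from \<open>0\<close>.
\<close>

definition E_sum ::
    "(real^'n) set \<Rightarrow> (complex^'n \<Rightarrow> complex) \<Rightarrow> complex^'n \<Rightarrow> (real^'n \<Rightarrow> complex) \<Rightarrow> complex" where
  "E_sum N f z \<phi> =
     (\<Sum>\<^sub>\<infinity>n\<in>N. LINT t|lborel. exp (pairing t (shift z n)) * f (shift z n) * \<phi> t)"

definition poly_in_t ::
    "int \<Rightarrow> (('n::finite \<Rightarrow> nat) \<Rightarrow> complex^'n \<Rightarrow> complex) \<Rightarrow> real^'n \<Rightarrow> complex^'n \<Rightarrow> complex" where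
  "poly_in_t D c t z =
     (\<Sum>k | int (\<Sum>i\<in>UNIV. k i) \<le> D. c k z * (\<Prod>i\<in>UNIV. complex_of_real (t $ i) ^ k i))"

end

theory Submission
  imports Defs "HOL-Complex_Analysis.Complex_Analysis"
begin

text \<open>
  Multiplying \<open>f\<close> by the linear form \<open>\<langle>\<cdot>, v\<rangle>\<close> amounts, by integration by parts, to
  differentiating \<open>E(f)\<close> along \<open>v\<close>, which lowers the degree in \<open>t\<close> by one.  Hence numerators may be
  ignored, and partial fractions reduce the claim to \<open>f = \<Prod> \<alpha>\<^bsup>-n(\<alpha>)\<^esup>\<close> over a linearly independent set
  \<open>\<kappa> \<subseteq> \<Delta>\<close>, where by the same device \<open>\<kappa>\<close> has at least \<open>r - 1\<close> elements and all \<open>n(\<alpha>) \<ge> 2\<close>.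

  If \<open>\<kappa>\<close> spans a wall with primitive normal \<open>x \<in> N\<close>, then \<open>f\<close> is invariant under shifts by \<open>x\<close>, so
  \<open>(e\<^bsup>2i\<pi>\<langle>t,x\<rangle>\<^esup> - 1) E(f) = 0\<close> and \<open>E(f)\<close> vanishes off the translated wall \<open>\<langle>t,x\<rangle> \<in> \<int>\<close>.  If \<open>\<kappa>\<close> is a
  basis, the series converges absolutely; averaging over \<open>M / \<int>\<kappa>\<close> replaces the sum over \<open>N\<close> by sums
  over the larger lattice dual to \<open>\<int>\<kappa>\<close>, which are products of the series
  \<open>\<Sum>\<^sub>j e\<^bsup>s(x+2i\<pi>j)\<^esup> / (x+2i\<pi>j)\<^sup>k\<close>.  For \<open>s\<close> in \<open>(l, l+1)\<close> the latter is \<open>e\<^sup>l\<^sup>x\<close> times a polynomial in \<open>s - l\<close> of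
  degree \<open>k - 1\<close>.  Indivisibility enters only to make \<open>\<langle>\<alpha>, N\<rangle> = \<int>\<close>, so that no pole is hit on the
  larger lattice.
\<close>

section \<open>Differentiability classes\<close>

text \<open>In the basis case the exchange of summation and integration rests on absolute
  convergence for fixed t, which a pole of order one destroys. So every pole order is raised by two,
  poles absent from the denominator being adjoined in the same way, and the squares of the linear
  forms are then removed again as numerators. Each move keeps the degree in t equal to the net pole
  order minus r: a pole of order n(\<alpha>) contributes a one-variable polynomial of degree
  n(\<alpha>) - 1, differentiation lowers both numbers by one, and partial fractions keep the total
  order. For a set spanning a wall the answer 0 meets every degree bound; but there the denominator
  does not decay along the missing direction, and this decay has to come from the test function.
  Finally, a presentation of \<open>f\<close> may contain terms of several degrees that cancel; they
  are separated by comparing the values of \<open>f\<close> at multiples of z.\<close>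

lemma frechet_derivative_cong_open:
  assumes "open S" "x \<in> S" "\<And>y. y \<in> S \<Longrightarrow> f y = g y"
  shows "frechet_derivative f (at x) = frechet_derivative g (at x)"
proof -
  \<comment> \<open>\<open>frechet_derivative\<close> is a choice among the derivatives; as both
    functions have the same ones, the choices agree even where no derivative exists.\<close>
  have "(f has_derivative f') (at x) \<longleftrightarrow> (g has_derivative f') (at x)" for f'
    using assms has_derivative_transform_within_open[of f f' x UNIV S g]
      has_derivative_transform_within_open[of g f' x UNIV S f] by auto
  then show ?thesis
    unfolding frechet_derivative_def by simp
qed

lemma C_diff_on_cong:
  assumes "open S" "\<And>x. x \<in> S \<Longrightarrow> f x = g x" "C_diff_on k S f"
  shows "C_diff_on k S g"
  using assms(2,3)
proof (induction k arbitrary: f g)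
  case 0
  then show ?case by (auto cong: continuous_on_cong)
next
  case (Suc k)
  have "g differentiable (at x)" if x: "x \<in> S" for x
  proof -
    from Suc.prems x obtain f' where "(f has_derivative f') (at x)"
      by (auto simp: differentiable_def)
    then have "(g has_derivative f') (at x)"
      using has_derivative_transform_within_open[OF _ \<open>open S\<close> x] Suc.prems(1) by blast
    then show ?thesis by (auto simp: differentiable_def)
  qed
  moreover have "C_diff_on k S (\<lambda>x. frechet_derivative g (at x) v)" for v
    by (rule Suc.IH[of "\<lambda>x. frechet_derivative f (at x) v"])
      (use Suc.prems frechet_derivative_cong_open[OF assms(1), of _ f g] in auto)
  ultimately show ?case by simp
qed

text \<open>Replaces the chosen \<open>frechet_derivative\<close> of the definition by any explicit
  derivative formula, so that the closure properties follow from the usual rules by induction on the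
  order.\<close>

lemma C_diff_on_SucI:
  assumes "open S" "\<And>x. x \<in> S \<Longrightarrow> (f has_derivative f' x) (at x)"
    "\<And>v. C_diff_on k S (\<lambda>x. f' x v)"
  shows "C_diff_on (Suc k) S f"
proof -
  have "C_diff_on k S (\<lambda>x. frechet_derivative f (at x) v)" for v
    using assms(1) _ assms(3)
  proof (rule C_diff_on_cong)
    fix x assume "x \<in> S"
    then show "f' x v = frechet_derivative f (at x) v"
      using frechet_derivative_at[OF assms(2)] by simp
  qed
  then show ?thesis using assms(2) by (auto simp: differentiable_def)
qed

lemma C_diff_on_SucD:
  assumes "C_diff_on (Suc k) S f" "x \<in> S"
  shows "(f has_derivative frechet_derivative f (at x)) (at x)"
  using assms by (simp add: frechet_derivative_works)

lemma C_diff_on_Suc_le: "C_diff_on (Suc k) S f \<Longrightarrow> C_diff_on k S f"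
proof (induction k arbitrary: f)
  case 0
  then show ?case
    by (auto intro!: continuous_at_imp_continuous_on differentiable_imp_continuous_within)
next
  case (Suc k)
  then show ?case by (metis C_diff_on.simps(2))
qed

lemma C_diff_on_subset: "C_diff_on k S f \<Longrightarrow> T \<subseteq> S \<Longrightarrow> C_diff_on k T f"
  by (induction k arbitrary: f) (auto intro: continuous_on_subset)

lemma C_diff_on_const: "open S \<Longrightarrow> C_diff_on k S (\<lambda>x. c)"
proof (induction k arbitrary: c)
  case (Suc k)
  show ?case
    by (rule C_diff_on_SucI[where f' = "\<lambda>x v. 0"]) (use Suc in auto)
qed auto

lemma C_diff_on_linear:
  assumes "open S" "bounded_linear f"
  shows "C_diff_on k S f"
proof (cases k)
  case 0
  then show ?thesis using assms by (auto simp: linear_continuous_on)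
next
  case (Suc m)
  have "C_diff_on (Suc m) S f"
    by (rule C_diff_on_SucI[where f' = "\<lambda>x. f"])
      (use assms in \<open>auto intro!: bounded_linear_imp_has_derivative C_diff_on_const\<close>)
  then show ?thesis using Suc by blast
qed

lemma C_diff_on_add:
  assumes "open S"
  shows "C_diff_on k S f \<Longrightarrow> C_diff_on k S g \<Longrightarrow> C_diff_on k S (\<lambda>x. f x + g x)"
proof (induction k arbitrary: f g)
  case (Suc k)
  show ?case
    by (rule C_diff_on_SucI[OF assms,
        where f' = "\<lambda>x v. frechet_derivative f (at x) v + frechet_derivative g (at x) v"])
      (use Suc in \<open>auto intro!: has_derivative_add C_diff_on_SucD[of k S]\<close>)
qed (auto intro: continuous_intros)

lemma C_diff_on_mult:
  fixes f g :: "'a::real_normed_vector \<Rightarrow> 'b::real_normed_algebra"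
  assumes "open S"
  shows "C_diff_on k S f \<Longrightarrow> C_diff_on k S g \<Longrightarrow> C_diff_on k S (\<lambda>x. f x * g x)"
proof (induction k arbitrary: f g)
  case (Suc k)
  have "C_diff_on k S f" "C_diff_on k S g"
    using Suc.prems C_diff_on_Suc_le by blast+
  moreover have "C_diff_on k S (\<lambda>x. frechet_derivative f (at x) v)"
    "C_diff_on k S (\<lambda>x. frechet_derivative g (at x) v)" for v
    using Suc.prems by auto
  ultimately show ?case
    by (intro C_diff_on_SucI[OF assms, where f' = "\<lambda>x v. f x * frechet_derivative g (at x) v
          + frechet_derivative f (at x) v * g x"] has_derivative_mult C_diff_on_SucD[of k S]
        Suc.prems C_diff_on_add[OF assms] Suc.IH)
qed (auto intro: continuous_intros)

text \<open>The derivative is \<open>exp f\<close> times a derivative of \<open>f\<close>. The first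
  factor is covered by the induction hypothesis for the same \<open>f\<close>, which is a fortiori
  of the lower class.\<close>

lemma C_diff_on_exp:
  fixes f :: "'a::real_normed_vector \<Rightarrow> complex"
  assumes "open S"
  shows "C_diff_on k S f \<Longrightarrow> C_diff_on k S (\<lambda>x. exp (f x))"
proof (induction k)
  case (Suc k)
  have "((\<lambda>x. exp (f x)) has_derivative (\<lambda>v. exp (f x) * frechet_derivative f (at x) v)) (at x)"
    if "x \<in> S" for x
    using has_derivative_compose[OF C_diff_on_SucD[OF Suc.prems that],
        OF DERIV_exp[unfolded has_field_derivative_def]] by simp
  then show ?case
    using Suc C_diff_on_Suc_le[OF Suc.prems]
    by (intro C_diff_on_SucI[OF assms, where
          f' = "\<lambda>x v. exp (f x) * frechet_derivative f (at x) v"] C_diff_on_mult[OF assms] Suc.IH) auto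
qed (auto intro: continuous_intros)

lemma C_diff_on_inverse:
  fixes f :: "'a::real_normed_vector \<Rightarrow> complex"
  assumes "open S" and nz: "\<And>x. x \<in> S \<Longrightarrow> f x \<noteq> 0"
  shows "C_diff_on k S f \<Longrightarrow> C_diff_on k S (\<lambda>x. inverse (f x))"
proof (induction k)
  case (Suc k)
  have "((\<lambda>x. inverse (f x)) has_derivative
      (\<lambda>v. (-1) * (inverse (f x) * frechet_derivative f (at x) v * inverse (f x)))) (at x)"
    if "x \<in> S" for x
    using Deriv.has_derivative_inverse[OF nz[OF that] C_diff_on_SucD[OF Suc.prems that]] that by simp
  then show ?case
    using Suc C_diff_on_Suc_le[OF Suc.prems]
    by (intro C_diff_on_SucI[OF assms(1), where f' = "\<lambda>x v. (-1) *
          (inverse (f x) * frechet_derivative f (at x) v * inverse (f x))"] C_diff_on_mult[OF assms(1)] C_diff_on_const[OF assms(1)]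
        Suc.IH) auto
qed (use nz in \<open>auto intro: continuous_intros\<close>)

text \<open>Every condition in the definition concerns one point at a time. This glues functions
  that are given by different formulas on the members of an open cover.\<close>

lemma C_diff_on_local:
  assumes "\<And>x. x \<in> S \<Longrightarrow> \<exists>T. open T \<and> x \<in> T \<and> C_diff_on k T f"
  shows "C_diff_on k S f"
  using assms
proof (induction k arbitrary: f)
  case 0
  show ?case
    unfolding C_diff_on.simps
  proof (rule continuous_at_imp_continuous_on, rule ballI)
    fix x assume "x \<in> S"
    with 0 obtain T where "open T" "x \<in> T" "continuous_on T f" by auto
    then show "isCont f x" by (simp add: continuous_on_eq_continuous_at)
  qed
next
  case (Suc k)
  then have "C_diff_on k S (\<lambda>x. frechet_derivative f (at x) v)" for v
    by (metis C_diff_on.simps(2))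
  then show ?case using Suc.prems by auto
qed

section \<open>Smooth functions\<close>

lemma smooth_on_const: "open S \<Longrightarrow> smooth_on S (\<lambda>x. c)"
  and smooth_on_linear: "open S \<Longrightarrow> bounded_linear h \<Longrightarrow> smooth_on S h"
  by (simp_all add: smooth_on_def C_diff_on_const C_diff_on_linear)

lemma smooth_on_add: "open S \<Longrightarrow> smooth_on S f \<Longrightarrow> smooth_on S g \<Longrightarrow> smooth_on S (\<lambda>x. f x + g x)"
  by (simp add: smooth_on_def C_diff_on_add)

lemma smooth_on_mult:
  fixes f g :: "'a::real_normed_vector \<Rightarrow> 'b::real_normed_algebra"
  shows "open S \<Longrightarrow> smooth_on S f \<Longrightarrow> smooth_on S g \<Longrightarrow> smooth_on S (\<lambda>x. f x * g x)"
  by (simp add: smooth_on_def C_diff_on_mult)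

lemma smooth_on_exp:
  fixes f :: "'a::real_normed_vector \<Rightarrow> complex"
  shows "open S \<Longrightarrow> smooth_on S f \<Longrightarrow> smooth_on S (\<lambda>x. exp (f x))"
  by (simp add: smooth_on_def C_diff_on_exp)

lemma smooth_on_inverse:
  fixes f :: "'a::real_normed_vector \<Rightarrow> complex"
  shows "open S \<Longrightarrow> (\<And>x. x \<in> S \<Longrightarrow> f x \<noteq> 0) \<Longrightarrow> smooth_on S f \<Longrightarrow> smooth_on S (\<lambda>x. inverse (f x))"
  by (simp add: smooth_on_def C_diff_on_inverse)

lemma smooth_on_cong:
  "open S \<Longrightarrow> (\<And>x. x \<in> S \<Longrightarrow> f x = g x) \<Longrightarrow> smooth_on S f \<Longrightarrow> smooth_on S g"
  unfolding smooth_on_def using C_diff_on_cong by blast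

lemma smooth_on_subset: "smooth_on S f \<Longrightarrow> T \<subseteq> S \<Longrightarrow> smooth_on T f"
  unfolding smooth_on_def using C_diff_on_subset by blast

lemma smooth_on_local:
  assumes "\<And>x. x \<in> S \<Longrightarrow> \<exists>T. open T \<and> x \<in> T \<and> smooth_on T f"
  shows "smooth_on S f"
  unfolding smooth_on_def
proof
  fix k
  show "C_diff_on k S f"
    using assms C_diff_on_local[of S k f] unfolding smooth_on_def by blast
qed

lemma smooth_on_continuous: "smooth_on S f \<Longrightarrow> continuous_on S f"
  unfolding smooth_on_def using C_diff_on.simps(1) by blast

lemma smooth_on_has_derivative:
  assumes "smooth_on S f" "x \<in> S"
  shows "(f has_derivative frechet_derivative f (at x)) (at x)"
  using assms C_diff_on_SucD[of 0 S f x] unfolding smooth_on_def by metis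

lemma smooth_on_frechet: "smooth_on S f \<Longrightarrow> smooth_on S (\<lambda>x. frechet_derivative f (at x) v)"
  unfolding smooth_on_def using C_diff_on.simps(2) by blast

section \<open>The one-variable series\<close>

text \<open>With x = \<open>pairing \<alpha> z\<close> and j = \<alpha> \<bullet> n this is the
  value of the linear form \<alpha> at \<open>shift z n\<close>.\<close>

abbreviation wint :: "complex \<Rightarrow> int \<Rightarrow> complex" where
  "wint x j \<equiv> x + 2 * complex_of_real pi * \<i> * of_int j"

lemma summable_on_int:
  fixes f :: "int \<Rightarrow> real"
  assumes nn: "\<And>j. f j \<ge> 0"
    and 1: "summable (\<lambda>n. f (int n))" and 2: "summable (\<lambda>n. f (- int n))"
  shows "f summable_on UNIV"
proof -
  have "(f \<circ> int) summable_on UNIV"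
    using 1 nn by (simp add: o_def summable_on_UNIV_nonneg_real_iff)
  then have A: "f summable_on range int"
    by (subst summable_on_reindex) auto
  have "(f \<circ> (\<lambda>n. - int n)) summable_on UNIV"
    using 2 nn by (simp add: o_def summable_on_UNIV_nonneg_real_iff)
  moreover have "inj (\<lambda>n. - int n)" by (simp add: inj_on_def)
  ultimately have B: "f summable_on range (\<lambda>n. - int n)"
    by (simp only: summable_on_reindex)
  have "j \<in> range int \<union> range (\<lambda>n. - int n)" for j
    using int_cases2[of j] by blast
  then have "(UNIV :: int set) = range int \<union> range (\<lambda>n. - int n)"
    by blast
  then show ?thesis using summable_on_union[OF A B] by simp
qed

lemma summable_wint2:
  "(\<lambda>j. inverse (norm (wint x j) ^ 2)) summable_on UNIV"
proof -
  \<comment> \<open>Once n >= |x|, the modulus of \<open>wint x j\<close> is at least 2 pi n - |x|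
    >= n.\<close>
  have key: "inverse (norm (wint x j) ^ 2) \<le> inverse (real n ^ 2)"
    if "\<bar>j\<bar> = int n" "n \<ge> nat \<lceil>norm x\<rceil> + 1" for j n
  proof -
    have n: "norm x \<le> real n" "n \<ge> 1" using that by linarith+
    have "norm (2 * complex_of_real pi * \<i> * of_int j) = 2 * pi * real n"
      using that(1) by (simp add: norm_mult)
    moreover have "norm (2 * complex_of_real pi * \<i> * of_int j) - norm x \<le> norm (wint x j)"
      by (metis add.commute norm_diff_ineq)
    moreover have "2 * pi * real n \<ge> 2 * real n" using pi_gt3 n by simp
    ultimately have "real n \<le> norm (wint x j)" using n by linarith
    then show ?thesis
      using n by (intro le_imp_inverse_le power_mono) auto
  qed
  have S: "summable (\<lambda>n. inverse (real n ^ 2))"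
    using inverse_power_summable[of 2, where 'a = real] by simp
  show ?thesis
  proof (rule summable_on_int)
    show "summable (\<lambda>n. inverse (norm (wint x (int n)) ^ 2))"
    proof (rule summable_comparison_test'[OF S, of "nat \<lceil>norm x\<rceil> + 1"])
      fix n assume "nat \<lceil>norm x\<rceil> + 1 \<le> n"
      then show "norm (inverse (norm (wint x (int n)) ^ 2)) \<le> inverse (real n ^ 2)"
        using key[of "int n" n] by simp
    qed
    show "summable (\<lambda>n. inverse (norm (wint x (- int n)) ^ 2))"
    proof (rule summable_comparison_test'[OF S, of "nat \<lceil>norm x\<rceil> + 1"])
      fix n assume "nat \<lceil>norm x\<rceil> + 1 \<le> n"
      then show "norm (inverse (norm (wint x (- int n)) ^ 2)) \<le> inverse (real n ^ 2)"
        using key[of "- int n" n] by simp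
    qed
  qed auto
qed

lemma summable_wint:
  assumes k: "k \<ge> 2"
  shows "(\<lambda>j. norm (inverse (wint x j) ^ k)) summable_on UNIV"
proof -
  have S: "(\<lambda>j. inverse (norm (wint x j) ^ 2)) summable_on UNIV"
    by (rule summable_wint2)
  \<comment> \<open>A summable nonnegative family is bounded by its sum, so the powers beyond the
    second are absorbed into a constant.\<close>
  obtain C where C: "\<And>j. inverse (norm (wint x j) ^ 2) \<le> C"
  proof -
    have "inverse (norm (wint x j) ^ 2) \<le> infsum (\<lambda>j. inverse (norm (wint x j) ^ 2)) UNIV" for j
      using finite_sum_le_infsum[OF S, of "{j}"] by auto
    then show ?thesis using that by blast
  qed
  have C': "inverse (norm (wint x j)) \<le> sqrt C" for j
    using C[of j] by (intro real_le_rsqrt) (simp add: power_inverse)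
  have "norm (inverse (wint x j) ^ k) \<le> sqrt C ^ (k - 2) * inverse (norm (wint x j) ^ 2)" for j
  proof -
    have "norm (inverse (wint x j) ^ k) = inverse (norm (wint x j)) ^ (k - 2) * inverse (norm (wint x j)) ^ 2"
      using k by (simp only: norm_power norm_inverse power_add[symmetric] le_add_diff_inverse2)
    also have "\<dots> \<le> sqrt C ^ (k - 2) * inverse (norm (wint x j)) ^ 2"
      by (intro mult_right_mono power_mono C') auto
    finally show ?thesis by (simp add: power_inverse)
  qed
  then show ?thesis
    by (intro summable_on_comparison_test[OF summable_on_cmult_right[OF S]]) auto
qed

text \<open>Pointwise Fourier inversion by Chernoff's argument: dividing \<open>\<phi>(s) - \<phi>(s\<^sub>0)\<close> by
  \<open>e\<^bsup>2\<pi>i(s - s\<^sub>0)\<^esup> - 1\<close> makes the partial sums telescope.\<close>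

lemma fourier_coeff_bound:
  fixes P D :: "real \<Rightarrow> complex" and s0 :: real
  assumes der: "\<And>s. s \<in> {0..1} \<Longrightarrow> (P has_vector_derivative D s) (at s within {0..1})"
    and cD: "continuous_on {0..1} D"
  shows "\<exists>C. \<forall>j::int. j \<noteq> 0 \<longrightarrow> norm (integral {0..1}
      (\<lambda>s. exp (- (2 * of_real pi * \<i> * of_int j * of_real (s - s0))) * P s)) \<le> C / \<bar>real_of_int j\<bar>"
proof -
  have cP: "continuous_on {0..1} P"
    by (rule continuous_on_vector_derivative) (use der in auto)
  define E where "E = (\<lambda>j (s::real). exp (- (2 * of_real pi * \<i> * of_int j * of_real (s - s0))))"
  have cE: "continuous_on A (E j)" for j A
    unfolding E_def by (intro continuous_intros)
  have nE: "norm (E j s) = 1" for j s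
    unfolding E_def norm_exp_eq_Re by simp
  \<comment> \<open>The two boundary terms and the remaining integral of one integration by parts,
    estimated with |\<open>E j\<close>| = 1.\<close>
  define C where "C = norm (P 1) + norm (P 0) + integral {0..1} (\<lambda>s. norm (D s))"
  have "norm (integral {0..1} (\<lambda>s. E j s * P s)) \<le> C / \<bar>real_of_int j\<bar>" if j: "j \<noteq> 0" for j
  proof -
    define c where "c = - (2 * of_real pi * \<i> * of_int j)"
    have c: "c \<noteq> 0" "norm c = 2 * pi * \<bar>real_of_int j\<bar>"
      using j unfolding c_def by (auto simp: norm_mult)
    have dE: "((\<lambda>s. E j s) has_vector_derivative c * E j s) (at s within A)" for s A
    proof -
      have "((\<lambda>z. exp (c * (z - of_real s0))) has_field_derivative c * E j s) (at (of_real s))"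
        by (auto intro!: derivative_eq_intros simp: E_def c_def)
      then show ?thesis
        using has_vector_derivative_real_field[of _ "c * E j s" s A]
        by (simp add: E_def c_def has_vector_derivative_at_within)
    qed
    have "((\<lambda>s. E j s * P s / c) has_vector_derivative (E j s * P s + E j s * D s / c)) (at s within {0..1})"
      if "s \<in> {0..1}" for s
      using c by (auto intro!: derivative_eq_intros dE der[OF that] simp: field_simps)
    then have "((\<lambda>s. E j s * P s + E j s * D s / c) has_integral (E j 1 * P 1 / c - E j 0 * P 0 / c)) {0..1}"
      by (intro fundamental_theorem_of_calculus) auto
    then have "integral {0..1} (\<lambda>s. E j s * P s + E j s * D s / c) = E j 1 * P 1 / c - E j 0 * P 0 / c"
      by blast
    moreover have "integral {0..1} (\<lambda>s. E j s * P s + E j s * D s / c) =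
        integral {0..1} (\<lambda>s. E j s * P s) + integral {0..1} (\<lambda>s. E j s * D s) / c"
      by (subst integral_add)
        (auto intro!: integrable_continuous_real continuous_intros cE cP cD c)
    ultimately have eq: "integral {0..1} (\<lambda>s. E j s * P s) =
        (E j 1 * P 1 - E j 0 * P 0 - integral {0..1} (\<lambda>s. E j s * D s)) / c"
      using c(1) by (simp add: field_split_simps)
    have "norm (integral {0..1} (\<lambda>s. E j s * D s)) \<le> integral {0..1} (\<lambda>s. norm (D s))"
      by (rule integral_norm_bound_integral)
        (auto intro!: integrable_continuous_real continuous_intros cE cD simp: norm_mult nE)
    then have "norm (E j 1 * P 1 - E j 0 * P 0 - integral {0..1} (\<lambda>s. E j s * D s)) \<le> C"
      unfolding C_def
      by (intro order_trans[OF norm_triangle_ineq4] add_mono order_trans[OF norm_triangle_ineq4])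
        (auto simp: norm_mult nE)
    then have "norm (integral {0..1} (\<lambda>s. E j s * P s)) \<le> C / (2 * pi * \<bar>real_of_int j\<bar>)"
      unfolding eq norm_divide c(2) by (intro divide_right_mono) auto
    also have "\<dots> \<le> C / \<bar>real_of_int j\<bar>"
    proof (rule divide_left_mono)
      show "\<bar>real_of_int j\<bar> \<le> 2 * pi * \<bar>real_of_int j\<bar>"
        using pi_gt3 mult_right_mono[of 1 "2 * pi" "\<bar>real_of_int j\<bar>"] by simp
      show "0 \<le> C" unfolding C_def
        by (intro add_nonneg_nonneg integral_nonneg integrable_continuous_real continuous_intros cD) auto
    qed (use j in auto)
    finally show ?thesis .
  qed
  then show ?thesis unfolding E_def by blast
qed

lemma integral_exp_2pi:
  fixes s0 :: real
  shows "integral {0..1} (\<lambda>s. exp (- (2 * of_real pi * \<i> * of_int j * of_real (s - s0)))) =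
    (if j = 0 then 1 else 0 :: complex)"
proof (cases "j = 0")
  case False
  define c where "c = - (2 * of_real pi * \<i> * of_int j)"
  have c: "c \<noteq> 0" using False by (auto simp: c_def)
  define G where "G = (\<lambda>z. exp (c * (z - of_real s0)) / c)"
  have "((\<lambda>s. G (of_real s)) has_vector_derivative exp (c * (of_real s - of_real s0))) (at s within {0..1})" for s
    unfolding G_def using c
    by (intro has_vector_derivative_real_field[THEN has_vector_derivative_at_within])
      (auto intro!: derivative_eq_intros)
  then have "((\<lambda>s. exp (c * (of_real s - of_real s0))) has_integral (G (of_real 1) - G (of_real 0))) {0..1}"
    by (intro fundamental_theorem_of_calculus) auto
  moreover have "G (of_real 1) = G (of_real 0)"
  proof -
    have "exp c = 1"
      unfolding c_def exp_eq_1 by (auto intro!: exI[of _ "-j"])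
    then have "exp (c * (1 - of_real s0)) = exp (c * (0 - of_real s0))"
      by (simp add: right_diff_distrib exp_diff exp_minus field_simps)
    then show ?thesis by (simp add: G_def)
  qed
  ultimately have "integral {0..1} (\<lambda>s. exp (c * (of_real s - of_real s0))) = 0"
    by (simp add: integral_unique)
  then show ?thesis using False by (simp add: c_def)
qed simp

lemma fourier_inversion:
  assumes hol: "\<phi> holomorphic_on UNIV" and s0: "0 < s0" "s0 < 1"
  shows "(\<lambda>J. \<Sum>j = - int J..int J. integral {0..1}
      (\<lambda>s. exp (- (2 * of_real pi * \<i> * of_int j * of_real (s - s0))) * \<phi> (of_real s)))
    \<longlonglongrightarrow> \<phi> (of_real s0)"
proof -
  define a where "a = complex_of_real s0"
  define g where "g = (\<lambda>z. exp (2 * of_real pi * \<i> * (z - a)))"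
  \<comment> \<open>The quotient of the difference quotients of \<phi> and g at a, each continued
    over its removable singularity. As g'(a) is not 0, \<psi> is holomorphic at a; at the other
    points of the ball it is (\<phi> - \<phi>(a)) / (g - 1).\<close>
  define \<psi> where "\<psi> = (\<lambda>z. (if z = a then deriv \<phi> a else (\<phi> z - \<phi> a) / (z - a))
     / (if z = a then deriv g a else (g z - g a) / (z - a)))"
  \<comment> \<open>Radius 1 is exactly right: the ball contains [0, 1] because 0 < s0 < 1, and g
    takes the value 1 only at the points a + n for integers n, of which the open ball contains just
    a.\<close>
  define O' where "O' = ball a 1"
  have g1: "g z = 1 \<longleftrightarrow> z = a" if "z \<in> O'" for z
  proof
    assume "g z = 1"
    then obtain n :: int where n: "2 * of_real pi * \<i> * (z - a) = of_int (2 * n) * pi * \<i>"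
      unfolding g_def exp_eq_1 by (auto simp: complex_eq_iff)
    then have "(2 * of_real pi * \<i>) * (z - a) = (2 * of_real pi * \<i>) * of_int n"
      by simp
    then have "z - a = of_int n" by (subst (asm) mult_left_cancel) auto
    with that have "norm (of_int n :: complex) < 1"
      unfolding O'_def by (metis dist_commute dist_norm mem_ball)
    then have "n = 0" by (simp add: norm_of_int)
    with \<open>z - a = of_int n\<close> show "z = a" by simp
  qed (simp add: g_def)
  have ga: "g a = 1" by (simp add: g_def)
  have dga: "deriv g a = 2 * of_real pi * \<i>"
    unfolding g_def by (intro DERIV_imp_deriv) (auto intro!: derivative_eq_intros)
  have holg: "g holomorphic_on O'" unfolding g_def by (intro holomorphic_intros)
  have hol': "\<phi> holomorphic_on O'" using hol holomorphic_on_subset by blast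
  have hol\<psi>: "\<psi> holomorphic_on O'"
    unfolding \<psi>_def
  proof (intro holomorphic_on_divide pole_lemma_open hol' holg)
    fix z assume "z \<in> O'"
    then show "(if z = a then deriv g a else (g z - g a) / (z - a)) \<noteq> 0"
      using g1[of z] ga dga by auto
  qed (auto simp: O'_def)
  have eq: "\<phi> z = \<phi> a + (g z - 1) * \<psi> z" if "z \<in> O'" for z
    using g1[OF that] ga by (auto simp: \<psi>_def)
  have sub: "of_real s \<in> O'" if "s \<in> {0..1}" for s :: real
    using that s0 by (auto simp: O'_def a_def dist_of_real dist_real_def)
  define P where "P = (\<lambda>s::real. \<psi> (of_real s))"
  define D where "D = (\<lambda>s::real. deriv \<psi> (of_real s))"
  have der: "(P has_vector_derivative D s) (at s within {0..1})" if "s \<in> {0..1}" for s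
    unfolding P_def D_def
    by (intro has_vector_derivative_real_field[THEN has_vector_derivative_at_within]
        holomorphic_derivI[OF hol\<psi>]) (use sub that in \<open>auto simp: O'_def\<close>)
  have cD: "continuous_on {0..1} D"
    unfolding D_def
    by (rule continuous_on_compose2[OF holomorphic_on_imp_continuous_on[OF
          holomorphic_deriv[OF hol\<psi>]]]) (use sub in \<open>auto simp: O'_def intro: continuous_intros\<close>)
  have cP: "continuous_on {0..1} P"
    by (rule continuous_on_vector_derivative) (use der in auto)
  define E where "E = (\<lambda>j (s::real). exp (- (2 * of_real pi * \<i> * of_int j * of_real (s - s0))))"
  have cE: "continuous_on A (E j)" for j A
    unfolding E_def by (intro continuous_intros)
  define c where "c = (\<lambda>j. integral {0..1} (\<lambda>s. E j s * P s))"
  obtain C where C: "\<And>j. j \<noteq> 0 \<Longrightarrow> norm (c j) \<le> C / \<bar>real_of_int j\<bar>"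
    using fourier_coeff_bound[OF der cD, of s0] unfolding c_def E_def by blast
  have coeff: "integral {0..1} (\<lambda>s. E j s * \<phi> (of_real s)) =
      (if j = 0 then \<phi> a else 0) + (c (j - 1) - c j)" for j
  proof -
    \<comment> \<open>Multiplication by g lowers the frequency by one, so the term (g - 1) \<psi>
      contributes \<open>c (j - 1) - c j\<close>, which telescopes in j.\<close>
    have gE: "E j s * g (of_real s) = E (j - 1) s" for s
      unfolding E_def g_def a_def by (simp add: exp_add[symmetric] algebra_simps)
    have "integral {0..1} (\<lambda>s. E j s * \<phi> (of_real s)) =
        integral {0..1} (\<lambda>s. \<phi> a * E j s + (E (j - 1) s * P s - E j s * P s))"
      by (rule integral_cong, subst eq[OF sub])
        (auto simp: algebra_simps P_def gE[symmetric])
    also have "\<dots> = \<phi> a * integral {0..1} (E j) + (c (j - 1) - c j)"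
      unfolding c_def
      by (subst integral_add integral_diff integral_mult_right,
          (intro integrable_continuous_real continuous_intros cE cP)+)+ simp
    finally show ?thesis
      unfolding E_def using integral_exp_2pi[of j s0] by simp
  qed
  have sums: "(\<Sum>j = - int J..int J. integral {0..1} (\<lambda>s. E j s * \<phi> (of_real s))) =
      \<phi> a + c (- int J - 1) - c (int J)" for J
  proof (induction J)
    case (Suc J)
    have "{- int (Suc J)..int (Suc J)} = insert (- int J - 1) (insert (int J + 1) {- int J..int J})"
      by auto
    then show ?case using Suc by (simp add: coeff add.commute)
  qed (simp add: coeff)
  have lim1: "(\<lambda>J. C / real (Suc J)) \<longlonglongrightarrow> 0"
    using LIMSEQ_Suc[OF lim_const_over_n[of C]] by simp
  have "(\<lambda>J. c (- int J - 1)) \<longlonglongrightarrow> 0"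
  proof (rule Lim_null_comparison[OF always_eventually lim1], rule allI)
    fix J
    have "norm (c (- int J - 1)) \<le> C / \<bar>real_of_int (- int J - 1)\<bar>" by (rule C) simp
    also have "\<bar>real_of_int (- int J - 1)\<bar> = real (Suc J)" by simp
    finally show "norm (c (- int J - 1)) \<le> C / real (Suc J)" .
  qed
  moreover have "(\<lambda>J. c (int J)) \<longlonglongrightarrow> 0"
  proof (rule LIMSEQ_imp_Suc, rule Lim_null_comparison[OF always_eventually lim1], rule allI)
    fix J
    show "norm (c (int (Suc J))) \<le> C / real (Suc J)" using C[of "int (Suc J)"] by simp
  qed
  ultimately have "(\<lambda>J. \<phi> a + c (- int J - 1) - c (int J)) \<longlonglongrightarrow> \<phi> a + 0 - 0"
    by (intro tendsto_intros)
  then have "(\<lambda>J. \<Sum>j = - int J..int J. integral {0..1} (\<lambda>s. E j s * \<phi> (of_real s))) \<longlonglongrightarrow> \<phi> a"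
    unfolding sums by simp
  then show ?thesis unfolding E_def a_def .
qed


text \<open>The values at \<open>0\<close> of the polynomials \<open>Q\<^sub>k\<close> below, determined by \<open>Q\<^sub>1 = 1 / (1 - e\<^sup>-\<^sup>x)\<close>,
  \<open>Q\<^sub>k\<^sub>+\<^sub>1' = Q\<^sub>k\<close> and \<open>Q\<^sub>k(1) = e\<^sup>x Q\<^sub>k(0)\<close> for \<open>k \<ge> 2\<close>.\<close>

fun per_coeff :: "complex \<Rightarrow> nat \<Rightarrow> complex" where
  "per_coeff x k = (if k = 0 then 0 else if k = 1 then inverse (1 - exp (- x))
    else (\<Sum>i\<in>{1..<k}. per_coeff x (k - i) / fact i) * (exp (- x) * inverse (1 - exp (- x))))"

declare per_coeff.simps [simp del]

text \<open>Taylor expansion at 0: the i-th derivative of the k-th polynomial is the (k - i)-th one.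
  The generating function is y e^(s y) / (1 - e^(y - x)); up to sign and the factor k! these are the
  Apostol-Bernoulli polynomials with parameter e^(-x).\<close>

definition per_poly :: "nat \<Rightarrow> complex \<Rightarrow> complex \<Rightarrow> complex" where
  "per_poly k x s = (\<Sum>i<k. per_coeff x (k - i) / fact i * s ^ i)"

lemma per_poly_deriv:
  "((\<lambda>s. per_poly (Suc k) x s) has_field_derivative per_poly k x s) (at s within A)"
proof -
  have "((\<lambda>s. \<Sum>i<Suc k. per_coeff x (Suc k - i) / fact i * s ^ i) has_field_derivative
     (\<Sum>i<Suc k. per_coeff x (Suc k - i) / fact i * (of_nat i * s ^ (i - 1)))) (at s within A)"
    by (intro DERIV_sum DERIV_cmult) (auto intro!: derivative_eq_intros)
  moreover have "(\<Sum>i<Suc k. per_coeff x (Suc k - i) / fact i * (of_nat i * s ^ (i - 1))) = per_poly k x s"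
    unfolding per_poly_def sum.lessThan_Suc_shift by (auto intro!: sum.cong simp: field_simps simp del: of_nat_Suc)
  ultimately show ?thesis by (simp add: per_poly_def)
qed

lemma per_poly_0: "per_poly k x 0 = per_coeff x k"
  by (cases k) (auto simp: per_poly_def sum.lessThan_Suc_shift per_coeff.simps)

text \<open>The recursion for \<open>per_coeff\<close>, read as a relation between the end values;
  \<open>T\<close> below is the increment of the polynomial over [0, 1]. The exceptional value 1 at
  k = 1 is a jump, the source of the first factor 1 / w in the Fourier coefficients.\<close>

lemma per_poly_boundary:
  assumes x: "exp x \<noteq> 1" and k: "k \<ge> 1"
  shows "per_poly k x 0 - exp (- x) * per_poly k x 1 = (if k = 1 then 1 else 0)"
proof (cases "k = 1")
  case True
  have "exp (- x) \<noteq> 1" using x by (simp add: exp_minus)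
  then show ?thesis using True by (simp add: per_poly_0) (simp add: per_poly_def per_coeff.simps field_simps)
next
  case False
  have ne: "exp (- x) \<noteq> 1" using x by (simp add: exp_minus)
  define T where "T = (\<Sum>i\<in>{1..<k}. per_coeff x (k - i) / fact i)"
  have a: "per_coeff x k = T * (exp (- x) * inverse (1 - exp (- x)))"
    using False k unfolding T_def by (subst per_coeff.simps) auto
  have "{..<k} = insert 0 {1..<k}" using k by auto
  then have "per_poly k x 1 = per_coeff x k + T"
    unfolding per_poly_def T_def by simp
  then show ?thesis using False ne by (simp add: per_poly_0 a divide_simps) (simp add: algebra_simps)
qed

text \<open>Integration by parts lowers k by one at the price of a factor 1 / w. Since e^(-w) =
  e^(-x), the boundary terms are those of \<open>per_poly_boundary\<close>, and they survive only
  when k = 1, where the remaining integrand is 0. For w = \<open>wint x j\<close> this says that the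
  terms of the series are the Fourier coefficients of e^(-s x) times the polynomial.\<close>

lemma per_poly_fourier:
  assumes w: "w \<noteq> 0" "exp w = exp x" and x: "exp x \<noteq> 1" and k: "k \<ge> 1"
  shows "integral {0..1} (\<lambda>s. exp (- (of_real s * w)) * per_poly k x (of_real s)) = inverse w ^ k"
  using k
proof (induction k rule: nat_induct_at_least[of 1])
  have step: "integral {0..1} (\<lambda>s. exp (- (of_real s * w)) * per_poly (Suc k) x (of_real s)) =
     integral {0..1} (\<lambda>s. exp (- (of_real s * w)) * per_poly k x (of_real s)) / w
     + (if Suc k = 1 then 1 else 0) / w" for k
  proof -
    define E where "E = (\<lambda>s::real. exp (- (of_real s * w)))"
    define Q where "Q = (\<lambda>k (s::real). per_poly k x (of_real s))"
    have c: "continuous_on A E" "continuous_on A (Q k)" for A k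
      unfolding E_def Q_def per_poly_def by (intro continuous_intros)+
    have "((\<lambda>z. - exp (- (z * w)) * per_poly (Suc k) x z / w) has_field_derivative
        exp (- (z * w)) * per_poly (Suc k) x z - exp (- (z * w)) * per_poly k x z / w) (at z)" for z
      using w by (auto intro!: derivative_eq_intros per_poly_deriv simp: divide_simps)
    then have "((\<lambda>s. E s * Q (Suc k) s - E s * Q k s / w) has_integral
        ((- E 1 * Q (Suc k) 1 / w) - (- E 0 * Q (Suc k) 0 / w))) {0..1}"
      unfolding E_def Q_def
      by (intro fundamental_theorem_of_calculus
          has_vector_derivative_real_field[THEN has_vector_derivative_at_within]) auto
    then have "integral {0..1} (\<lambda>s. E s * Q (Suc k) s - E s * Q k s / w) =
       (E 0 * Q (Suc k) 0 - E 1 * Q (Suc k) 1) / w"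
      by (simp add: integral_unique diff_divide_distrib)
    also have "\<dots> = (if Suc k = 1 then 1 else 0) / w"
      using per_poly_boundary[OF x, of "Suc k"] w(2) by (simp add: E_def Q_def exp_minus)
    also have "integral {0..1} (\<lambda>s. E s * Q (Suc k) s - E s * Q k s / w) =
       integral {0..1} (\<lambda>s. E s * Q (Suc k) s) - integral {0..1} (\<lambda>s. E s * Q k s) / w"
      by (subst integral_diff) (auto intro!: integrable_continuous_real continuous_intros c w)
    finally show ?thesis by (simp add: E_def Q_def algebra_simps)
  qed
  {
    case base
    show ?case using step[of 0] by (simp add: per_poly_def inverse_eq_divide)
  next
    case (Suc n)
    then show ?case using step[of n] by (simp add: field_simps)
  }
qed

section \<open>Values of the series between consecutive integers\<close>

lemma exp_wint: "exp (wint x j) = exp x"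
proof -
  have "exp (2 * of_real pi * \<i> * of_int j) = 1"
    unfolding exp_eq_1 by (auto intro!: exI[of _ j])
  then show ?thesis by (simp add: exp_add)
qed

lemma wint_nonzero_iff: "(\<forall>j. wint x j \<noteq> 0) \<longleftrightarrow> exp x \<noteq> 1"
proof
  assume "\<forall>j. wint x j \<noteq> 0"
  show "exp x \<noteq> 1"
  proof
    assume "exp x = 1"
    then obtain n :: int where n: "Re x = 0" "Im x = of_int (2 * n) * pi"
      unfolding exp_eq_1 by blast
    have "x = of_int (2 * n) * pi * \<i>"
      by (rule complex_eqI) (use n in auto)
    then have "wint x (- n) = 0" by simp
    with \<open>\<forall>j. wint x j \<noteq> 0\<close> show False by blast
  qed
next
  assume "exp x \<noteq> 1"
  then show "\<forall>j. wint x j \<noteq> 0" using exp_wint[of x] by (metis exp_zero)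
qed

text \<open>Fourier inversion yields only the limit of the symmetric partial sums. Because k \<ge>
  2, the family is absolutely summable and its unordered sum has to be that limit.\<close>

lemma sum_wint_unit:
  assumes x: "exp x \<noteq> 1" and k: "k \<ge> 2" and s: "0 < s" "s < (1::real)"
  shows "(\<Sum>\<^sub>\<infinity>j. exp (of_real s * wint x j) * inverse (wint x j) ^ k) = per_poly k x (of_real s)"
proof -
  have nz: "wint x j \<noteq> 0" for j using wint_nonzero_iff x by blast
  define \<phi> where "\<phi> = (\<lambda>z. exp (- (z * x)) * per_poly k x z)"
  have hol: "\<phi> holomorphic_on UNIV"
    unfolding \<phi>_def per_poly_def by (intro holomorphic_intros)
  define c where "c = (\<lambda>j. exp (2 * of_real pi * \<i> * of_int j * of_real s) * inverse (wint x j) ^ k)"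
  have "integral {0..1} (\<lambda>u. exp (- (2 * of_real pi * \<i> * of_int j * of_real (u - s))) * \<phi> (of_real u)) = c j"
    for j
  proof -
    have "exp (- (2 * of_real pi * \<i> * of_int j * of_real (u - s))) * \<phi> (of_real u) =
       exp (2 * of_real pi * \<i> * of_int j * of_real s) *
       (exp (- (of_real u * wint x j)) * per_poly k x (of_real u))" for u
      unfolding \<phi>_def by (simp add: mult.assoc[symmetric] exp_add[symmetric]) (simp add: algebra_simps)
    then show ?thesis
      using per_poly_fourier[OF nz exp_wint x, of k j] k by (simp add: c_def)
  qed
  then have lim: "(\<lambda>J. \<Sum>j = - int J..int J. c j) \<longlonglongrightarrow> \<phi> (of_real s)"
    using fourier_inversion[OF hol s] by simp
  have "norm (c j) = norm (inverse (wint x j) ^ k)" for j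
    unfolding c_def norm_mult norm_exp_eq_Re by simp
  then have "(\<lambda>j. norm (c j)) summable_on UNIV"
    using summable_wint[OF k] by simp
  then have "c summable_on UNIV" by (rule abs_summable_summable)
  then have "(c has_sum infsum c UNIV) UNIV" by simp
  \<comment> \<open>Every finite set of integers lies in all large symmetric intervals, so the
    unordered sum is also their limit.\<close>
  moreover have "filterlim (\<lambda>J. {- int J..int J}) (finite_subsets_at_top UNIV) sequentially"
    unfolding filterlim_finite_subsets_at_top
  proof (intro allI impI)
    fix X :: "int set" assume "finite X \<and> X \<subseteq> UNIV"
    then have B: "\<bar>j\<bar> \<le> (\<Sum>i\<in>X. \<bar>i\<bar>)" if "j \<in> X" for j
      using that by (intro member_le_sum) auto
    show "\<forall>\<^sub>F y in sequentially. finite {- int y..int y} \<and> X \<subseteq> {- int y..int y} \<and> {- int y..int y} \<subseteq> UNIV"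
      using eventually_ge_at_top[of "nat (\<Sum>i\<in>X. \<bar>i\<bar>)"]
    proof eventually_elim
      case (elim J)
      then show ?case using B by fastforce
    qed
  qed
  ultimately have "(\<lambda>J. \<Sum>j = - int J..int J. c j) \<longlonglongrightarrow> infsum c UNIV"
    unfolding has_sum_def by (rule filterlim_compose)
  then have "infsum c UNIV = \<phi> (of_real s)"
    using lim LIMSEQ_unique by blast
  moreover have "exp (of_real s * wint x j) * inverse (wint x j) ^ k = exp (of_real s * x) * c j" for j
    unfolding c_def by (simp add: mult.assoc[symmetric] exp_add[symmetric]) (simp add: algebra_simps)
  ultimately show ?thesis
    by (simp add: infsum_cmult_right' \<phi>_def mult.assoc[symmetric] exp_add[symmetric])
qed

text \<open>Lowering s by the integer l divides every term by the same number, since e^(l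
  \<open>wint x j\<close>) = e^(l x) for all j.\<close>

lemma sum_wint:
  assumes x: "exp x \<noteq> 1" and k: "k \<ge> 2" and s: "of_int l < s" "s < of_int l + (1::real)"
  shows "(\<Sum>\<^sub>\<infinity>j. exp (of_real s * wint x j) * inverse (wint x j) ^ k) =
    exp (of_int l * x) * per_poly k x (of_real s - of_int l)"
proof -
  have "exp (of_real s * wint x j) = exp (of_int l * x) * exp (of_real (s - of_int l) * wint x j)" for j
  proof -
    have "exp (2 * of_real pi * \<i> * of_int (l * j)) = 1"
      unfolding exp_eq_1 by (auto intro!: exI[of _ "l * j"])
    then have "exp (of_int l * x) = exp (of_int l * wint x j)"
      by (simp add: distrib_left exp_add mult_ac)
    then show ?thesis by (simp add: exp_add[symmetric] algebra_simps)
  qed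
  then have "(\<Sum>\<^sub>\<infinity>j. exp (of_real s * wint x j) * inverse (wint x j) ^ k) =
    (\<Sum>\<^sub>\<infinity>j. exp (of_int l * x) * (exp (of_real (s - of_int l) * wint x j) * inverse (wint x j) ^ k))"
    by (simp add: mult.assoc)
  also have "\<dots> = exp (of_int l * x) * per_poly k x (of_real (s - of_int l))"
    by (subst infsum_cmult_right', subst sum_wint_unit[OF x k]) (use s in auto)
  finally show ?thesis by simp
qed

section \<open>Lattices\<close>

text \<open>The dual basis is indexed by the basis vectors themselves. As the dot product serves as
  the pairing, \<open>d b\<close> is a vector of V when b is a linear form, and conversely.\<close>

definition dual_family :: "(real^'n) set \<Rightarrow> (real^'n \<Rightarrow> real^'n) \<Rightarrow> bool" where
  "dual_family B d \<longleftrightarrow> finite B \<and> (\<forall>b\<in>B. \<forall>b'\<in>B. d b \<bullet> b' = (if b = b' then 1 else 0)) \<and>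
     (\<forall>x. (\<Sum>b\<in>B. (d b \<bullet> x) *\<^sub>R b) = x)"

lemma dual_family_exists:
  fixes B :: "(real^'n) set"
  assumes B: "independent B" "span B = UNIV"
  shows "\<exists>d. dual_family B d"
proof -
  have fin: "finite B" using B independent_bound by blast
  have "\<exists>v. \<forall>b'\<in>B. v \<bullet> b' = (if b = b' then 1 else 0)" for b
  proof -
    obtain g :: "real^'n \<Rightarrow> real" where g: "linear g" "\<forall>x\<in>B. g x = (if b = x then 1 else 0)"
      using linear_independent_extend[OF B(1), of "\<lambda>x. if b = x then 1 else 0 :: real"] by blast
    have "adjoint g 1 \<bullet> x = g x" for x
      using adjoint_works[OF g(1), of x 1] by (simp add: inner_commute)
    then show ?thesis using g by metis
  qed
  then obtain d where d: "\<And>b b'. b' \<in> B \<Longrightarrow> d b \<bullet> b' = (if b = b' then 1 else 0)" by metis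
  have "(\<Sum>b\<in>B. (d b \<bullet> x) *\<^sub>R b) = x" for x
  proof (rule linear_eq_on_span[where B = B])
    show "linear (\<lambda>x. \<Sum>b\<in>B. (d b \<bullet> x) *\<^sub>R b)"
      by (intro linear_compose_sum ballI linearI) (auto simp: inner_add_right algebra_simps)
    show "linear (\<lambda>x :: real^'n. x)" by (rule linear_id[unfolded id_def])
    show "(\<Sum>b\<in>B. (d b \<bullet> x) *\<^sub>R b) = x" if "x \<in> B" for x
    proof -
      have "(\<Sum>b\<in>B. (d b \<bullet> x) *\<^sub>R b) = (\<Sum>b\<in>B. if b = x then b else 0)"
        by (rule sum.cong) (use d[OF that] in auto)
      then show ?thesis using fin that by simp
    qed
  qed (use B in auto)
  then show ?thesis using d fin unfolding dual_family_def by blast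
qed

lemma dual_family_expand:
  assumes "dual_family B d" shows "(\<Sum>b\<in>B. (d b \<bullet> x) *\<^sub>R b) = x"
  using assms unfolding dual_family_def by blast

lemma dual_family_delta:
  assumes "dual_family B d" "b \<in> B" "b' \<in> B" shows "d b \<bullet> b' = (if b = b' then 1 else 0)"
  using assms unfolding dual_family_def by blast

lemma dual_family_finite: "dual_family B d \<Longrightarrow> finite B"
  unfolding dual_family_def by blast

lemma dual_family_inner:
  assumes "dual_family B d" shows "x \<bullet> y = (\<Sum>b\<in>B. (d b \<bullet> x) * (b \<bullet> y))"
proof -
  have "x \<bullet> y = (\<Sum>b\<in>B. (d b \<bullet> x) *\<^sub>R b) \<bullet> y" by (simp add: dual_family_expand[OF assms])
  then show ?thesis by (simp add: inner_sum_left)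
qed

lemma dual_family_inner_sum:
  assumes "dual_family B d" "b \<in> B"
  shows "b \<bullet> (\<Sum>a\<in>B. c a *\<^sub>R d a) = c b" and "d b \<bullet> (\<Sum>a\<in>B. c a *\<^sub>R a) = c b"
proof -
  have fin: "finite B" using assms dual_family_finite by blast
  have "b \<bullet> (\<Sum>a\<in>B. c a *\<^sub>R d a) = (\<Sum>a\<in>B. if a = b then c a else 0)"
    unfolding inner_sum_right
    by (rule sum.cong) (use dual_family_delta[OF assms(1) _ assms(2)] in \<open>auto simp: inner_commute\<close>)
  then show "b \<bullet> (\<Sum>a\<in>B. c a *\<^sub>R d a) = c b" using fin assms by simp
  have "d b \<bullet> (\<Sum>a\<in>B. c a *\<^sub>R a) = (\<Sum>a\<in>B. if a = b then c a else 0)"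
    unfolding inner_sum_right
    by (rule sum.cong) (use dual_family_delta[OF assms(1,2)] in auto)
  then show "d b \<bullet> (\<Sum>a\<in>B. c a *\<^sub>R a) = c b" using fin assms by simp
qed

lemma dual_family_eqI:
  assumes "dual_family B d" "\<And>b. b \<in> B \<Longrightarrow> b \<bullet> x = b \<bullet> y"
  shows "x = y"
proof -
  have "z \<bullet> x = z \<bullet> y" for z
    unfolding dual_family_inner[OF assms(1), of z] by (rule sum.cong) (use assms in auto)
  then show ?thesis by (metis vector_eq_ldot)
qed

text \<open>Division with remainder: a - \<lfloor>a / c\<rfloor> c lies in the subgroup and in [0,
  c), so it is 0 by minimality of c.\<close>

lemma subgroup_least_multiple:
  fixes A :: "real set"
  assumes diff: "\<And>a b. a \<in> A \<Longrightarrow> b \<in> A \<Longrightarrow> a - b \<in> A"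
    and c: "c \<in> A" "0 < c" and least: "\<And>a. a \<in> A \<Longrightarrow> 0 < a \<Longrightarrow> c \<le> a"
    and a: "a \<in> A"
  shows "\<exists>l::int. a = of_int l * c"
proof -
  have z: "0 \<in> A" using diff[OF c(1) c(1)] by simp
  then have neg: "- b \<in> A" if "b \<in> A" for b using diff[OF z that] by simp
  have add: "b + b' \<in> A" if "b \<in> A" "b' \<in> A" for b b' using diff[OF that(1) neg[OF that(2)]] by simp
  have nat: "of_nat n * c \<in> A" for n
    by (induction n) (auto simp: z distrib_right add c)
  then have mult: "of_int l * c \<in> A" for l
  proof (cases l rule: int_cases2)
    case (nonneg n)
    then show ?thesis using nat[of n] by simp
  next
    case (nonpos n)
    then show ?thesis using neg[OF nat[of n]] by simp
  qed
  define l where "l = \<lfloor>a / c\<rfloor>"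
  have "a - of_int l * c \<in> A" using diff[OF a mult] .
  moreover have "of_int l * c \<le> a" "a < of_int l * c + c"
    using c(2) floor_divide_lower[of c a] floor_divide_upper[of c a] unfolding l_def
    by (auto simp: algebra_simps)
  ultimately have "a - of_int l * c = 0"
    using least[of "a - of_int l * c"] by fastforce
  then show ?thesis by (intro exI[of _ l]) simp
qed

section \<open>A lattice and its dual\<close>

locale lattice_pair =
  fixes N :: "(real^'n) set"
  assumes lattice: "lattice_in N"
begin

abbreviation M :: "(real^'n) set" where "M \<equiv> dual_lattice N"

lemma lattice_basis:
  "\<exists>B d. dual_family B d \<and> (\<forall>x. (\<forall>b\<in>B. d b \<bullet> x \<in> \<int>) \<longrightarrow> x \<in> N) \<and> B \<subseteq> N \<and> d ` B \<subseteq> M"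
proof -
  obtain B where B: "independent B" "span B = UNIV"
    "N = range (\<lambda>a :: real^'n \<Rightarrow> int. \<Sum>b\<in>B. of_int (a b) *\<^sub>R b)"
    using lattice unfolding lattice_in_def by blast
  obtain d where d: "dual_family B d" using dual_family_exists[OF B(1,2)] by blast
  have N: "N = {x. \<forall>b\<in>B. d b \<bullet> x \<in> \<int>}"
  proof (intro set_eqI iffI)
    fix x assume "x \<in> N"
    then show "x \<in> {x. \<forall>b\<in>B. d b \<bullet> x \<in> \<int>}"
      using dual_family_inner_sum(2)[OF d] unfolding B(3) by auto
  next
    fix x assume "x \<in> {x. \<forall>b\<in>B. d b \<bullet> x \<in> \<int>}"
    then have "(\<Sum>b\<in>B. of_int \<lfloor>d b \<bullet> x\<rfloor> *\<^sub>R b) = (\<Sum>b\<in>B. (d b \<bullet> x) *\<^sub>R b)"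
      by (intro sum.cong) (auto simp: of_int_floor)
    then have "x = (\<Sum>b\<in>B. of_int \<lfloor>d b \<bullet> x\<rfloor> *\<^sub>R b)"
      by (simp add: dual_family_expand[OF d])
    then show "x \<in> N" unfolding B(3) by (rule range_eqI[where x = "\<lambda>b. \<lfloor>d b \<bullet> x\<rfloor>"])
  qed
  have BN: "B \<subseteq> N" unfolding N using dual_family_delta[OF d] by auto
  have dM: "d ` B \<subseteq> M" unfolding dual_lattice_def using N by auto
  show ?thesis using d BN dM N by (intro exI[of _ B] exI[of _ d]) simp
qed

lemma M_int: "m \<in> M \<Longrightarrow> n \<in> N \<Longrightarrow> m \<bullet> n \<in> \<int>"
  unfolding dual_lattice_def by blast

lemma M_diff: "a \<in> M \<Longrightarrow> b \<in> M \<Longrightarrow> a - b \<in> M"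
  and M_add: "a \<in> M \<Longrightarrow> b \<in> M \<Longrightarrow> a + b \<in> M"
  and M_minus: "a \<in> M \<Longrightarrow> - a \<in> M"
  and M_zero: "0 \<in> M"
  and M_scale: "a \<in> M \<Longrightarrow> of_int l *\<^sub>R a \<in> M"
  unfolding dual_lattice_def by (auto simp: inner_diff_left inner_add_left)

lemma M_sum: "(\<And>i. i \<in> I \<Longrightarrow> g i \<in> M) \<Longrightarrow> sum g I \<in> M"
  unfolding dual_lattice_def by (auto simp: inner_sum_left)

text \<open>The coordinate forms of a basis of \<open>N\<close> belong to \<open>M\<close>, so
  integrality against \<open>M\<close> includes integrality of all coordinates.\<close>

lemma double_dual:
  assumes "\<And>m. m \<in> M \<Longrightarrow> m \<bullet> y \<in> \<int>" shows "y \<in> N"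
proof -
  obtain B d where "dual_family B d" and N: "\<And>x. (\<forall>b\<in>B. d b \<bullet> x \<in> \<int>) \<Longrightarrow> x \<in> N" and "d ` B \<subseteq> M"
    using lattice_basis by metis
  then show ?thesis using assms by (intro N) auto
qed

lemma N_add: "a \<in> N \<Longrightarrow> b \<in> N \<Longrightarrow> a + b \<in> N"
  and N_diff: "a \<in> N \<Longrightarrow> b \<in> N \<Longrightarrow> a - b \<in> N"
  by (auto intro!: double_dual simp: inner_add_right inner_diff_right M_int)

lemma N_scale: "a \<in> N \<Longrightarrow> of_int l *\<^sub>R a \<in> N"
  by (auto intro!: double_dual simp: M_int)

lemma span_M: "span M = UNIV"
proof -
  obtain B d where d: "dual_family B d" "d ` B \<subseteq> M"
    using lattice_basis by blast
  have "x = (\<Sum>b\<in>B. (b \<bullet> x) *\<^sub>R d b)" for x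
    by (rule dual_family_eqI[OF d(1)]) (simp add: dual_family_inner_sum[OF d(1)])
  then have "x \<in> span M" for x
    using d(2) by (metis (no_types, lifting) image_subset_iff span_base span_scale span_sum)
  then show ?thesis by blast
qed

lemma extend_basis:
  assumes "K \<subseteq> M" "independent K"
  obtains B d where "K \<subseteq> B" "B \<subseteq> M" "independent B" "span B = UNIV" "dual_family B d"
proof -
  obtain B where B: "K \<subseteq> B" "B \<subseteq> M" "independent B" "M \<subseteq> span B"
    using maximal_independent_subset_extend[OF assms] by blast
  then have "span B = UNIV" using span_M by (metis span_mono span_span top.extremum_unique)
  then show ?thesis using that B dual_family_exists by metis
qed

text \<open>The values of a on \<open>N\<close> form a nonzero subgroup of the integers, generated
  by some k > 0. Then a / k is still integral on \<open>N\<close>, hence in \<open>M\<close>, and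
  indivisibility gives k = 1.\<close>

lemma indivisible_surj:
  assumes a: "a \<in> M" "a \<noteq> 0" and ind: "indivisible_in M a"
  shows "\<exists>n\<in>N. a \<bullet> n = of_int j"
proof -
  obtain B d where d: "dual_family B d" "B \<subseteq> N" using lattice_basis by blast
  define A where "A = (\<lambda>n. a \<bullet> n) ` N"
  have AZ: "x \<in> \<int>" if "x \<in> A" for x using that a M_int by (auto simp: A_def)
  have diff: "x - y \<in> A" if "x \<in> A" "y \<in> A" for x y
    using that N_diff unfolding A_def by (auto simp: image_iff) (metis inner_diff_right)
  have "\<exists>b\<in>B. a \<bullet> b \<noteq> 0"
    using dual_family_eqI[OF d(1), of a 0] a by (metis inner_commute inner_zero_left)
  then obtain x0 where x0: "x0 \<in> A" "x0 \<noteq> 0" using d(2) by (auto simp: A_def)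
  have zA: "0 \<in> A" using diff[OF x0(1) x0(1)] by simp
  define P where "P = (\<lambda>k::nat. 0 < k \<and> real k \<in> A)"
  have "\<exists>k. P k"
  proof -
    have "\<bar>x0\<bar> \<in> A" using x0 diff[OF zA x0(1)] by (cases "x0 \<ge> 0") auto
    moreover obtain l :: int where "x0 = of_int l" using AZ[OF x0(1)] Ints_cases by blast
    ultimately have "P (nat \<bar>l\<bar>)" using x0 by (auto simp: P_def)
    then show ?thesis by blast
  qed
  define k where "k = (LEAST k. P k)"
  have k: "P k" and least: "\<And>l. P l \<Longrightarrow> k \<le> l"
    unfolding k_def using \<open>\<exists>k. P k\<close> by (auto intro: LeastI_ex Least_le)
  have mult: "\<exists>l::int. x = of_int l * real k" if "x \<in> A" for x
  proof (rule subgroup_least_multiple[OF diff])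
    fix y assume y: "y \<in> A" "0 < y"
    then obtain l :: int where "y = of_int l" using AZ Ints_cases by blast
    with y have "P (nat l)" by (auto simp: P_def)
    then show "real k \<le> y" using least \<open>y = of_int l\<close> y by fastforce
  qed (use k that in \<open>auto simp: P_def\<close>)
  have "(1 / real k) *\<^sub>R a \<in> M"
    unfolding dual_lattice_def
  proof (intro CollectI ballI)
    fix n assume "n \<in> N"
    then have "a \<bullet> n \<in> A" by (simp add: A_def)
    then show "((1 / real k) *\<^sub>R a) \<bullet> n \<in> \<int>" using mult[of "a \<bullet> n"] k by (auto simp: P_def)
  qed
  moreover have "a = of_int (int k) *\<^sub>R ((1 / real k) *\<^sub>R a)" using k by (simp add: P_def)
  ultimately have "\<bar>int k\<bar> = 1" using ind unfolding indivisible_in_def by blast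
  then have "1 \<in> A" using k by (simp add: P_def)
  then obtain n where n: "n \<in> N" "a \<bullet> n = 1" by (auto simp: A_def)
  then show ?thesis using N_scale[OF n(1), of j] by (intro bexI[of _ "of_int j *\<^sub>R n"]) auto
qed

text \<open>For a basis K contained in \<open>M\<close>, the points of \<open>M\<close> in the
  half-open parallelepiped of K: one representative for each class of \<open>M\<close> modulo
  \<int>K.\<close>

definition reps :: "(real^'n) set \<Rightarrow> (real^'n \<Rightarrow> real^'n) \<Rightarrow> (real^'n) set" where
  "reps K d = {m \<in> M. \<forall>a\<in>K. 0 \<le> d a \<bullet> m \<and> d a \<bullet> m < 1}"

definition red :: "(real^'n) set \<Rightarrow> (real^'n \<Rightarrow> real^'n) \<Rightarrow> real^'n \<Rightarrow> real^'n" where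
  "red K d m = m - (\<Sum>a\<in>K. of_int \<lfloor>d a \<bullet> m\<rfloor> *\<^sub>R a)"

lemma red_coord:
  assumes "dual_family K d" "a \<in> K" shows "d a \<bullet> red K d m = frac (d a \<bullet> m)"
  unfolding red_def inner_diff_right dual_family_inner_sum(2)[OF assms] frac_def ..

lemma red_in_reps:
  assumes "dual_family K d" "K \<subseteq> M" "m \<in> M" shows "red K d m \<in> reps K d"
proof -
  have "red K d m \<in> M"
    unfolding red_def using assms by (intro M_diff M_sum M_scale) auto
  then show ?thesis unfolding reps_def using red_coord[OF assms(1)] frac_lt_1 by auto
qed

text \<open>Coordinates in [0, 1) bound the value of m on each vector b of a lattice basis of
  \<open>N\<close> by \<open>L b\<close>. These values are integers and determine m.\<close>

lemma finite_reps:
  assumes "dual_family K d" shows "finite (reps K d)"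
proof -
  obtain B e where B: "dual_family B e" "B \<subseteq> N" using lattice_basis by blast
  define L where "L = (\<lambda>b. \<Sum>a\<in>K. \<bar>a \<bullet> b\<bar>)"
  define h where "h = (\<lambda>m. \<lambda>b\<in>B. \<lfloor>m \<bullet> b\<rfloor>)"
  have fin: "finite (PiE B (\<lambda>b. {- \<lceil>L b\<rceil> - 1..\<lceil>L b\<rceil> + 1}))"
    by (intro finite_PiE dual_family_finite[OF B(1)]) auto
  have "h ` reps K d \<subseteq> PiE B (\<lambda>b. {- \<lceil>L b\<rceil> - 1..\<lceil>L b\<rceil> + 1})"
  proof (rule image_subsetI)
    fix m assume m: "m \<in> reps K d"
    have bound: "\<bar>m \<bullet> b\<bar> \<le> L b" for b
    proof -
      have "\<bar>m \<bullet> b\<bar> \<le> (\<Sum>a\<in>K. \<bar>(d a \<bullet> m) * (a \<bullet> b)\<bar>)"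
        unfolding dual_family_inner[OF assms, of m b] by (rule sum_abs)
      also have "\<dots> \<le> L b"
        unfolding L_def abs_mult
        by (intro sum_mono mult_left_le_one_le) (use m in \<open>auto simp: reps_def\<close>)
      finally show ?thesis .
    qed
    have "- \<lceil>L b\<rceil> - 1 \<le> \<lfloor>m \<bullet> b\<rfloor>" "\<lfloor>m \<bullet> b\<rfloor> \<le> \<lceil>L b\<rceil> + 1" for b
    proof -
      have "\<lfloor>- L b\<rfloor> \<le> \<lfloor>m \<bullet> b\<rfloor>" "\<lfloor>m \<bullet> b\<rfloor> \<le> \<lfloor>L b\<rfloor>"
        using bound[of b] by (intro floor_mono; simp add: abs_le_iff)+
      moreover have "\<lfloor>L b\<rfloor> \<le> \<lceil>L b\<rceil>" by (rule floor_le_ceiling)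
      ultimately show "- \<lceil>L b\<rceil> - 1 \<le> \<lfloor>m \<bullet> b\<rfloor>" "\<lfloor>m \<bullet> b\<rfloor> \<le> \<lceil>L b\<rceil> + 1"
        unfolding floor_minus by linarith+
    qed
    then show "h m \<in> PiE B (\<lambda>b. {- \<lceil>L b\<rceil> - 1..\<lceil>L b\<rceil> + 1})" by (auto simp: h_def)
  qed
  then have "finite (h ` reps K d)" using fin finite_subset by blast
  moreover have "inj_on h (reps K d)"
  proof (rule inj_onI)
    fix m m' assume m: "m \<in> reps K d" "m' \<in> reps K d" "h m = h m'"
    show "m = m'"
    proof (rule dual_family_eqI[OF B(1)])
      fix b assume b: "b \<in> B"
      then have "\<lfloor>m \<bullet> b\<rfloor> = \<lfloor>m' \<bullet> b\<rfloor>" using fun_cong[OF m(3), of b] by (simp add: h_def)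
      moreover have "m \<bullet> b \<in> \<int>" "m' \<bullet> b \<in> \<int>" using m b B M_int by (auto simp: reps_def)
      ultimately show "b \<bullet> m = b \<bullet> m'" by (metis inner_commute of_int_floor)
    qed
  qed
  ultimately show ?thesis using finite_imageD by blast
qed

lemma zero_in_reps: "0 \<in> reps K d"
  by (simp add: reps_def M_zero)

lemma cis_2pi_int: "x \<in> \<int> \<Longrightarrow> cis (2 * pi * x) = 1"
  by (rule cis_multiple_2pi)

text \<open>Orthogonality for the finite group \<open>M\<close> / \<int>K, on which y defines a
  character because it is integral on K. If y is not in \<open>N\<close>, some m0 in
  \<open>M\<close> has a nontrivial character value; translation by m0 permutes the representatives
  and multiplies the sum by this value, so the sum is 0.\<close>

lemma sum_characters:
  assumes K: "dual_family K d" "K \<subseteq> M"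
    and y: "\<And>a. a \<in> K \<Longrightarrow> a \<bullet> y \<in> \<int>"
  shows "(\<Sum>m\<in>reps K d. cis (2 * pi * (m \<bullet> y))) = (if y \<in> N then of_nat (card (reps K d)) else 0)"
proof (cases "y \<in> N")
  case True
  then have "cis (2 * pi * (m \<bullet> y)) = 1" if "m \<in> reps K d" for m
    using that M_int by (intro cis_2pi_int) (auto simp: reps_def)
  then show ?thesis using True by simp
next
  case False
  then obtain m0 where m0: "m0 \<in> M" "m0 \<bullet> y \<notin> \<int>" using double_dual by blast
  define \<sigma> where "\<sigma> = (\<lambda>m. red K d (m + m0))"
  let ?e = "\<lambda>m. cis (2 * pi * (m \<bullet> y))"
  have fin: "finite (reps K d)" using finite_reps K by blast
  have \<sigma>G: "\<sigma> ` reps K d \<subseteq> reps K d"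
    unfolding \<sigma>_def using red_in_reps[OF K] M_add m0(1) by (auto simp: reps_def)
  have inj: "inj_on \<sigma> (reps K d)"
  proof (rule inj_onI)
    fix m m' assume m: "m \<in> reps K d" "m' \<in> reps K d" "\<sigma> m = \<sigma> m'"
    have "d a \<bullet> m = d a \<bullet> m'" if a: "a \<in> K" for a
    proof -
      have "frac (d a \<bullet> m + d a \<bullet> m0) = frac (d a \<bullet> m' + d a \<bullet> m0)"
        using arg_cong[OF m(3), of "\<lambda>x. d a \<bullet> x"] red_coord[OF K(1) a]
        by (simp add: \<sigma>_def inner_add_right)
      moreover define l where "l = \<lfloor>d a \<bullet> m + d a \<bullet> m0\<rfloor> - \<lfloor>d a \<bullet> m' + d a \<bullet> m0\<rfloor>"
      ultimately have l: "d a \<bullet> m - d a \<bullet> m' = of_int l"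
        by (simp add: frac_def)
      moreover have "\<bar>d a \<bullet> m - d a \<bullet> m'\<bar> < 1"
        using m a by (fastforce simp: reps_def)
      ultimately have "l = 0" by (simp flip: of_int_abs)
      with l show ?thesis by simp
    qed
    then have "(\<Sum>a\<in>K. (d a \<bullet> m) *\<^sub>R a) = (\<Sum>a\<in>K. (d a \<bullet> m') *\<^sub>R a)" by simp
    then show "m = m'" by (simp add: dual_family_expand[OF K(1)])
  qed
  then have bij: "bij_betw \<sigma> (reps K d) (reps K d)"
    using endo_inj_surj[OF fin \<sigma>G inj] by (simp add: bij_betw_def)
  have e\<sigma>: "?e (\<sigma> m) = ?e m0 * ?e m" for m
  proof -
    define l where "l = (\<Sum>a\<in>K. of_int \<lfloor>d a \<bullet> (m + m0)\<rfloor> * (a \<bullet> y))"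
    have l: "\<sigma> m \<bullet> y = m0 \<bullet> y + m \<bullet> y - l"
      unfolding \<sigma>_def red_def l_def by (simp add: inner_diff_left inner_sum_left inner_add_left)
    have lZ: "l \<in> \<int>"
      unfolding l_def using y by (intro Ints_sum Ints_mult) auto
    have "?e (\<sigma> m) = cis (2 * pi * (m0 \<bullet> y) + 2 * pi * (m \<bullet> y) - 2 * pi * l)"
      by (simp add: l algebra_simps)
    also have "\<dots> = ?e m0 * ?e m"
      using cis_2pi_int[OF lZ] by (simp add: cis_mult cis_divide[symmetric])
    finally show ?thesis .
  qed
  have "?e m0 \<noteq> 1"
  proof
    assume "?e m0 = 1"
    then have "exp (\<i> * complex_of_real (2 * pi * (m0 \<bullet> y))) = 1" by (simp add: cis_conv_exp)
    then obtain n :: int where "2 * pi * (m0 \<bullet> y) = of_int (2 * n) * pi"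
      unfolding exp_eq_1 by auto
    then have "m0 \<bullet> y = of_int n" by simp
    with m0(2) show False by simp
  qed
  moreover have "sum ?e (reps K d) = ?e m0 * sum ?e (reps K d)"
    using sum.reindex_bij_betw[OF bij, of ?e] by (simp add: e\<sigma> sum_distrib_left)
  ultimately show ?thesis using False by simp
qed

text \<open>Extend K by one element \<beta> of \<open>M\<close> to a basis. The dual vector
  \<open>d \<beta>\<close> vanishes on K and takes on \<open>M\<close> the multiples of a least
  positive number c; dividing it by c makes its values on \<open>M\<close> exactly the integers, so
  the quotient lies in \<open>N\<close>.\<close>

lemma primitive_normal:
  assumes K: "K \<subseteq> M" "independent K" "card K + 1 = CARD('n)"
  obtains x where "x \<in> N" "\<And>a. a \<in> K \<Longrightarrow> a \<bullet> x = 0" "\<exists>m\<in>M. m \<bullet> x = 1"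
    "\<And>t. t \<bullet> x = 0 \<Longrightarrow> t \<in> span K"
proof -
  obtain B d where B: "K \<subseteq> B" "B \<subseteq> M" "independent B" "span B = UNIV" "dual_family B d"
    using extend_basis[OF K(1,2)] by blast
  have finB: "finite B" using B dual_family_finite by blast
  have "card B = CARD('n)"
    using B(3,4) by (metis DIM_cart DIM_real basis_card_eq_dim dim_UNIV mult.right_neutral top_greatest)
  then have "card (B - K) = 1" using K(3) B(1) finB by (simp add: card_Diff_subset finite_subset)
  then obtain \<beta> where \<beta>: "B - K = {\<beta>}" by (auto simp: card_1_singleton_iff)
  then have \<beta>B: "\<beta> \<in> B" "\<beta> \<notin> K" "B = insert \<beta> K" using B(1) by auto
  define A where "A = (\<lambda>m. d \<beta> \<bullet> m) ` M"
  \<comment> \<open>The value 1 is attained at \<beta>. Any value in (0, 1) is unchanged by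
    reduction modulo \<int>B, hence attained on the finite set \<open>reps B d\<close>; so this
    minimum is the least positive value on all of \<open>M\<close>.\<close>
  define c where "c = Min (insert 1 {v \<in> (\<lambda>m. d \<beta> \<bullet> m) ` reps B d. 0 < v})"
  have fin: "finite (insert 1 {v \<in> (\<lambda>m. d \<beta> \<bullet> m) ` reps B d. 0 < v})"
    using finite_reps[OF B(5)] by simp
  have c_in: "c \<in> insert 1 {v \<in> (\<lambda>m. d \<beta> \<bullet> m) ` reps B d. 0 < v}"
    unfolding c_def by (rule Min_in[OF fin]) simp
  have "1 \<in> A" using dual_family_delta[OF B(5) \<beta>B(1) \<beta>B(1)] B(2) \<beta>B(1) by (force simp: A_def)
  then have cA: "c \<in> A" "0 < c" using c_in by (auto simp: A_def reps_def)
  have diff: "x - y \<in> A" if "x \<in> A" "y \<in> A" for x y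
    using that M_diff unfolding A_def by (auto simp: image_iff) (metis inner_diff_right)
  have least: "c \<le> v" if v: "v \<in> A" "0 < v" for v
  proof (cases "v < 1")
    case False
    have "c \<le> 1" unfolding c_def by (rule Min_le[OF fin]) simp
    then show ?thesis using False by simp
  next
    case True
    obtain m where m: "m \<in> M" "v = d \<beta> \<bullet> m" using v by (auto simp: A_def)
    have "d \<beta> \<bullet> red B d m = v"
      using red_coord[OF B(5) \<beta>B(1), of m] True v(2) m(2) by (simp add: frac_eq)
    then have "v \<in> (\<lambda>m. d \<beta> \<bullet> m) ` reps B d" using red_in_reps[OF B(5,2) m(1)] by force
    then show ?thesis unfolding c_def using v by (intro Min_le[OF fin]) auto
  qed
  define x where "x = (1 / c) *\<^sub>R d \<beta>"
  have xm: "m \<bullet> x \<in> \<int>" if "m \<in> M" for m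
  proof -
    have "d \<beta> \<bullet> m \<in> A" using that by (simp add: A_def)
    then obtain l :: int where "d \<beta> \<bullet> m = of_int l * c"
      using subgroup_least_multiple[OF diff cA least] by blast
    then have "m \<bullet> x = of_int l" using cA(2) by (simp add: x_def inner_commute)
    then show ?thesis by simp
  qed
  show ?thesis
  proof (rule that)
    show "x \<in> N" using xm by (rule double_dual)
    show "a \<bullet> x = 0" if "a \<in> K" for a
      using dual_family_delta[OF B(5) \<beta>B(1), of a] that \<beta>B by (auto simp: x_def inner_commute)
    show "\<exists>m\<in>M. m \<bullet> x = 1" using cA by (auto simp: A_def x_def inner_commute)
    show "t \<in> span K" if t: "t \<bullet> x = 0" for t
    proof -
      have "d \<beta> \<bullet> t = 0" using t cA(2) by (simp add: x_def inner_commute)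
      then have "t = (\<Sum>b\<in>K. (d b \<bullet> t) *\<^sub>R b)"
        using dual_family_expand[OF B(5), of t] finB \<beta>B by simp
      then show ?thesis by (metis (no_types, lifting) span_base span_scale span_sum)
    qed
  qed
qed

end

section \<open>Test functions and integration by parts\<close>

lemma pairing_add_left: "pairing (s + t) z = pairing s z + pairing t z"
  and pairing_add_right: "pairing t (z + w) = pairing t z + pairing t w"
  and pairing_scaleR_left: "pairing (c *\<^sub>R t) z = of_real c * pairing t z"
  and pairing_scale_right: "pairing t (a *s z) = a * pairing t z"
  and pairing_minus_left: "pairing (- t) z = - pairing t z"
  and pairing_zero_left [simp]: "pairing 0 z = 0"
  by (simp_all add: pairing_def algebra_simps sum.distrib sum_distrib_left sum_negf)

lemma pairing_sum_left: "pairing (sum g I) z = (\<Sum>i\<in>I. pairing (g i) z)"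
  by (induction I rule: infinite_finite_induct) (auto simp: pairing_add_left)

lemma pairing_of_real: "pairing t (\<chi> i. of_real (n $ i)) = of_real (t \<bullet> n)"
  by (simp add: pairing_def inner_vec_def)

lemma pairing_shift: "pairing t (shift z n) = pairing t z + 2 * of_real pi * \<i> * of_real (t \<bullet> n)"
  by (simp add: shift_def pairing_add_right pairing_scale_right pairing_of_real)

lemma bounded_linear_pairing_right: "bounded_linear (\<lambda>z. pairing t z)"
  unfolding pairing_def
  by (intro bounded_linear_sum bounded_linear_compose[OF bounded_linear_mult_right]
      bounded_linear_vec_nth)

lemma bounded_linear_pairing_left: "bounded_linear (\<lambda>t. pairing t z)"
  unfolding pairing_def
  by (intro bounded_linear_sum bounded_linear_compose[OF bounded_linear_mult_left]
      bounded_linear_compose[OF bounded_linear_of_real] bounded_linear_vec_nth)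

section \<open>Integrals of directional derivatives\<close>

lemma integrable_compact_support:
  fixes h :: "'a::euclidean_space \<Rightarrow> 'b::{banach, second_countable_topology}"
  assumes "continuous_on UNIV h" "compact K" "\<And>t. t \<notin> K \<Longrightarrow> h t = 0"
  shows "integrable lborel h"
proof -
  have "integrable lborel (\<lambda>t. indicator K t *\<^sub>R h t)"
    using assms by (intro borel_integrable_compact) (auto intro: continuous_on_subset)
  moreover have "(\<lambda>t. indicator K t *\<^sub>R h t) = h"
    using assms(3) by (auto simp: indicator_def)
  ultimately show ?thesis by simp
qed

text \<open>By translation invariance of Lebesgue measure every difference quotient of h along v has
  integral 0. The mean value inequality bounds the quotients by B on one fixed compact set, and
  dominated convergence passes to \<open>h'\<close>.\<close>

lemma integral_directional_derivative_zero:
  fixes h h' :: "'a::euclidean_space \<Rightarrow> 'b::{banach, second_countable_topology}"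
  assumes der: "\<And>t. ((\<lambda>s. h (t + s *\<^sub>R v)) has_vector_derivative h' t) (at 0)"
    and ch: "continuous_on UNIV h" and ch': "continuous_on UNIV h'"
    and K: "compact K" "\<And>t. t \<notin> K \<Longrightarrow> h t = 0" "\<And>t. t \<notin> K \<Longrightarrow> h' t = 0"
  shows "(LINT t|lborel. h' t) = 0"
proof -
  have "bounded (h' ` K)"
    using K(1) ch' by (intro compact_imp_bounded compact_continuous_image) (auto intro: continuous_on_subset)
  then obtain B where "B > 0" and BK: "\<And>t. t \<in> K \<Longrightarrow> norm (h' t) \<le> B"
    by (auto simp: bounded_pos)
  then have B: "norm (h' t) \<le> B" for t
    using K(3)[of t] by (cases "t \<in> K") auto
  have bound: "norm (h (t + s *\<^sub>R v) - h t) \<le> B * \<bar>s\<bar>" for s t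
  proof -
    have d: "((\<lambda>s. h (t + s *\<^sub>R v)) has_derivative (\<lambda>x. x *\<^sub>R h' (t + u *\<^sub>R v))) (at u within UNIV)" for u
    proof -
      have "((\<lambda>s. h (t + u *\<^sub>R v + s *\<^sub>R v)) \<circ> (\<lambda>s. s - u) has_vector_derivative
          1 *\<^sub>R h' (t + u *\<^sub>R v)) (at u)"
        by (rule vector_diff_chain_at) (use der[of "t + u *\<^sub>R v"] in \<open>auto intro!: derivative_eq_intros\<close>)
      moreover have "(\<lambda>s. h (t + u *\<^sub>R v + s *\<^sub>R v)) \<circ> (\<lambda>s. s - u) = (\<lambda>s. h (t + s *\<^sub>R v))"
        by (simp add: o_def algebra_simps)
      ultimately have "((\<lambda>s. h (t + s *\<^sub>R v)) has_vector_derivative h' (t + u *\<^sub>R v)) (at u)"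
        by simp
      then show ?thesis by (simp add: has_vector_derivative_def)
    qed
    have "norm (h (t + s *\<^sub>R v) - h (t + 0 *\<^sub>R v)) \<le> B * norm (s - 0)"
    proof (rule differentiable_bound[OF convex_UNIV d])
      show "onorm (\<lambda>x. x *\<^sub>R h' (t + u *\<^sub>R v)) \<le> B" for u
        by (rule onorm_bound) (use \<open>B > 0\<close> B in \<open>auto simp: mult.commute[of B] intro: mult_left_mono\<close>)
    qed auto
    then show ?thesis by simp
  qed
  \<comment> \<open>Outside this set neither t nor t + s v meets K for any s in [0, 1], so it
    contains the supports of all the difference quotients.\<close>
  define K' where "K' = (\<lambda>(k, s). k - s *\<^sub>R v) ` (K \<times> {0..1::real})"
  have K': "compact K'"
    unfolding K'_def case_prod_unfold
    by (intro compact_continuous_image compact_Times K continuous_intros) auto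
  have sub: "t \<in> K'" if "t + s *\<^sub>R v \<in> K" "s \<in> {0..1}" for t s
    unfolding K'_def using that by (auto intro!: image_eqI[of _ _ "(t + s *\<^sub>R v, s)"])
  define s where "s = (\<lambda>i. 1 / real (Suc i))"
  have s: "s i \<in> {0<..1}" for i by (auto simp: s_def)
  have ih: "integrable lborel h" by (rule integrable_compact_support[OF ch K(1,2)])
  define q where "q = (\<lambda>i t. (1 / s i) *\<^sub>R (h (t + s i *\<^sub>R v) - h t))"
  have "(\<lambda>i. LINT t|lborel. q i t) \<longlonglongrightarrow> (LINT t|lborel. h' t)"
  proof (rule integral_dominated_convergence)
    show "integrable lborel (\<lambda>t. indicator K' t * B)"
      using borel_integrable_compact[OF K', of "\<lambda>_. B"] by simp
    show "AE t in lborel. (\<lambda>i. q i t) \<longlonglongrightarrow> h' t"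
    proof (rule AE_I2)
      fix t
      have "((\<lambda>y. (1 / norm (y - 0)) *\<^sub>R (h (t + y *\<^sub>R v) - (h (t + 0 *\<^sub>R v) + (y - 0) *\<^sub>R h' t))) \<longlongrightarrow> 0) (at 0)"
        using der[of t] unfolding has_vector_derivative_def has_derivative_at2 by blast
      moreover have "filterlim s (at 0) sequentially"
        unfolding filterlim_at using LIMSEQ_Suc[OF lim_1_over_n, where 'a1 = real] s
        by (auto simp: s_def[abs_def])
      ultimately have "(\<lambda>i. (1 / norm (s i - 0)) *\<^sub>R (h (t + s i *\<^sub>R v) - (h (t + 0 *\<^sub>R v) + (s i - 0) *\<^sub>R h' t)))
          \<longlonglongrightarrow> 0" by (rule filterlim_compose)
      moreover have "(1 / norm (s i - 0)) *\<^sub>R (h (t + s i *\<^sub>R v) - (h (t + 0 *\<^sub>R v) + (s i - 0) *\<^sub>R h' t))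
          = q i t - h' t" for i
        using s[of i] by (simp add: q_def algebra_simps)
      ultimately show "(\<lambda>i. q i t) \<longlonglongrightarrow> h' t"
        by (simp add: LIM_zero_iff)
    qed
    show "AE t in lborel. norm (q i t) \<le> indicator K' t * B" for i
    proof (rule AE_I2)
      fix t
      show "norm (q i t) \<le> indicator K' t * B"
      proof (cases "t \<in> K'")
        case True
        then show ?thesis using bound[of t "s i"] s[of i] unfolding q_def norm_scaleR
            by (simp add: pos_divide_le_eq)
      next
        case False
        then have "t \<notin> K" "t + s i *\<^sub>R v \<notin> K" using sub[of t 0] sub[of t "s i"] s[of i] by auto
        then show ?thesis using False K(2) by (simp add: q_def)
      qed
    qed
    have [measurable]: "h \<in> borel_measurable borel" "h' \<in> borel_measurable borel"
      using ch ch' by (auto intro: borel_measurable_continuous_onI)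
    show "h' \<in> borel_measurable lborel" by simp
    show "q i \<in> borel_measurable lborel" for i unfolding q_def by measurable
  qed
  moreover have "(LINT t|lborel. q i t) = 0" for i
  proof -
    have "integrable (distr lborel borel ((+) (s i *\<^sub>R v))) h"
      using ih by (simp add: lborel_distr_plus)
    then have "integrable lborel (\<lambda>t. h (t + s i *\<^sub>R v))"
      by (subst (asm) integrable_distr_eq) (auto simp: add.commute borel_measurable_continuous_onI ch)
    moreover have "(LINT t|lborel. h (t + s i *\<^sub>R v)) = (LINT t|distr lborel borel ((+) (s i *\<^sub>R v)). h t)"
      by (subst integral_distr) (auto simp: add.commute borel_measurable_continuous_onI ch)
    then have "(LINT t|lborel. h (t + s i *\<^sub>R v)) = (LINT t|lborel. h t)"
      by (simp add: lborel_distr_plus)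
    ultimately show ?thesis unfolding q_def using ih by simp
  qed
  ultimately show ?thesis by (simp add: LIMSEQ_const_iff)
qed


section \<open>Test functions\<close>

lemma test_functionsI:
  "smooth_on UNIV \<phi> \<Longrightarrow> compact K \<Longrightarrow> K \<subseteq> A \<Longrightarrow> (\<And>t. t \<notin> K \<Longrightarrow> \<phi> t = 0) \<Longrightarrow> \<phi> \<in> test_functions A"
  unfolding test_functions_def by blast

lemma test_functionsE:
  assumes "\<phi> \<in> test_functions A"
  obtains K where "smooth_on UNIV \<phi>" "compact K" "K \<subseteq> A" "\<And>t. t \<notin> K \<Longrightarrow> \<phi> t = 0"
  using assms unfolding test_functions_def by blast

lemma test_functions_mono: "A \<subseteq> B \<Longrightarrow> \<phi> \<in> test_functions A \<Longrightarrow> \<phi> \<in> test_functions B"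
  unfolding test_functions_def by blast

lemma test_functions_outside: "\<phi> \<in> test_functions A \<Longrightarrow> t \<notin> A \<Longrightarrow> \<phi> t = 0"
  unfolding test_functions_def by blast

lemma test_functions_mult:
  assumes "\<phi> \<in> test_functions A" "smooth_on UNIV g"
  shows "(\<lambda>t. g t * \<phi> t) \<in> test_functions A"
proof -
  obtain K where K: "smooth_on UNIV \<phi>" "compact K" "K \<subseteq> A" "\<And>t. t \<notin> K \<Longrightarrow> \<phi> t = 0"
    using assms(1) by (rule test_functionsE) blast
  show ?thesis
    by (rule test_functionsI[OF smooth_on_mult[OF open_UNIV assms(2) K(1)] K(2,3)]) (simp add: K(4))
qed

text \<open>The open sets where g is nonzero and where t is outside the support K cover the space.
  On the second the product is identically 0, whatever value \<open>inverse\<close> takes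
  there.\<close>

lemma test_functions_divide:
  assumes "\<phi> \<in> test_functions A" "smooth_on UNIV g" and nz: "\<And>t. t \<in> A \<Longrightarrow> g t \<noteq> 0"
  shows "(\<lambda>t. inverse (g t) * \<phi> t) \<in> test_functions A"
proof -
  obtain K where K: "smooth_on UNIV \<phi>" "compact K" "K \<subseteq> A" "\<And>t. t \<notin> K \<Longrightarrow> \<phi> t = 0"
    using assms(1) by (rule test_functionsE) blast
  have "smooth_on UNIV (\<lambda>t. inverse (g t) * \<phi> t)"
  proof (rule smooth_on_local)
    fix t :: "real^'a"
    show "\<exists>T. open T \<and> t \<in> T \<and> smooth_on T (\<lambda>t. inverse (g t) * \<phi> t)"
    proof (cases "t \<in> K")
      case True
      define T where "T = g -` (- {0})"
      have T: "open T"
        unfolding T_def using smooth_on_continuous[OF assms(2)]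
        by (intro open_vimage) auto
      have "smooth_on T (\<lambda>t. inverse (g t) * \<phi> t)"
        by (intro smooth_on_mult smooth_on_inverse T smooth_on_subset[OF assms(2)]
            smooth_on_subset[OF K(1)]) (auto simp: T_def)
      moreover have "t \<in> T" using nz[of t] K(3) True by (auto simp: T_def)
      ultimately show ?thesis using T by blast
    next
      case False
      have o: "open (- K)" using K(2) by (simp add: compact_imp_closed open_Compl)
      have "smooth_on (- K) (\<lambda>t. inverse (g t) * \<phi> t)"
        by (rule smooth_on_cong[OF o _ smooth_on_const[OF o, of 0]]) (simp add: K(4))
      then show ?thesis using o False by blast
    qed
  qed
  then show ?thesis by (rule test_functionsI[OF _ K(2,3)]) (simp add: K(4))
qed

lemma test_functions_add:
  assumes "\<phi> \<in> test_functions A" "\<psi> \<in> test_functions A"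
  shows "(\<lambda>t. \<phi> t + \<psi> t) \<in> test_functions A"
proof -
  obtain K where K: "smooth_on UNIV \<phi>" "compact K" "K \<subseteq> A" "\<And>t. t \<notin> K \<Longrightarrow> \<phi> t = 0"
    using assms(1) by (rule test_functionsE) blast
  obtain L where L: "smooth_on UNIV \<psi>" "compact L" "L \<subseteq> A" "\<And>t. t \<notin> L \<Longrightarrow> \<psi> t = 0"
    using assms(2) by (rule test_functionsE) blast
  show ?thesis
    by (rule test_functionsI[OF smooth_on_add[OF open_UNIV K(1) L(1)], of "K \<union> L"])
      (use K L in auto)
qed

definition ddir :: "real^'n \<Rightarrow> (real^'n \<Rightarrow> complex) \<Rightarrow> real^'n \<Rightarrow> complex" where
  "ddir v \<phi> t = frechet_derivative \<phi> (at t) v"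

lemma has_derivative_imp_directional:
  assumes "(f has_derivative f') (at t)"
  shows "((\<lambda>s. f (t + s *\<^sub>R v)) has_vector_derivative f' v) (at 0)"
proof -
  have "((\<lambda>s. f (t + s *\<^sub>R v)) has_derivative (\<lambda>x. f' (x *\<^sub>R v))) (at 0)"
    by (rule has_derivative_compose[where g = f and f = "\<lambda>s. t + s *\<^sub>R v"])
      (use assms in \<open>auto intro!: derivative_eq_intros\<close>)
  then show ?thesis
    using linear_scale[OF has_derivative_linear[OF assms]] by (simp add: has_vector_derivative_def)
qed

lemma ddir_derivative:
  assumes "smooth_on UNIV \<phi>"
  shows "((\<lambda>s. \<phi> (t + s *\<^sub>R v)) has_vector_derivative ddir v \<phi> t) (at 0)"
  unfolding ddir_def
  by (intro has_derivative_imp_directional smooth_on_has_derivative[OF assms]) simp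

lemma smooth_on_ddir: "smooth_on S \<phi> \<Longrightarrow> smooth_on S (ddir v \<phi>)"
  unfolding ddir_def[abs_def] by (rule smooth_on_frechet)

lemma ddir_zero:
  assumes "compact K" "\<And>t. t \<notin> K \<Longrightarrow> \<phi> t = 0" "t \<notin> K"
  shows "ddir v \<phi> t = 0"
proof -
  have o: "open (- K)" using assms(1) by (simp add: compact_imp_closed open_Compl)
  have "frechet_derivative \<phi> (at t) = frechet_derivative (\<lambda>_. 0) (at t)"
    by (rule frechet_derivative_cong_open[OF o]) (use assms in auto)
  then show ?thesis by (simp add: ddir_def)
qed

lemma test_functions_ddir:
  assumes "\<phi> \<in> test_functions A"
  shows "ddir v \<phi> \<in> test_functions A"
proof -
  obtain K where K: "smooth_on UNIV \<phi>" "compact K" "K \<subseteq> A" "\<And>t. t \<notin> K \<Longrightarrow> \<phi> t = 0"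
    using assms(1) by (rule test_functionsE) blast
  show ?thesis
    by (rule test_functionsI[OF smooth_on_ddir[OF K(1)] K(2,3) ddir_zero[OF K(2,4)]])
qed

text \<open>F may be arbitrary off A: the product is continuous on A and identically 0 on the
  complement of the support, and these two open sets cover the space.\<close>

lemma test_functions_integrable:
  assumes \<phi>: "\<phi> \<in> test_functions A" and o: "open A" and F: "continuous_on A F"
  shows "integrable lborel (\<lambda>t. F t * \<phi> t)" and "continuous_on UNIV (\<lambda>t. F t * \<phi> t)"
proof -
  obtain K where K: "smooth_on UNIV \<phi>" "compact K" "K \<subseteq> A" "\<And>t. t \<notin> K \<Longrightarrow> \<phi> t = 0"
    using \<phi> by (rule test_functionsE) blast
  have oK: "open (- K)" using K(2) by (simp add: compact_imp_closed open_Compl)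
  have "continuous_on A (\<lambda>t. F t * \<phi> t)"
    by (intro continuous_intros F continuous_on_subset[OF smooth_on_continuous[OF K(1)]]) auto
  moreover have "continuous_on (- K) (\<lambda>t. F t * \<phi> t)"
    by (rule continuous_on_eq[of _ "\<lambda>_. 0"]) (auto simp: K(4))
  ultimately have "continuous_on (A \<union> - K) (\<lambda>t. F t * \<phi> t)"
    using o oK continuous_on_open_Un by blast
  moreover have "A \<union> - K = UNIV" using K(3) by blast
  ultimately show c: "continuous_on UNIV (\<lambda>t. F t * \<phi> t)" by simp
  show "integrable lborel (\<lambda>t. F t * \<phi> t)"
    by (rule integrable_compact_support[OF c K(2)]) (simp add: K(4))
qed

text \<open>F is differentiated only inside A. At any other point the product with \<phi> vanishes
  on the neighbourhood \<open>- K\<close>, so its derivative is 0 there and the product rule holds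
  on the whole space.\<close>

lemma integral_by_parts_test:
  assumes \<phi>: "\<phi> \<in> test_functions A" and o: "open A"
    and F: "continuous_on A F" "continuous_on A F'"
    and der: "\<And>t. t \<in> A \<Longrightarrow> ((\<lambda>s. F (t + s *\<^sub>R v)) has_vector_derivative F' t) (at 0)"
  shows "(LINT t|lborel. F' t * \<phi> t) = - (LINT t|lborel. F t * ddir v \<phi> t)"
proof -
  obtain K where K: "smooth_on UNIV \<phi>" "compact K" "K \<subseteq> A" "\<And>t. t \<notin> K \<Longrightarrow> \<phi> t = 0"
    using \<phi> by (rule test_functionsE) blast
  have oK: "open (- K)" using K(2) by (simp add: compact_imp_closed open_Compl)
  have \<phi>': "ddir v \<phi> \<in> test_functions A" using \<phi> by (rule test_functions_ddir)
  have "(LINT t|lborel. F t * ddir v \<phi> t + F' t * \<phi> t) = 0"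
  proof (rule integral_directional_derivative_zero[where h = "\<lambda>t. F t * \<phi> t" and K = K and v = v])
    show "continuous_on UNIV (\<lambda>t. F t * \<phi> t)"
      by (rule test_functions_integrable(2)[OF \<phi> o F(1)])
    show "continuous_on UNIV (\<lambda>t. F t * ddir v \<phi> t + F' t * \<phi> t)"
      by (intro continuous_on_add test_functions_integrable(2)[OF \<phi> o F(2)]
          test_functions_integrable(2)[OF \<phi>' o F(1)])
    show "((\<lambda>s. F (t + s *\<^sub>R v) * \<phi> (t + s *\<^sub>R v)) has_vector_derivative
        F t * ddir v \<phi> t + F' t * \<phi> t) (at 0)" for t
    proof (cases "t \<in> A")
      case True
      show ?thesis
        using has_vector_derivative_mult[OF der[OF True] ddir_derivative[OF K(1), of t v]] by simp
    next
      case False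
      then have t: "t \<notin> K" using K(3) by blast
      have "((\<lambda>t. F t * \<phi> t) has_derivative (\<lambda>_. 0)) (at t)"
        by (rule has_derivative_transform_within_open[of "\<lambda>_. 0", OF _ oK]) (use t K(4) in auto)
      then show ?thesis
        using has_derivative_imp_directional[of "\<lambda>t. F t * \<phi> t"] ddir_zero[OF K(2,4) t] K(4)[OF t]
        by fastforce
    qed
  qed (use K ddir_zero[OF K(2,4)] in auto)
  moreover have "(LINT t|lborel. F t * ddir v \<phi> t + F' t * \<phi> t) =
      (LINT t|lborel. F t * ddir v \<phi> t) + (LINT t|lborel. F' t * \<phi> t)"
    by (rule Bochner_Integration.integral_add)
      (intro test_functions_integrable(1)[OF \<phi> o] test_functions_integrable(1)[OF \<phi>' o] F)+
  ultimately show ?thesis by (simp add: eq_neg_iff_add_eq_0 add.commute)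
qed

text \<open>The two-sided Laplace transform of a test function. The series of E(f) paired with
  \<phi> has the terms \<open>f w * laplace \<phi> w\<close> at w =
  \<open>shift z n\<close>.\<close>

definition laplace :: "(real^'n \<Rightarrow> complex) \<Rightarrow> complex^'n \<Rightarrow> complex" where
  "laplace \<phi> w = (LINT t|lborel. exp (pairing t w) * \<phi> t)"

lemma continuous_on_exp_pairing: "continuous_on S (\<lambda>t. exp (pairing t w))"
  by (intro continuous_intros bounded_linear.continuous_on[OF bounded_linear_pairing_left] continuous_on_id)

lemma laplace_integrable: "\<phi> \<in> test_functions A \<Longrightarrow> integrable lborel (\<lambda>t. exp (pairing t w) * \<phi> t)"
  using test_functions_integrable(1)[OF test_functions_mono[OF subset_UNIV] open_UNIV]
    continuous_on_exp_pairing by blast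

text \<open>Serves in both directions: it turns a numerator of \<open>f\<close> into a derivative,
  and it turns smoothness of the test function into decay of its transform.\<close>

lemma laplace_ddir:
  assumes "\<phi> \<in> test_functions A"
  shows "pairing v w * laplace \<phi> w = - laplace (ddir v \<phi>) w"
proof -
  have "(LINT t|lborel. (pairing v w * exp (pairing t w)) * \<phi> t) =
      - (LINT t|lborel. exp (pairing t w) * ddir v \<phi> t)"
  proof (rule integral_by_parts_test[OF test_functions_mono[OF subset_UNIV assms] open_UNIV])
    show "((\<lambda>s. exp (pairing (t + s *\<^sub>R v) w)) has_vector_derivative pairing v w * exp (pairing t w)) (at 0)"
      for t
      unfolding pairing_add_left pairing_scaleR_left
      by (rule has_vector_derivative_real_field[where a = 0, simplified])
        (auto intro!: derivative_eq_intros)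
  qed (auto intro!: continuous_intros continuous_on_exp_pairing)
  then show ?thesis by (simp add: laplace_def mult.assoc)
qed

lemma laplace_add:
  assumes "\<phi> \<in> test_functions A" "\<psi> \<in> test_functions A"
  shows "laplace (\<lambda>t. a * \<phi> t + b * \<psi> t) w = a * laplace \<phi> w + b * laplace \<psi> w"
proof -
  have "exp (pairing t w) * (a * \<phi> t + b * \<psi> t) =
      a * (exp (pairing t w) * \<phi> t) + b * (exp (pairing t w) * \<psi> t)" for t
    by (simp add: algebra_simps)
  then show ?thesis
    unfolding laplace_def using laplace_integrable[OF assms(1), of w] laplace_integrable[OF assms(2), of w]
    by simp
qed

section \<open>Polynomials with coefficients in a ring of functions\<close>

lemma generated_algebra_sum:
  "(\<And>i. i \<in> I \<Longrightarrow> f i \<in> generated_algebra G) \<Longrightarrow> (\<lambda>z. \<Sum>i\<in>I. f i z) \<in> generated_algebra G"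
proof (induction I rule: infinite_finite_induct)
  case (insert x F)
  then show ?case using generated_algebra.add[of "f x" G "\<lambda>z. \<Sum>i\<in>F. f i z"] by simp
qed (simp_all add: generated_algebra.const)

text \<open>Polynomials in t of degree at most D with coefficients in R, generated so that proofs go
  by induction. For negative D only the zero function can be derived, in accordance with the
  convention on negative degrees.\<close>

inductive polyT :: "(complex^'n \<Rightarrow> complex) set \<Rightarrow> int \<Rightarrow> (real^'n \<Rightarrow> complex^'n \<Rightarrow> complex) \<Rightarrow> bool"
  for R :: "(complex^'n \<Rightarrow> complex) set" where
  zero: "polyT R D (\<lambda>t z. 0)"
| const: "0 \<le> D \<Longrightarrow> c \<in> R \<Longrightarrow> polyT R D (\<lambda>t z. c z)"
| coord: "polyT R D p \<Longrightarrow> polyT R (D + 1) (\<lambda>t z. of_real (t $ i) * p t z)"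
| add: "polyT R D p \<Longrightarrow> polyT R D q \<Longrightarrow> polyT R D (\<lambda>t z. p t z + q t z)"

lemma polyT_mono: "polyT R D p \<Longrightarrow> D \<le> D' \<Longrightarrow> polyT R D' p"
proof (induction arbitrary: D' rule: polyT.induct)
  case (coord D p i)
  then show ?case using polyT.coord[of R "D' - 1" p i] by simp
qed (auto intro: polyT.intros)

lemma polyT_mult:
  assumes R: "\<And>f g. f \<in> R \<Longrightarrow> g \<in> R \<Longrightarrow> (\<lambda>z. f z * g z) \<in> R"
  shows "polyT R D p \<Longrightarrow> polyT R D' q \<Longrightarrow> polyT R (D + D') (\<lambda>t z. p t z * q t z)"
proof (induction rule: polyT.induct)
  case (zero D)
  then show ?case by (simp add: polyT.zero)
next
  case (const D c)
  have "polyT R D' (\<lambda>t z. c z * q t z)"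
    using \<open>polyT R D' q\<close>
  proof (induction rule: polyT.induct)
    case (coord D p i)
    show ?case using polyT.coord[OF coord.IH, of i] by (simp add: mult.left_commute)
  next
    case (add D p q)
    show ?case using polyT.add[OF add.IH] by (simp add: distrib_left)
  qed (use const R in \<open>auto intro: polyT.intros\<close>)
  then show ?case by (rule polyT_mono) (use const in auto)
next
  case (coord D p i)
  show ?case using polyT.coord[OF coord.IH[OF coord.prems], of i] by (simp add: mult.assoc add_ac)
next
  case (add D p q)
  show ?case using polyT.add[OF add.IH(1)[OF add.prems] add.IH(2)[OF add.prems]] by (simp add: distrib_right)
qed

lemma polyT_sum:
  assumes "\<And>i. i \<in> I \<Longrightarrow> polyT R D (p i)"
  shows "polyT R D (\<lambda>t z. \<Sum>i\<in>I. p i t z)"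
  using assms
proof (induction I rule: infinite_finite_induct)
  case (insert x F)
  then show ?case using polyT.add[of R D "p x" "\<lambda>t z. \<Sum>i\<in>F. p i t z"] by simp
qed (simp_all add: polyT.zero)

lemma polyT_prod:
  assumes R: "\<And>f g. f \<in> R \<Longrightarrow> g \<in> R \<Longrightarrow> (\<lambda>z. f z * g z) \<in> R" "(\<lambda>z. 1) \<in> R"
    and "\<And>i. i \<in> I \<Longrightarrow> polyT R (D i) (p i)"
  shows "polyT R (\<Sum>i\<in>I. D i) (\<lambda>t z. \<Prod>i\<in>I. p i t z)"
  using assms(3)
proof (induction I rule: infinite_finite_induct)
  case (insert x F)
  have "polyT R (D x + (\<Sum>i\<in>F. D i)) (\<lambda>t z. p x t z * (\<Prod>i\<in>F. p i t z))"
    by (rule polyT_mult[OF R(1)]) (use insert in auto)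
  then show ?case using insert.hyps by simp
next
  case empty
  show ?case using polyT.const[OF order_refl R(2)] by simp
next
  case (infinite I)
  show ?case using polyT.const[OF order_refl R(2)] infinite by simp
qed

lemma polyT_inner:
  fixes R :: "(complex^'n \<Rightarrow> complex) set"
  assumes c: "\<And>a. (\<lambda>z. a) \<in> R"
  shows "polyT R 1 (\<lambda>t z. of_real (u \<bullet> t))"
proof -
  have "polyT R 1 (\<lambda>t z. of_real (t $ i) * of_real (u $ i))" for i
    using polyT.coord[OF polyT.const[of 0 "\<lambda>z. of_real (u $ i)" R], of i] c by simp
  then have "polyT R 1 (\<lambda>t z. \<Sum>i\<in>UNIV. of_real (t $ i) * of_real (u $ i))"
    by (intro polyT_sum)
  then show ?thesis by (simp add: inner_vec_def mult.commute)
qed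

lemma polyT_power:
  assumes R: "\<And>f g. f \<in> R \<Longrightarrow> g \<in> R \<Longrightarrow> (\<lambda>z. f z * g z) \<in> R" "(\<lambda>z. 1) \<in> R"
    and "polyT R 1 p"
  shows "polyT R (int k) (\<lambda>t z. p t z ^ k)"
proof (induction k)
  case 0
  show ?case using polyT.const[OF order_refl R(2)] by simp
next
  case (Suc k)
  have "polyT R (1 + int k) (\<lambda>t z. p t z * p t z ^ k)"
    by (rule polyT_mult) (use R(1) assms(3) Suc in auto)
  then show ?case by simp
qed

lemma polyT_continuous: "polyT R D p \<Longrightarrow> continuous_on S (\<lambda>t. p t z)"
  by (induction rule: polyT.induct) (auto intro!: continuous_intros)

lemma polyT_derivative:
  fixes R :: "(complex^'n \<Rightarrow> complex) set"
  assumes R: "\<And>a f. f \<in> R \<Longrightarrow> (\<lambda>z. a * f z) \<in> R"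
  shows "polyT R D p \<Longrightarrow> \<exists>q. polyT R (D - 1) q \<and>
    (\<forall>t z. ((\<lambda>s. p (t + s *\<^sub>R v) z) has_vector_derivative q t z) (at 0))"
proof (induction rule: polyT.induct)
  case (zero D)
  show ?case by (intro exI[of _ "\<lambda>t z. 0"]) (auto intro: polyT.zero)
next
  case (const D c)
  show ?case by (intro exI[of _ "\<lambda>t z. 0"]) (auto intro: polyT.zero)
next
  case (add D p q)
  then obtain p' q' where "polyT R (D - 1) p'" "polyT R (D - 1) q'"
    "\<forall>t z. ((\<lambda>s. p (t + s *\<^sub>R v) z) has_vector_derivative p' t z) (at 0)"
    "\<forall>t z. ((\<lambda>s. q (t + s *\<^sub>R v) z) has_vector_derivative q' t z) (at 0)" by blast
  then show ?case
    by (intro exI[of _ "\<lambda>t z. p' t z + q' t z"]) (auto intro: polyT.add has_vector_derivative_add)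
next
  case (coord D p i)
  then obtain p' where p': "polyT R (D - 1) p'"
    "\<And>t z. ((\<lambda>s. p (t + s *\<^sub>R v) z) has_vector_derivative p' t z) (at 0)" by blast
  \<comment> \<open>The product rule for t_i p leaves the term v_i p, which has not been
    differentiated; its bound D is just what D + 1 - 1 allows.\<close>
  have smult: "polyT R D (\<lambda>t z. a * p t z)" for a
    using \<open>polyT R D p\<close>
  proof (induction rule: polyT.induct)
    case (coord D p i)
    show ?case using polyT.coord[OF coord.IH, of i] by (simp add: mult.left_commute)
  next
    case (add D p q)
    show ?case using polyT.add[OF add.IH] by (simp add: distrib_left)
  qed (use R in \<open>auto intro: polyT.intros\<close>)
  have "((\<lambda>s. of_real ((t + s *\<^sub>R v) $ i) * p (t + s *\<^sub>R v) z) has_vector_derivative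
     of_real (v $ i) * p t z + of_real (t $ i) * p' t z) (at 0)" for t z
  proof -
    have d: "((\<lambda>s. complex_of_real ((t + s *\<^sub>R v) $ i)) has_vector_derivative of_real (v $ i)) (at 0)"
      by (auto intro!: derivative_eq_intros has_vector_derivative_real_field[where a = 0, simplified])
    show ?thesis using has_vector_derivative_mult[OF d p'(2)[of t z]] by (simp add: add.commute)
  qed
  moreover have "polyT R D (\<lambda>t z. of_real (v $ i) * p t z + of_real (t $ i) * p' t z)"
    using polyT.coord[OF p'(1), of i] by (intro polyT.add smult) simp
  ultimately show ?case by (intro exI[of _ "\<lambda>t z. of_real (v $ i) * p t z + of_real (t $ i) * p' t z"]) simp
qed

lemma finite_exponents: "finite {k :: 'n::finite \<Rightarrow> nat. int (\<Sum>i\<in>UNIV. k i) \<le> D}"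
proof (rule finite_subset)
  show "{k :: 'n \<Rightarrow> nat. int (\<Sum>i\<in>UNIV. k i) \<le> D} \<subseteq> PiE UNIV (\<lambda>_. {..nat D})"
  proof (intro subsetI PiE_I)
    fix k :: "'n \<Rightarrow> nat" and i
    assume "k \<in> {k. int (\<Sum>i\<in>UNIV. k i) \<le> D}"
    moreover have "k i \<le> sum k UNIV" by (rule member_le_sum) auto
    ultimately have "k i \<le> nat D" unfolding mem_Collect_eq by linarith
    then show "k i \<in> {..nat D}" by simp
  qed auto
qed (intro finite_PiE; simp)

lemma polyT_imp_poly_in_t:
  fixes R :: "(complex^'n \<Rightarrow> complex) set"
  assumes R: "\<And>f g. f \<in> R \<Longrightarrow> g \<in> R \<Longrightarrow> (\<lambda>z. f z + g z) \<in> R" "(\<lambda>z. 0) \<in> R"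
  shows "polyT R D p \<Longrightarrow> \<exists>c. (\<forall>k. c k \<in> R) \<and> (\<forall>t z. p t z = poly_in_t D c t z)"
proof (induction rule: polyT.induct)
  case (zero D)
  show ?case using R by (intro exI[of _ "\<lambda>k z. 0"]) (auto simp: poly_in_t_def)
next
  case (const D c)
  have "c z = poly_in_t D (\<lambda>k. if k = (\<lambda>_. 0) then c else (\<lambda>z. 0)) t z" for t z
  proof -
    have "poly_in_t D (\<lambda>k. if k = (\<lambda>_. 0) then c else (\<lambda>z. 0)) t z =
      (\<Sum>k \<in> {k :: 'n \<Rightarrow> nat. int (\<Sum>i\<in>UNIV. k i) \<le> D}. if k = (\<lambda>_. 0) then c z else 0)"
      unfolding poly_in_t_def by (intro sum.cong) auto
    then show ?thesis using finite_exponents[where 'n = 'n and D = D] const by simp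
  qed
  then show ?case using const R by (intro exI[of _ "\<lambda>k. if k = (\<lambda>_. 0) then c else (\<lambda>z. 0)"]) auto
next
  case (add D p q)
  then obtain c c' where "\<forall>k. c k \<in> R" "\<forall>k. c' k \<in> R"
    "\<forall>t z. p t z = poly_in_t D c t z" "\<forall>t z. q t z = poly_in_t D c' t z" by blast
  then show ?case using R(1)
    by (intro exI[of _ "\<lambda>k z. c k z + c' k z"]) (auto simp: poly_in_t_def distrib_right sum.distrib)
next
  case (coord D p i)
  then obtain c where c: "\<And>k. c k \<in> R" "\<And>t z. p t z = poly_in_t D c t z" by blast
  \<comment> \<open>Multiplication by t_i raises the i-th exponent by one, so the new coefficient at
    k is the old one at k lowered in position i. The case k i = 0 is separate because natural
    subtraction would return k itself.\<close>
  define c' where "c' = (\<lambda>k. if k i = 0 then (\<lambda>z. 0) else c (k(i := k i - 1)))"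
  define up where "up = (\<lambda>k :: 'n \<Rightarrow> nat. k(i := k i + 1))"
  have sum_up: "(\<Sum>j\<in>UNIV. up k j) = (\<Sum>j\<in>UNIV. k j) + 1" for k
    using sum.remove[of UNIV i "up k"] sum.remove[of UNIV i k] by (auto simp: up_def)
  have "of_real (t $ i) * p t z = poly_in_t (D + 1) c' t z" for t z
  proof -
    define m where "m = (\<lambda>k :: 'n \<Rightarrow> nat. \<Prod>j\<in>UNIV. complex_of_real (t $ j) ^ k j)"
    have m_up: "m (up k) = of_real (t $ i) * m k" for k
      using prod.remove[of UNIV i "\<lambda>j. complex_of_real (t $ j) ^ up k j"]
        prod.remove[of UNIV i "\<lambda>j. complex_of_real (t $ j) ^ k j"]
      by (simp add: m_def up_def)
    let ?S = "\<lambda>D. {k :: 'n \<Rightarrow> nat. int (\<Sum>j\<in>UNIV. k j) \<le> D}"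
    have inj: "inj_on up (?S D)"
    proof (rule inj_onI)
      fix k l assume "up k = up l"
      then have "(up k)(i := up k i - 1) = (up l)(i := up l i - 1)" by simp
      then show "k = l" by (simp add: up_def)
    qed
    have "poly_in_t (D + 1) c' t z = (\<Sum>k\<in>?S (D + 1). c' k z * m k)"
      by (simp add: poly_in_t_def m_def)
    also have "\<dots> = (\<Sum>k\<in>up ` ?S D. c' k z * m k)"
    proof (rule sum.mono_neutral_right)
      show "up ` ?S D \<subseteq> ?S (D + 1)"
        by (rule image_subsetI) (unfold mem_Collect_eq sum_up, simp)
      show "\<forall>k\<in>?S (D + 1) - up ` ?S D. c' k z * m k = 0"
      proof
        fix k assume k: "k \<in> ?S (D + 1) - up ` ?S D"
        have "k i = 0"
        proof (rule ccontr)
          assume "k i \<noteq> 0"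
          define l where "l = k(i := k i - 1)"
          have "k = up l" using \<open>k i \<noteq> 0\<close> by (auto simp: up_def l_def)
          moreover from this have "l \<in> ?S D"
            using k sum_up[of l] by (simp del: of_nat_sum)
          ultimately show False using k by blast
        qed
        then show "c' k z * m k = 0" by (simp add: c'_def)
      qed
    qed (rule finite_exponents)
    also have "\<dots> = (\<Sum>k\<in>?S D. c' (up k) z * m (up k))"
      by (rule sum.reindex[OF inj, unfolded o_def])
    also have "\<dots> = of_real (t $ i) * poly_in_t D c t z"
      unfolding poly_in_t_def sum_distrib_left
      by (intro sum.cong refl) (simp add: m_up, simp add: m_def c'_def up_def)
    finally show ?thesis by (simp add: c)
  qed
  moreover have "\<forall>k. c' k \<in> R" using c R(2) by (simp add: c'_def)
  ultimately show ?case by blast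
qed

lemma C_diff_on_snd:
  "C_diff_on k U c \<Longrightarrow> open U \<Longrightarrow> C_diff_on k (UNIV \<times> U) (\<lambda>x. c (snd x))"
proof (induction k arbitrary: c)
  case 0
  then show ?case by (auto intro!: continuous_on_compose2[of U c _ snd] continuous_intros)
next
  case (Suc k)
  show ?case
  proof (rule C_diff_on_SucI[where f' = "\<lambda>x v. frechet_derivative c (at (snd x)) (snd v)"])
    show "((\<lambda>x. c (snd x)) has_derivative (\<lambda>v. frechet_derivative c (at (snd x)) (snd v))) (at x)"
      if "x \<in> UNIV \<times> U" for x
      by (rule has_derivative_compose[where f = snd and g = c])
        (use C_diff_on_SucD[OF Suc.prems(1)] that in \<open>auto intro!: derivative_eq_intros\<close>)
  qed (use Suc in \<open>auto simp: open_Times\<close>)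
qed

lemma polyT_smooth:
  fixes R :: "(complex^'n \<Rightarrow> complex) set"
  assumes "open U" and R: "\<And>c. c \<in> R \<Longrightarrow> smooth_on U c"
  shows "polyT R D p \<Longrightarrow> smooth_on (UNIV \<times> U) (\<lambda>(t, z). p t z)"
proof (induction rule: polyT.induct)
  case (zero D)
  then show ?case using assms(1) by (simp add: case_prod_unfold smooth_on_const open_Times)
next
  case (const D c)
  then have "C_diff_on k U c" for k using R unfolding smooth_on_def by blast
  then show ?case
    unfolding smooth_on_def case_prod_unfold by (intro allI C_diff_on_snd[OF _ assms(1)])
next
  case (coord D p i)
  have "bounded_linear (\<lambda>x :: (real^'n) \<times> (complex^'n). complex_of_real (fst x $ i))"
    by (intro bounded_linear_compose[OF bounded_linear_of_real]
        bounded_linear_compose[OF bounded_linear_vec_nth] bounded_linear_fst)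
  then show ?case
    using smooth_on_mult[OF _ smooth_on_linear coord.IH, unfolded case_prod_unfold] assms(1)
    by (simp add: case_prod_unfold open_Times)
next
  case (add D p q)
  then show ?case
    using smooth_on_add[OF _ add.IH] assms(1) by (simp add: case_prod_unfold open_Times)
qed

section \<open>The class of representable functions\<close>

lemma continuous_on_pairing_right: "continuous_on S (\<lambda>z. pairing t z)"
  by (rule bounded_linear.continuous_on[OF bounded_linear_pairing_right continuous_on_id])

locale arrangement = lattice_pair N for N :: "(real^'n) set" +
  fixes \<Delta> :: "(real^'n) set"
  assumes finite_\<Delta>: "finite \<Delta>" and \<Delta>_M: "\<Delta> \<subseteq> dual_lattice N" and zero_notin_\<Delta>: "0 \<notin> \<Delta>"
    and indivisible: "\<forall>\<alpha>\<in>\<Delta>. indivisible_in (dual_lattice N) \<alpha>"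
    and wall_exists: "\<exists>H. wall \<Delta> H"
begin

abbreviation "U \<equiv> U_Delta N \<Delta>"
abbreviation "A \<equiv> areg N \<Delta>"
abbreviation "RT \<equiv> R_T_Delta N \<Delta>"

lemma pairing_shift_int:
  assumes "a \<in> M" "n \<in> N"
  shows "pairing a (shift z n) = wint (pairing a z) \<lfloor>a \<bullet> n\<rfloor>"
proof -
  have "real_of_int \<lfloor>a \<bullet> n\<rfloor> = a \<bullet> n" using M_int[OF assms] by simp
  then have "complex_of_int \<lfloor>a \<bullet> n\<rfloor> = of_real (a \<bullet> n)" by (metis of_real_of_int_eq)
  then show ?thesis by (simp add: pairing_shift)
qed

text \<open>By indivisibility \<alpha> takes every integer value on \<open>N\<close>. So avoiding
  its zeros at all lattice shifts of z means avoiding \<open>wint (pairing \<alpha> z) j = 0\<close>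
  for every integer j, which is a condition on the exponential alone.\<close>

lemma U_iff: "z \<in> U \<longleftrightarrow> (\<forall>\<alpha>\<in>\<Delta>. exp (pairing \<alpha> z) \<noteq> 1)"
proof
  assume z: "z \<in> U"
  show "\<forall>\<alpha>\<in>\<Delta>. exp (pairing \<alpha> z) \<noteq> 1"
  proof
    fix \<alpha> assume \<alpha>: "\<alpha> \<in> \<Delta>"
    have "wint (pairing \<alpha> z) j \<noteq> 0" for j
    proof -
      obtain n where n: "n \<in> N" "\<alpha> \<bullet> n = of_int j"
        using indivisible_surj[of \<alpha> j] \<alpha> \<Delta>_M zero_notin_\<Delta> indivisible by blast
      then have "pairing \<alpha> (shift z n) = wint (pairing \<alpha> z) j" by (simp add: pairing_shift)
      then show ?thesis using z n(1) \<alpha> by (auto simp: U_Delta_def)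
    qed
    then show "exp (pairing \<alpha> z) \<noteq> 1" using wint_nonzero_iff by blast
  qed
next
  assume "\<forall>\<alpha>\<in>\<Delta>. exp (pairing \<alpha> z) \<noteq> 1"
  then have "wint (pairing \<alpha> z) j \<noteq> 0" if "\<alpha> \<in> \<Delta>" for \<alpha> j using wint_nonzero_iff that by blast
  then show "z \<in> U" unfolding U_Delta_def using pairing_shift_int \<Delta>_M by auto
qed

lemma open_U: "open U"
proof -
  have "U = (\<Inter>\<alpha>\<in>\<Delta>. (\<lambda>z. exp (pairing \<alpha> z)) -` (- {1}))" using U_iff by auto
  moreover have "open ((\<lambda>z. exp (pairing \<alpha> z)) -` (- {1}))" for \<alpha>
    by (intro open_vimage continuous_intros continuous_on_pairing_right)
  ultimately show ?thesis using finite_\<Delta> by auto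
qed

text \<open>With the primitive normal x, all translates of the wall by \<open>M\<close> are
  described by the single condition t \<bullet> x \<in> \<int>. Hence their union is closed, and
  e^(2 pi i (t \<bullet> x)) - 1 has no zero on \<open>A\<close>.\<close>

lemma wall_translates:
  assumes K: "K \<subseteq> \<Delta>" "independent K" "card K + 1 = CARD('n)"
  obtains x where "x \<in> N" "\<And>a. a \<in> K \<Longrightarrow> a \<bullet> x = 0"
    "(\<Union>m\<in>M. (\<lambda>t. m + t) ` span K) = {t. t \<bullet> x \<in> \<int>}" "\<And>t. t \<in> A \<Longrightarrow> t \<bullet> x \<notin> \<int>"
proof -
  have KM: "K \<subseteq> M" using K \<Delta>_M by blast
  obtain x where x: "x \<in> N" "\<And>a. a \<in> K \<Longrightarrow> a \<bullet> x = 0" "\<exists>m\<in>M. m \<bullet> x = 1"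
    "\<And>t. t \<bullet> x = 0 \<Longrightarrow> t \<in> span K"
    using primitive_normal[OF KM K(2,3)] by blast
  have span0: "t \<bullet> x = 0" if "t \<in> span K" for t
    using that by (induction rule: span_induct) (auto simp: x(2) subspace_def inner_add_left)
  have eq: "(\<Union>m\<in>M. (\<lambda>t. m + t) ` span K) = {t. t \<bullet> x \<in> \<int>}"
  proof (intro set_eqI iffI)
    fix t assume "t \<in> (\<Union>m\<in>M. (\<lambda>t. m + t) ` span K)"
    then show "t \<in> {t. t \<bullet> x \<in> \<int>}" using span0 M_int x(1) by (auto simp: inner_add_left)
  next
    fix t assume "t \<in> {t. t \<bullet> x \<in> \<int>}"
    then obtain l :: int where l: "t \<bullet> x = of_int l" using Ints_cases by blast
    obtain m where m: "m \<in> M" "m \<bullet> x = 1" using x(3) by blast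
    have "t - of_int l *\<^sub>R m \<in> span K" by (rule x(4)) (simp add: inner_diff_left l m)
    then have "t \<in> (\<lambda>t. of_int l *\<^sub>R m + t) ` span K" by (intro image_eqI[of _ _ "t - of_int l *\<^sub>R m"]) auto
    then show "t \<in> (\<Union>m\<in>M. (\<lambda>t. m + t) ` span K)" using M_scale[OF m(1)] by blast
  qed
  have "wall \<Delta> (span K)" using K by (auto simp: wall_def)
  then have "(\<Union>m\<in>M. (\<lambda>t. m + t) ` span K) \<inter> A = {}"
    unfolding areg_def by blast
  then have avoid: "t \<bullet> x \<notin> \<int>" if "t \<in> A" for t
    using that unfolding eq by blast
  show ?thesis by (rule that) (fact x(1), erule x(2), fact eq, erule avoid)
qed

lemma areg_avoids:
  assumes "K \<subseteq> \<Delta>" "independent K" "card K + 1 = CARD('n)" "m \<in> M" "t - m \<in> span K"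
  shows "t \<notin> A"
proof -
  have "wall \<Delta> (span K)" using assms by (auto simp: wall_def)
  moreover have "t \<in> (\<lambda>t. m + t) ` span K" using assms(5) by (intro image_eqI[of _ _ "t - m"]) auto
  ultimately show ?thesis using assms(4) unfolding areg_def by blast
qed

text \<open>There are finitely many walls, but infinitely many translates of each may occur; the
  latter form the preimage of the closed set \<int> under a linear form.\<close>

lemma open_areg: "open A"
proof -
  have "finite (Collect (wall \<Delta>))"
  proof (rule finite_subset)
    show "Collect (wall \<Delta>) \<subseteq> span ` Pow \<Delta>" by (auto simp: wall_def)
  qed (use finite_\<Delta> in auto)
  moreover have "closed (\<Union>m\<in>M. (\<lambda>t. m + t) ` H)" if W: "wall \<Delta> H" for H
  proof -
    obtain K where "K \<subseteq> \<Delta> \<and> independent K \<and> card K + 1 = CARD('n) \<and> H = span K"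
      using W[unfolded wall_def] ..
    then have K: "K \<subseteq> \<Delta>" "independent K" "card K + 1 = CARD('n)" "H = span K" by auto
    obtain x where "x \<in> N" "\<And>a. a \<in> K \<Longrightarrow> a \<bullet> x = 0"
      and x: "(\<Union>m\<in>M. (\<lambda>t. m + t) ` span K) = {t. t \<bullet> x \<in> \<int>}"
      and "\<And>t. t \<in> A \<Longrightarrow> t \<bullet> x \<notin> \<int>"
      by (rule wall_translates[OF K(1-3)]) blast
    have "closed ((\<lambda>t. t \<bullet> x) -` (\<int> :: real set))"
      by (intro closed_vimage closed_Ints continuous_intros)
    then show ?thesis unfolding K(4) x by (simp add: vimage_def)
  qed
  ultimately show ?thesis unfolding areg_def by (intro open_Compl closed_UN) auto
qed

section \<open>The coefficient ring\<close>

lemma RT_const: "(\<lambda>z. c) \<in> RT"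
  and RT_add: "f \<in> RT \<Longrightarrow> g \<in> RT \<Longrightarrow> (\<lambda>z. f z + g z) \<in> RT"
  and RT_mult: "f \<in> RT \<Longrightarrow> g \<in> RT \<Longrightarrow> (\<lambda>z. f z * g z) \<in> RT"
  and RT_cmult: "f \<in> RT \<Longrightarrow> (\<lambda>z. c * f z) \<in> RT"
  unfolding R_T_Delta_def by (auto intro: generated_algebra.intros)

lemma RT_sum: "(\<And>i. i \<in> I \<Longrightarrow> f i \<in> RT) \<Longrightarrow> (\<lambda>z. \<Sum>i\<in>I. f i z) \<in> RT"
  unfolding R_T_Delta_def by (rule generated_algebra_sum)

lemma RT_exp: "m \<in> M \<Longrightarrow> (\<lambda>z. exp (pairing m z)) \<in> RT"
  unfolding R_T_Delta_def R_T_def by (rule generated_algebra.gen) (auto intro: generated_algebra.gen)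

lemma RT_inverse: "\<alpha> \<in> \<Delta> \<Longrightarrow> (\<lambda>z. inverse (1 - exp (- pairing \<alpha> z))) \<in> RT"
  unfolding R_T_Delta_def by (rule generated_algebra.gen) auto

text \<open>The recursion only uses e^(-x), which is the character of - \<alpha>, and 1 / (1 -
  e^(-x)), which is one of the adjoined inverses.\<close>

lemma RT_per_coeff:
  assumes "\<alpha> \<in> \<Delta>" shows "(\<lambda>z. per_coeff (pairing \<alpha> z) k) \<in> RT"
proof (induction k rule: less_induct)
  case (less k)
  consider "k = 0" | "k = 1" | "k \<ge> 2" by linarith
  then show ?case
  proof cases
    case 3
    have "(\<lambda>z. (\<Sum>i\<in>{1..<k}. inverse (fact i) * per_coeff (pairing \<alpha> z) (k - i)) *
        (exp (pairing (- \<alpha>) z) * inverse (1 - exp (- pairing \<alpha> z)))) \<in> RT"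
      by (intro RT_mult RT_sum RT_cmult RT_exp RT_inverse less M_minus)
        (use assms \<Delta>_M in auto)
    then show ?thesis
      using 3 by (subst per_coeff.simps) (simp add: pairing_minus_left divide_inverse mult.commute)
  qed (use RT_const RT_inverse assms in \<open>simp_all add: per_coeff.simps\<close>)
qed

lemma RT_smooth: "c \<in> RT \<Longrightarrow> smooth_on U c"
proof -
  note sm = smooth_on_const[OF open_U] smooth_on_add[OF open_U] smooth_on_mult[OF open_U]
    smooth_on_exp[OF open_U] smooth_on_linear[OF open_U bounded_linear_pairing_right]
  have R: "smooth_on U c" if "c \<in> R_T N" for c
    using that unfolding R_T_def by (induction rule: generated_algebra.induct) (auto intro!: sm)
  have ne: "1 - exp (- pairing \<alpha> z) \<noteq> 0" if "\<alpha> \<in> \<Delta>" "z \<in> U" for \<alpha> z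
    using that by (auto simp: U_iff exp_minus)
  have I: "smooth_on U (\<lambda>z. inverse (1 - exp (- pairing \<alpha> z)))" if "\<alpha> \<in> \<Delta>" for \<alpha>
  proof (rule smooth_on_inverse[OF open_U])
    have "smooth_on U (\<lambda>z. 1 + (-1) * exp (pairing (- \<alpha>) z))" by (intro sm)
    then show "smooth_on U (\<lambda>z. 1 - exp (- pairing \<alpha> z))" by (simp add: pairing_minus_left)
  qed (use ne that in auto)
  show ?thesis if "c \<in> RT"
    using that unfolding R_T_Delta_def
    by (induction rule: generated_algebra.induct) (use R I in \<open>auto intro: sm\<close>)
qed

section \<open>Piecewise polynomial functions and the series they represent\<close>

definition piecewise :: "int \<Rightarrow> (real^'n \<Rightarrow> complex^'n \<Rightarrow> complex) \<Rightarrow> bool" where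
  "piecewise D F \<longleftrightarrow> (\<forall>t0\<in>A. \<exists>p. polyT RT D p \<and>
     (\<forall>t\<in>connected_component_set A t0. \<forall>z\<in>U. F t z = p t z))"

text \<open>Stated with \<open>has_sum\<close>, so that summability is part of the claim: such sums
  can be added, whereas \<open>infsum\<close> would silently be 0 for a divergent family.\<close>

definition represents :: "(complex^'n \<Rightarrow> complex) \<Rightarrow> (real^'n \<Rightarrow> complex^'n \<Rightarrow> complex) \<Rightarrow> bool" where
  "represents f F \<longleftrightarrow> (\<forall>z\<in>U. \<forall>\<phi>\<in>test_functions A.
     ((\<lambda>n. f (shift z n) * laplace \<phi> (shift z n)) has_sum (LINT t|lborel. F t z * \<phi> t)) N)"

definition good :: "int \<Rightarrow> (complex^'n \<Rightarrow> complex) \<Rightarrow> bool" where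
  "good D f \<longleftrightarrow> (\<exists>F. piecewise D F \<and> represents f F)"

lemma representsD:
  "represents f F \<Longrightarrow> z \<in> U \<Longrightarrow> \<phi> \<in> test_functions A \<Longrightarrow>
    ((\<lambda>n. f (shift z n) * laplace \<phi> (shift z n)) has_sum (LINT t|lborel. F t z * \<phi> t)) N"
  unfolding represents_def by blast

lemma open_component: "open (connected_component_set A t)"
  by (rule open_connected_component[OF open_areg])

lemma component_refl: "t \<in> A \<Longrightarrow> t \<in> connected_component_set A t"
  by simp

lemma piecewise_continuous:
  assumes "piecewise D F" "z \<in> U" shows "continuous_on A (\<lambda>t. F t z)"
proof (rule continuous_at_imp_continuous_on, rule ballI)
  fix t0 assume t0: "t0 \<in> A"
  let ?C = "connected_component_set A t0"
  obtain p where p: "polyT RT D p" "\<And>t. t \<in> ?C \<Longrightarrow> F t z = p t z"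
    using assms t0 unfolding piecewise_def by blast
  have "continuous_on ?C (\<lambda>t. F t z)"
    by (rule continuous_on_eq[OF polyT_continuous[OF p(1)]]) (rule p(2)[symmetric])
  then show "isCont (\<lambda>t. F t z) t0"
    using open_component component_refl[OF t0] by (simp add: continuous_on_eq_continuous_at)
qed

lemma piecewise_integrable:
  assumes "piecewise D F" "z \<in> U" "\<phi> \<in> test_functions A"
  shows "integrable lborel (\<lambda>t. F t z * \<phi> t)"
  using test_functions_integrable(1)[OF assms(3) open_areg piecewise_continuous[OF assms(1,2)]] .

lemma piecewise_smooth:
  assumes "piecewise D F" shows "smooth_on (A \<times> U) (\<lambda>(t, z). F t z)"
proof (rule smooth_on_local)
  fix x assume "x \<in> A \<times> U"
  then obtain t0 z0 where x: "x = (t0, z0)" "t0 \<in> A" "z0 \<in> U" by blast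
  let ?C = "connected_component_set A t0"
  obtain p where p: "polyT RT D p" "\<And>t z. t \<in> ?C \<Longrightarrow> z \<in> U \<Longrightarrow> F t z = p t z"
    using assms x unfolding piecewise_def by blast
  have o: "open (?C \<times> U)" using open_component open_U by (rule open_Times)
  have "smooth_on (?C \<times> U) (\<lambda>(t, z). F t z)"
    by (rule smooth_on_cong[OF o _ smooth_on_subset[OF polyT_smooth[OF open_U RT_smooth p(1)]]])
      (use p(2) in auto)
  then show "\<exists>T. open T \<and> x \<in> T \<and> smooth_on T (\<lambda>(t, z). F t z)"
    using o x component_refl by blast
qed

text \<open>Lattice shifts of points of \<open>U\<close> avoid the zeros of all \<alpha>, so the
  default values at poles never enter and cancellations need only hold away from the poles.\<close>

lemma good_cong:
  assumes "good D f" "\<And>z. (\<And>\<alpha>. \<alpha> \<in> \<Delta> \<Longrightarrow> pairing \<alpha> z \<noteq> 0) \<Longrightarrow> f z = g z"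
  shows "good D g"
proof -
  have "f (shift z n) = g (shift z n)" if "z \<in> U" "n \<in> N" for z n
    using assms(2)[of "shift z n"] that by (auto simp: U_Delta_def)
  then have "represents f F \<Longrightarrow> represents g F" for F
    unfolding represents_def by (auto cong: has_sum_cong)
  then show ?thesis using assms(1) unfolding good_def by blast
qed

lemma piecewise_mono: "piecewise D F \<Longrightarrow> D \<le> D' \<Longrightarrow> piecewise D' F"
  unfolding piecewise_def by (blast intro: polyT_mono)

lemma good_mono: "good D f \<Longrightarrow> D \<le> D' \<Longrightarrow> good D' f"
  unfolding good_def using piecewise_mono by blast

lemma good_zero: "good D (\<lambda>z. 0)"
  unfolding good_def
  by (rule exI[of _ "\<lambda>t z. 0"]) (auto simp: piecewise_def represents_def intro: polyT.zero exI[of _ "\<lambda>t z. 0"])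

lemma good_add:
  assumes "good D f" "good D g" shows "good D (\<lambda>z. f z + g z)"
proof -
  obtain F G where F: "piecewise D F" "represents f F" and G: "piecewise D G" "represents g G"
    using assms unfolding good_def by blast
  have "piecewise D (\<lambda>t z. F t z + G t z)"
    unfolding piecewise_def
  proof
    fix t0 assume "t0 \<in> A"
    then obtain p q where "polyT RT D p" "polyT RT D q"
      "\<forall>t\<in>connected_component_set A t0. \<forall>z\<in>U. F t z = p t z"
      "\<forall>t\<in>connected_component_set A t0. \<forall>z\<in>U. G t z = q t z"
      using F(1) G(1) unfolding piecewise_def by blast
    then show "\<exists>p. polyT RT D p \<and> (\<forall>t\<in>connected_component_set A t0. \<forall>z\<in>U. F t z + G t z = p t z)"
      by (intro exI[of _ "\<lambda>t z. p t z + q t z"]) (auto intro: polyT.add)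
  qed
  moreover have "represents (\<lambda>z. f z + g z) (\<lambda>t z. F t z + G t z)"
    unfolding represents_def
  proof (intro ballI)
    fix z \<phi> assume z: "z \<in> U" "\<phi> \<in> test_functions A"
    have "(LINT t|lborel. (F t z + G t z) * \<phi> t) = (LINT t|lborel. F t z * \<phi> t) + (LINT t|lborel. G t z * \<phi> t)"
      unfolding distrib_right
      by (intro Bochner_Integration.integral_add piecewise_integrable[OF F(1) z] piecewise_integrable[OF G(1) z])
    then show "((\<lambda>n. (f (shift z n) + g (shift z n)) * laplace \<phi> (shift z n)) has_sum
        (LINT t|lborel. (F t z + G t z) * \<phi> t)) N"
      using has_sum_add[OF representsD[OF F(2) z] representsD[OF G(2) z]] by (simp add: distrib_right)
  qed
  ultimately show ?thesis unfolding good_def by blast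
qed

lemma good_cmult:
  assumes "good D f" shows "good D (\<lambda>z. c * f z)"
proof -
  obtain F where F: "piecewise D F" "represents f F"
    using assms unfolding good_def by blast
  have "piecewise D (\<lambda>t z. c * F t z)"
    unfolding piecewise_def
  proof
    fix t0 assume "t0 \<in> A"
    then obtain p where p: "polyT RT D p"
      "\<forall>t\<in>connected_component_set A t0. \<forall>z\<in>U. F t z = p t z"
      using F(1) unfolding piecewise_def by blast
    have "polyT RT (0 + D) (\<lambda>t z. c * p t z)"
      by (rule polyT_mult) (use RT_mult p polyT.const[OF order_refl RT_const] in auto)
    then show "\<exists>p. polyT RT D p \<and> (\<forall>t\<in>connected_component_set A t0. \<forall>z\<in>U. c * F t z = p t z)"
      using p by (intro exI[of _ "\<lambda>t z. c * p t z"]) auto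
  qed
  moreover have "represents (\<lambda>z. c * f z) (\<lambda>t z. c * F t z)"
    unfolding represents_def
  proof (intro ballI)
    fix z \<phi> assume "z \<in> U" "\<phi> \<in> test_functions A"
    from has_sum_cmult_right[OF representsD[OF F(2) this], of c]
    show "((\<lambda>n. c * f (shift z n) * laplace \<phi> (shift z n)) has_sum (LINT t|lborel. c * F t z * \<phi> t)) N"
      by (simp add: mult.assoc)
  qed
  ultimately show ?thesis unfolding good_def by blast
qed

lemma good_pairing:
  assumes "good D f" shows "good (D - 1) (\<lambda>z. pairing v z * f z)"
proof -
  obtain F where F: "piecewise D F" "represents f F"
    using assms unfolding good_def by blast
  let ?C = "connected_component_set A"
  have "\<forall>t0\<in>A. \<exists>q. polyT RT (D - 1) q \<and> (\<forall>t\<in>?C t0. \<forall>z\<in>U.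
      ((\<lambda>s. F (t + s *\<^sub>R v) z) has_vector_derivative q t z) (at 0))"
  proof
    fix t0 assume t0: "t0 \<in> A"
    obtain p where p: "polyT RT D p" "\<And>t z. t \<in> ?C t0 \<Longrightarrow> z \<in> U \<Longrightarrow> F t z = p t z"
      using F(1) t0 unfolding piecewise_def by blast
    obtain q where q: "polyT RT (D - 1) q"
      "\<And>t z. ((\<lambda>s. p (t + s *\<^sub>R v) z) has_vector_derivative q t z) (at 0)"
      using polyT_derivative[of RT D p v] RT_cmult p(1) by blast
    have "((\<lambda>s. F (t + s *\<^sub>R v) z) has_vector_derivative q t z) (at 0)" if t: "t \<in> ?C t0" "z \<in> U" for t z
    proof (rule has_vector_derivative_transform_within_open[OF q(2)])
      show "open ((\<lambda>s. t + s *\<^sub>R v) -` ?C t0)"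
        by (intro open_vimage open_component continuous_intros)
    qed (use t p in auto)
    then show "\<exists>q. polyT RT (D - 1) q \<and> (\<forall>t\<in>?C t0. \<forall>z\<in>U.
      ((\<lambda>s. F (t + s *\<^sub>R v) z) has_vector_derivative q t z) (at 0))" using q(1) by blast
  qed
  then obtain q where q: "\<And>t0. t0 \<in> A \<Longrightarrow> polyT RT (D - 1) (q t0)"
    "\<And>t0 t z. t0 \<in> A \<Longrightarrow> t \<in> ?C t0 \<Longrightarrow> z \<in> U \<Longrightarrow>
       ((\<lambda>s. F (t + s *\<^sub>R v) z) has_vector_derivative q t0 t z) (at 0)"
    by metis
  \<comment> \<open>The polynomial q is chosen separately for each base point, even within one
    component. All choices are derivatives of the same function, so by uniqueness they agree on the
    component, and evaluating q at base point t is legitimate.\<close>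
  define F' where "F' = (\<lambda>t z. q t t z)"
  have dF: "((\<lambda>s. F (t + s *\<^sub>R v) z) has_vector_derivative F' t z) (at 0)" if "t \<in> A" "z \<in> U" for t z
    unfolding F'_def using q(2)[OF that(1) component_refl[OF that(1)] that(2)] .
  have pw: "piecewise (D - 1) F'"
    unfolding piecewise_def
  proof
    fix t0 assume t0: "t0 \<in> A"
    have "F' t z = q t0 t z" if "t \<in> ?C t0" "z \<in> U" for t z
    proof -
      have "t \<in> A" using that(1) connected_component_subset by blast
      then show ?thesis using vector_derivative_unique_at[OF dF q(2)[OF t0 that]] that by blast
    qed
    then show "\<exists>p. polyT RT (D - 1) p \<and> (\<forall>t\<in>?C t0. \<forall>z\<in>U. F' t z = p t z)"
      using q(1)[OF t0] by blast
  qed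
  have "represents (\<lambda>z. pairing v z * f z) F'"
    unfolding represents_def
  proof (intro ballI)
    fix z \<phi> assume z: "z \<in> U" and \<phi>: "\<phi> \<in> test_functions A"
    have "((\<lambda>n. f (shift z n) * laplace (ddir v \<phi>) (shift z n)) has_sum
        (LINT t|lborel. F t z * ddir v \<phi> t)) N"
      by (rule representsD[OF F(2) z test_functions_ddir[OF \<phi>]])
    then have "((\<lambda>n. - (f (shift z n) * laplace (ddir v \<phi>) (shift z n))) has_sum
        - (LINT t|lborel. F t z * ddir v \<phi> t)) N"
      by (simp add: has_sum_uminus)
    moreover have "- (LINT t|lborel. F t z * ddir v \<phi> t) = (LINT t|lborel. F' t z * \<phi> t)"
      using integral_by_parts_test[OF \<phi> open_areg piecewise_continuous[OF F(1) z]
          piecewise_continuous[OF pw z] dF[OF _ z]] by simp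
    moreover have "- (f w * laplace (ddir v \<phi>) w) = pairing v w * f w * laplace \<phi> w" for w
    proof -
      have "laplace (ddir v \<phi>) w = - (pairing v w * laplace \<phi> w)" using laplace_ddir[OF \<phi>, of v w] by simp
      then show ?thesis by simp
    qed
    ultimately show "((\<lambda>n. pairing v (shift z n) * f (shift z n) * laplace \<phi> (shift z n)) has_sum
        (LINT t|lborel. F' t z * \<phi> t)) N" by simp
  qed
  with pw show ?thesis unfolding good_def by blast
qed

end

section \<open>Summation over the lattice and denominators spanning a wall\<close>

lemma norm_exp_pairing_shift: "norm (exp (pairing t (shift z n))) = norm (exp (pairing t z))"
  by (simp add: pairing_shift norm_exp_eq_Re del: norm_exp_eq_Re) (simp add: norm_exp_eq_Re)

text \<open>A lattice shift changes the exponential only by a phase, so the bound does not depend on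
  n.\<close>

lemma laplace_bound:
  assumes "\<phi> \<in> test_functions A"
  shows "norm (laplace \<phi> (shift z n)) \<le> (LINT t|lborel. norm (exp (pairing t z) * \<phi> t))"
proof -
  have "norm (laplace \<phi> (shift z n)) \<le> (LINT t|lborel. norm (exp (pairing t (shift z n)) * \<phi> t))"
    unfolding laplace_def by (rule integral_norm_bound)
  then show ?thesis by (simp only: norm_mult norm_exp_pairing_shift)
qed

lemma summable_prod_wint:
  fixes x :: "'a \<Rightarrow> complex"
  assumes K: "finite K" and n: "\<And>a. a \<in> K \<Longrightarrow> n a \<ge> 2"
  shows "(\<lambda>j. norm (\<Prod>a\<in>K. inverse (wint (x a) (j a)) ^ n a)) summable_on PiE K (\<lambda>_. UNIV)"
proof -
  have "Infinite_Set_Sum.abs_summable_on (\<lambda>j. \<Prod>a\<in>K. inverse (wint (x a) (j a)) ^ n a) (PiE K (\<lambda>_. UNIV))"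
  proof (rule abs_summable_on_prod_PiE[OF K])
    fix a assume a: "a \<in> K"
    have "(\<lambda>j. norm (inverse (wint (x a) j) ^ n a)) summable_on UNIV"
      by (rule summable_wint[OF n[OF a]])
    then show "Infinite_Set_Sum.abs_summable_on (\<lambda>j. inverse (wint (x a) j) ^ n a) UNIV"
      by (simp only: abs_summable_equivalent)
  qed simp
  then show ?thesis by (simp only: abs_summable_equivalent)
qed

context lattice_pair
begin

text \<open>Identifies \<open>N\<close> with a subset of \<int>^K. Outside K the value is
  \<open>undefined\<close>, so that the result lies in \<open>PiE K\<close>, over which products of
  series are summed.\<close>

definition coords :: "(real^'n) set \<Rightarrow> real^'n \<Rightarrow> real^'n \<Rightarrow> int" where
  "coords K y = (\<lambda>a\<in>K. \<lfloor>a \<bullet> y\<rfloor>)"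

lemma inj_on_coords:
  assumes "dual_family K d" "K \<subseteq> M" shows "inj_on (coords K) N"
proof (rule inj_onI)
  fix y y' assume y: "y \<in> N" "y' \<in> N" "coords K y = coords K y'"
  show "y = y'"
  proof (rule dual_family_eqI[OF assms(1)])
    fix a assume a: "a \<in> K"
    then have "\<lfloor>a \<bullet> y\<rfloor> = \<lfloor>a \<bullet> y'\<rfloor>" using fun_cong[OF y(3), of a] by (simp add: coords_def)
    moreover have "a \<bullet> y \<in> \<int>" "a \<bullet> y' \<in> \<int>" using M_int y a assms(2) by auto
    ultimately show "a \<bullet> y = a \<bullet> y'" by (metis of_int_floor)
  qed
qed

text \<open>Under \<open>coords\<close> the family becomes part of a product of absolutely summable
  one-variable families.\<close>

lemma summable_prod_lattice:
  assumes d: "dual_family K d" "K \<subseteq> M"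
    and n: "\<And>a. a \<in> K \<Longrightarrow> n a \<ge> 2"
  shows "(\<lambda>y. norm (\<Prod>a\<in>K. inverse (wint (x a) \<lfloor>a \<bullet> y\<rfloor>) ^ n a)) summable_on N"
proof -
  let ?f = "\<lambda>j. norm (\<Prod>a\<in>K. inverse (wint (x a) (j a)) ^ n a)"
  have "?f summable_on PiE K (\<lambda>_. UNIV)"
    using summable_prod_wint[OF dual_family_finite[OF d(1)] n] by simp
  moreover have "coords K ` N \<subseteq> PiE K (\<lambda>_. UNIV)" by (auto simp: coords_def)
  ultimately have "?f summable_on coords K ` N" by (rule summable_on_subset_banach)
  then have "(?f \<circ> coords K) summable_on N"
    by (simp only: summable_on_reindex[OF inj_on_coords[OF d]])
  moreover have "?f \<circ> coords K = (\<lambda>y. norm (\<Prod>a\<in>K. inverse (wint (x a) \<lfloor>a \<bullet> y\<rfloor>) ^ n a))"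
    unfolding o_def by (intro ext arg_cong[where f = norm] prod.cong) (auto simp: coords_def)
  ultimately show ?thesis by (simp only:)
qed

end

context arrangement
begin

text \<open>The difference between F and a finite partial sum, multiplied by \<phi>, is at most the
  tail of the sum of |\<open>g n\<close>| times |e^(\<open>pairing t z\<close>) \<phi>(t)|. The
  second factor is integrable and independent of the finite set, so integration preserves
  convergence along the net of all finite subsets.\<close>

lemma has_sum_exchange:
  assumes g: "(\<lambda>n. norm (g n)) summable_on N" and \<phi>: "\<phi> \<in> test_functions A"
    and F: "continuous_on A F" "\<And>t. t \<in> A \<Longrightarrow> F t = (\<Sum>\<^sub>\<infinity>n\<in>N. g n * exp (pairing t (shift z n)))"
  shows "((\<lambda>n. g n * laplace \<phi> (shift z n)) has_sum (LINT t|lborel. F t * \<phi> t)) N"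
proof -
  define T where "T = (\<Sum>\<^sub>\<infinity>n\<in>N. norm (g n))"
  define C where "C = (LINT t|lborel. norm (exp (pairing t z) * \<phi> t))"
  have intF: "integrable lborel (\<lambda>t. F t * \<phi> t)"
    by (rule test_functions_integrable(1)[OF \<phi> open_areg F(1)])
  have intE: "integrable lborel (\<lambda>t. exp (pairing t w) * \<phi> t)" for w
    by (rule laplace_integrable[OF \<phi>])
  have tail: "norm (F t * \<phi> t - (\<Sum>n\<in>X. g n * (exp (pairing t (shift z n)) * \<phi> t)))
      \<le> (T - (\<Sum>n\<in>X. norm (g n))) * norm (exp (pairing t z) * \<phi> t)"
    if X: "finite X" "X \<subseteq> N" for X t
  proof (cases "t \<in> A")
    case False
    then show ?thesis using test_functions_outside[OF \<phi>] by simp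
  next
    case True
    define e where "e = (\<lambda>n. g n * exp (pairing t (shift z n)))"
    have ne: "norm (e n) = norm (exp (pairing t z)) * norm (g n)" for n
      unfolding e_def norm_mult norm_exp_pairing_shift by (rule mult.commute)
    have se: "(\<lambda>n. norm (e n)) summable_on N"
      unfolding ne by (rule summable_on_cmult_right[OF g])
    have "F t - sum e X = infsum e (N - X)"
      using infsum_Diff[OF abs_summable_summable[OF se] summable_on_finite[OF X(1)] X(2)] F(2)[OF True] X(1)
      by (simp add: e_def)
    then have "norm (F t - sum e X) \<le> (\<Sum>\<^sub>\<infinity>n\<in>N - X. norm (e n))"
      using norm_infsum_bound[OF summable_on_cofin_subset[OF se X(1)]] by simp
    also have "\<dots> = norm (exp (pairing t z)) * (\<Sum>\<^sub>\<infinity>n\<in>N - X. norm (g n))"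
      unfolding ne by (rule infsum_cmult_right')
    also have "(\<Sum>\<^sub>\<infinity>n\<in>N - X. norm (g n)) = T - (\<Sum>n\<in>X. norm (g n))"
      unfolding T_def using infsum_Diff[OF g summable_on_finite[OF X(1)] X(2)] X(1) by simp
    finally have b: "norm (F t - sum e X) \<le> norm (exp (pairing t z)) * (T - (\<Sum>n\<in>X. norm (g n)))" .
    have "F t * \<phi> t - (\<Sum>n\<in>X. g n * (exp (pairing t (shift z n)) * \<phi> t)) = (F t - sum e X) * \<phi> t"
      by (simp add: e_def left_diff_distrib sum_distrib_right mult.assoc)
    then have "norm (F t * \<phi> t - (\<Sum>n\<in>X. g n * (exp (pairing t (shift z n)) * \<phi> t)))
        \<le> norm (exp (pairing t z)) * (T - (\<Sum>n\<in>X. norm (g n))) * norm (\<phi> t)"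
      unfolding norm_mult using mult_right_mono[OF b norm_ge_zero[of "\<phi> t"]] by (simp only: norm_mult)
    then show ?thesis by (simp add: norm_mult mult_ac)
  qed
  have bound: "norm ((\<Sum>n\<in>X. g n * laplace \<phi> (shift z n)) - (LINT t|lborel. F t * \<phi> t))
      \<le> (T - (\<Sum>n\<in>X. norm (g n))) * C" if X: "finite X" "X \<subseteq> N" for X
  proof -
    have intX: "integrable lborel (\<lambda>t. \<Sum>n\<in>X. g n * (exp (pairing t (shift z n)) * \<phi> t))"
      by (intro Bochner_Integration.integrable_sum integrable_mult_right intE)
    have "(\<Sum>n\<in>X. g n * laplace \<phi> (shift z n)) = (LINT t|lborel. (\<Sum>n\<in>X. g n * (exp (pairing t (shift z n)) * \<phi> t)))"
      by (subst Bochner_Integration.integral_sum) (auto intro: intE simp: laplace_def)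
    then have "norm ((\<Sum>n\<in>X. g n * laplace \<phi> (shift z n)) - (LINT t|lborel. F t * \<phi> t)) =
       norm (LINT t|lborel. F t * \<phi> t - (\<Sum>n\<in>X. g n * (exp (pairing t (shift z n)) * \<phi> t)))"
      by (subst Bochner_Integration.integral_diff[OF intF intX]) (simp add: norm_minus_commute)
    also have "\<dots> \<le> (LINT t|lborel. (T - (\<Sum>n\<in>X. norm (g n))) * norm (exp (pairing t z) * \<phi> t))"
      by (rule order_trans[OF integral_norm_bound Bochner_Integration.integral_mono])
        (intro Bochner_Integration.integrable_diff intF intX integrable_mult_right integrable_norm intE
          tail[OF X])+
    finally show ?thesis by (simp add: C_def)
  qed
  have "((\<lambda>X. \<Sum>n\<in>X. norm (g n)) \<longlongrightarrow> T) (finite_subsets_at_top N)"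
    using has_sum_infsum[OF g] unfolding has_sum_def T_def .
  then have lim0: "((\<lambda>X. (T - (\<Sum>n\<in>X. norm (g n))) * C) \<longlongrightarrow> (T - T) * C) (finite_subsets_at_top N)"
    by (intro tendsto_intros)
  have "((\<lambda>X. (\<Sum>n\<in>X. g n * laplace \<phi> (shift z n)) - (LINT t|lborel. F t * \<phi> t)) \<longlongrightarrow> 0) (finite_subsets_at_top N)"
    by (rule Lim_null_comparison[OF _ lim0[simplified]])
      (rule eventually_finite_subsets_at_top_weakI, rule bound)
  then show ?thesis unfolding has_sum_def by (rule LIM_zero_cancel)
qed

text \<open>K gives no decay in the direction \<beta> that completes it to a basis. Applying a
  first-order operator along \<beta> twice to the test function multiplies its transform by the
  square of a shifted linear form; dividing by this square supplies the missing factor of order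
  two.\<close>

lemma laplace_summable_corank_one:
  assumes K: "K \<subseteq> \<Delta>" "independent K" "card K + 1 = CARD('n)" and n: "\<And>a. a \<in> K \<Longrightarrow> n a \<ge> 2"
    and z: "z \<in> U" and \<phi>: "\<phi> \<in> test_functions A"
  shows "(\<lambda>y. (\<Prod>a\<in>K. inverse (pairing a (shift z y)) ^ n a) * laplace \<phi> (shift z y)) summable_on N"
proof -
  have KM: "K \<subseteq> M" using K \<Delta>_M by blast
  obtain B d where B: "K \<subseteq> B" "B \<subseteq> M" "independent B" "span B = UNIV" "dual_family B d"
    using extend_basis[OF KM K(2)] by blast
  have finB: "finite B" using B dual_family_finite by blast
  have "card B = CARD('n)"
    using B(3,4) by (metis DIM_cart DIM_real basis_card_eq_dim dim_UNIV mult.right_neutral top_greatest)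
  then have "card (B - K) = 1" using K(3) B(1) finB by (simp add: card_Diff_subset finite_subset)
  then obtain \<beta> where "B - K = {\<beta>}" by (auto simp: card_1_singleton_iff)
  then have \<beta>: "\<beta> \<in> B" "\<beta> \<notin> K" "B = insert \<beta> K" using B(1) by auto
  \<comment> \<open>\<beta> lies in \<open>M\<close> but need not lie in \<Delta>, so
    \<open>pairing \<beta>\<close> may vanish at a shift of z. After subtracting this c its values
    there are \<open>wint 1 j\<close>, which are never 0.\<close>
  define c where "c = pairing \<beta> z - 1"
  define \<phi>1 where "\<phi>1 = (\<lambda>t. (-1) * ddir \<beta> \<phi> t + (- c) * \<phi> t)"
  define \<phi>2 where "\<phi>2 = (\<lambda>t. (-1) * ddir \<beta> \<phi>1 t + (- c) * \<phi>1 t)"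
  have step: "(\<lambda>t. (-1) * ddir \<beta> \<psi> t + (- c) * \<psi> t) \<in> test_functions A"
    "laplace (\<lambda>t. (-1) * ddir \<beta> \<psi> t + (- c) * \<psi> t) w = (pairing \<beta> w - c) * laplace \<psi> w"
    if \<psi>: "\<psi> \<in> test_functions A" for \<psi> w
  proof -
    have d: "ddir \<beta> \<psi> \<in> test_functions A" using \<psi> by (rule test_functions_ddir)
    show "(\<lambda>t. (-1) * ddir \<beta> \<psi> t + (- c) * \<psi> t) \<in> test_functions A"
      by (intro test_functions_add test_functions_mult[OF d smooth_on_const]
          test_functions_mult[OF \<psi> smooth_on_const] open_UNIV)
    have "pairing \<beta> w * laplace \<psi> w = - laplace (ddir \<beta> \<psi>) w" by (rule laplace_ddir[OF \<psi>])
    then show "laplace (\<lambda>t. (-1) * ddir \<beta> \<psi> t + (- c) * \<psi> t) w = (pairing \<beta> w - c) * laplace \<psi> w"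
      unfolding laplace_add[OF d \<psi>] by (simp add: left_diff_distrib)
  qed
  have \<phi>12: "\<phi>1 \<in> test_functions A" "\<phi>2 \<in> test_functions A"
    unfolding \<phi>1_def \<phi>2_def by (intro step(1) \<phi>)+
  have l2: "laplace \<phi>2 w = (pairing \<beta> w - c) ^ 2 * laplace \<phi> w" for w
    unfolding \<phi>2_def step(2)[OF \<phi>12(1)] unfolding \<phi>1_def step(2)[OF \<phi>] by (simp add: power2_eq_square)
  define x where "x = (\<lambda>a. if a = \<beta> then 1 else pairing a z)"
  define n' where "n' = (\<lambda>a. if a = \<beta> then 2 else n a)"
  define P where "P = (\<lambda>y. \<Prod>a\<in>B. inverse (wint (x a) \<lfloor>a \<bullet> y\<rfloor>) ^ n' a)"
  have x1: "exp (x a) \<noteq> 1" if "a \<in> B" for a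
  proof (cases "a = \<beta>")
    case True
    have "norm (exp 1 :: complex) \<noteq> norm (1 :: complex)" by (simp only: norm_exp_eq_Re) simp
    then have "exp 1 \<noteq> (1 :: complex)" by metis
    then show ?thesis using True by (simp add: x_def)
  next
    case False
    then show ?thesis using z that \<beta>(3) K(1) by (auto simp: x_def U_iff)
  qed
  have P: "(\<lambda>y. norm (P y)) summable_on N"
    unfolding P_def by (rule summable_prod_lattice[OF B(5,2)]) (use n \<beta>(3) in \<open>auto simp: n'_def\<close>)
  define C where "C = (LINT t|lborel. norm (exp (pairing t z) * \<phi>2 t))"
  have eq: "(\<Prod>a\<in>K. inverse (pairing a (shift z y)) ^ n a) * laplace \<phi> (shift z y) = P y * laplace \<phi>2 (shift z y)"
    if y: "y \<in> N" for y
  proof -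
    have "pairing \<beta> (shift z y) - c = wint 1 \<lfloor>\<beta> \<bullet> y\<rfloor>"
      using pairing_shift_int[of \<beta> y z] B(2) \<beta>(1) y by (auto simp: c_def)
    moreover have "wint 1 \<lfloor>\<beta> \<bullet> y\<rfloor> \<noteq> 0" using x1[OF \<beta>(1)] wint_nonzero_iff[of 1] by (simp add: x_def)
    ultimately have "inverse (wint 1 \<lfloor>\<beta> \<bullet> y\<rfloor>) ^ 2 * laplace \<phi>2 (shift z y) = laplace \<phi> (shift z y)"
      unfolding l2 by (simp add: power_inverse)
    moreover have "(\<Prod>a\<in>K. inverse (wint (x a) \<lfloor>a \<bullet> y\<rfloor>) ^ n' a) = (\<Prod>a\<in>K. inverse (pairing a (shift z y)) ^ n a)"
    proof (rule prod.cong[OF refl])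
      fix a assume "a \<in> K"
      then show "inverse (wint (x a) \<lfloor>a \<bullet> y\<rfloor>) ^ n' a = inverse (pairing a (shift z y)) ^ n a"
        using pairing_shift_int[of a y z] KM y \<beta>(2) by (auto simp: x_def n'_def)
    qed
    moreover have "P y = inverse (wint 1 \<lfloor>\<beta> \<bullet> y\<rfloor>) ^ 2 * (\<Prod>a\<in>K. inverse (wint (x a) \<lfloor>a \<bullet> y\<rfloor>) ^ n' a)"
      unfolding P_def \<beta>(3) by (subst prod.insert) (use finB \<beta> in \<open>auto simp: x_def n'_def\<close>)
    ultimately show ?thesis by (simp add: mult_ac)
  qed
  have "(\<lambda>y. P y * laplace \<phi>2 (shift z y)) summable_on N"
  proof (rule abs_summable_summable, rule summable_on_comparison_test)
    show "(\<lambda>y. norm (P y) * C) summable_on N" by (rule summable_on_cmult_left[OF P])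
    show "norm (P y * laplace \<phi>2 (shift z y)) \<le> norm (P y) * C" for y
      unfolding norm_mult[of "P y"] C_def by (intro mult_left_mono laplace_bound[OF \<phi>12(2)] norm_ge_zero)
  qed simp
  then show ?thesis using eq by (simp cong: summable_on_cong)
qed

lemma good_corank_one:
  assumes K: "K \<subseteq> \<Delta>" "independent K" "card K + 1 = CARD('n)" and n: "\<And>a. a \<in> K \<Longrightarrow> n a \<ge> 2"
  shows "good D (\<lambda>z. \<Prod>a\<in>K. inverse (pairing a z) ^ n a)"
proof -
  define f where "f = (\<lambda>z. \<Prod>a\<in>K. inverse (pairing a z) ^ n a)"
  obtain x where x: "x \<in> N" "\<And>a. a \<in> K \<Longrightarrow> a \<bullet> x = 0"
    "(\<Union>m\<in>M. (\<lambda>t. m + t) ` span K) = {t. t \<bullet> x \<in> \<int>}" "\<And>t. t \<in> A \<Longrightarrow> t \<bullet> x \<notin> \<int>"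
    by (rule wall_translates[OF K]) blast
  have "represents f (\<lambda>t z. 0)"
    unfolding represents_def
  proof (intro ballI)
    fix z \<phi> assume z: "z \<in> U" and \<phi>: "\<phi> \<in> test_functions A"
    define g where "g = (\<lambda>t. exp (2 * of_real pi * \<i> * of_real (t \<bullet> x)) + (-1 :: complex))"
    have "bounded_linear (\<lambda>t. 2 * of_real pi * \<i> * complex_of_real (t \<bullet> x))"
      by (intro bounded_linear_compose[OF bounded_linear_mult_right]
          bounded_linear_compose[OF bounded_linear_of_real] bounded_linear_inner_left)
    then have sg: "smooth_on UNIV g"
      unfolding g_def by (intro smooth_on_add smooth_on_exp smooth_on_linear smooth_on_const open_UNIV)
    have gnz: "g t \<noteq> 0" if "t \<in> A" for t
    proof
      assume "g t = 0"
      then have "exp (2 * of_real pi * \<i> * complex_of_real (t \<bullet> x)) = 1" by (simp add: g_def)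
      then obtain k :: int where "2 * pi * (t \<bullet> x) = of_int (2 * k) * pi"
        unfolding exp_eq_1 by auto
      then have "t \<bullet> x = of_int k" by simp
      then show False using x(4)[OF that] by simp
    qed
    \<comment> \<open>Dividing by g turns each term for \<phi> into the difference
      \<open>h (y + x) - h y\<close>: f is unchanged by the shift x, while the exponential acquires
      the factor g + 1. As h is summable and the shift permutes \<open>N\<close>, the differences
      sum to 0.\<close>
    define \<psi> where "\<psi> = (\<lambda>t. inverse (g t) * \<phi> t)"
    have \<psi>: "\<psi> \<in> test_functions A"
      unfolding \<psi>_def by (rule test_functions_divide[OF \<phi> sg gnz])
    define h where "h = (\<lambda>y. f (shift z y) * laplace \<psi> (shift z y))"
    have "h summable_on N"
      unfolding h_def f_def by (rule laplace_summable_corank_one[OF K n z \<psi>])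
    then have hs: "(h has_sum infsum h N) N" by (rule has_sum_infsum)
    have bij: "bij_betw (\<lambda>y. y + x) N N"
      by (rule bij_betw_byWitness[where f' = "\<lambda>y. y - x"]) (use N_add N_diff x(1) in auto)
    have "((\<lambda>y. h (y + x)) has_sum infsum h N) N"
      using hs by (simp only: has_sum_reindex_bij_betw[OF bij])
    then have "((\<lambda>y. h (y + x) + - h y) has_sum (infsum h N + - infsum h N)) N"
      by (intro has_sum_add) (use hs in \<open>simp_all add: has_sum_uminus\<close>)
    moreover have "h (y + x) + - h y = f (shift z y) * laplace \<phi> (shift z y)" for y
    proof -
      have "f (shift z (y + x)) = f (shift z y)"
        unfolding f_def by (rule prod.cong) (auto simp: pairing_shift inner_add_right x(2))
      moreover have "laplace \<psi> (shift z (y + x)) - laplace \<psi> (shift z y) = laplace \<phi> (shift z y)"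
      proof -
        have "laplace \<psi> (shift z (y + x)) - laplace \<psi> (shift z y) =
            (LINT t|lborel. exp (pairing t (shift z (y + x))) * \<psi> t - exp (pairing t (shift z y)) * \<psi> t)"
          unfolding laplace_def
          by (rule Bochner_Integration.integral_diff[symmetric]) (rule laplace_integrable[OF \<psi>])+
        also have "\<dots> = laplace \<phi> (shift z y)"
          unfolding laplace_def
        proof (rule Bochner_Integration.integral_cong[OF refl])
          fix t
          have "pairing t (shift z (y + x)) = pairing t (shift z y) + 2 * of_real pi * \<i> * of_real (t \<bullet> x)"
            by (simp add: pairing_shift inner_add_right distrib_left)
          then have "exp (pairing t (shift z (y + x))) * \<psi> t - exp (pairing t (shift z y)) * \<psi> t =
              exp (pairing t (shift z y)) * (g t * \<psi> t)"
            by (simp add: exp_add g_def algebra_simps)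
          also have "g t * \<psi> t = \<phi> t"
            using gnz[of t] test_functions_outside[OF \<phi>, of t] by (cases "t \<in> A") (auto simp: \<psi>_def)
          finally show "exp (pairing t (shift z (y + x))) * \<psi> t - exp (pairing t (shift z y)) * \<psi> t =
              exp (pairing t (shift z y)) * \<phi> t" .
        qed
        finally show ?thesis .
      qed
      ultimately show ?thesis by (simp add: h_def right_diff_distrib[symmetric])
    qed
    ultimately show "((\<lambda>n. f (shift z n) * laplace \<phi> (shift z n)) has_sum (LINT t|lborel. 0 * \<phi> t)) N"
      by simp
  qed
  moreover have "piecewise D (\<lambda>t z. 0)"
    unfolding piecewise_def by (auto intro!: exI[of _ "\<lambda>t z. 0"] polyT.zero)
  ultimately show ?thesis unfolding good_def f_def by blast
qed

end

section \<open>Denominators forming a basis\<close>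

lemma has_sum_finite_sum:
  fixes f :: "'i \<Rightarrow> 'a \<Rightarrow> complex"
  assumes "\<And>i. i \<in> I \<Longrightarrow> (f i has_sum s i) A"
  shows "((\<lambda>x. \<Sum>i\<in>I. f i x) has_sum (\<Sum>i\<in>I. s i)) A"
  using assms
proof (induction I rule: infinite_finite_induct)
  case (insert i I)
  then have "((\<lambda>x. f i x + (\<Sum>i\<in>I. f i x)) has_sum (s i + (\<Sum>i\<in>I. s i))) A"
    by (intro has_sum_add) auto
  then show ?case using insert.hyps by simp
qed simp_all

text \<open>Passing to another floor would force the connected image to contain an integer.\<close>

lemma connected_floor_constant:
  fixes g :: "'a::topological_space \<Rightarrow> real"
  assumes C: "connected C" "continuous_on C g" and ni: "\<And>t. t \<in> C \<Longrightarrow> g t \<notin> \<int>"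
    and s: "s \<in> C" and t: "t \<in> C"
  shows "\<lfloor>g s\<rfloor> = \<lfloor>g t\<rfloor>"
proof -
  have conn: "connected (g ` C)" using C by (intro connected_continuous_image)
  have False if uv: "u \<in> C" "v \<in> C" "\<lfloor>g u\<rfloor> < \<lfloor>g v\<rfloor>" for u v
  proof -
    have "g u \<le> of_int \<lfloor>g v\<rfloor>" "of_int \<lfloor>g v\<rfloor> \<le> g v" using uv(3) by linarith+
    then have "of_int \<lfloor>g v\<rfloor> \<in> g ` C"
      using connectedD_interval[OF conn imageI[OF uv(1)] imageI[OF uv(2)]] by blast
    then show False using ni by (metis Ints_of_int imageE)
  qed
  then show ?thesis using s t by (metis linorder_neqE)
qed

context lattice_pair
begin

lemma lattice_sum:
  assumes d: "dual_family K d" "K \<subseteq> M"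
    and x: "\<And>a. a \<in> K \<Longrightarrow> exp (pairing a z) \<noteq> 1" and n: "\<And>a. a \<in> K \<Longrightarrow> n a \<ge> 2"
    and ni: "\<And>a m. a \<in> K \<Longrightarrow> m \<in> M \<Longrightarrow> d a \<bullet> (t + m) \<notin> \<int>"
  shows "(\<Sum>\<^sub>\<infinity>y\<in>N. (\<Prod>a\<in>K. inverse (pairing a (shift z y)) ^ n a) * exp (pairing t (shift z y))) =
    (\<Sum>m\<in>reps K d. exp (- pairing m z) * (\<Prod>a\<in>K. exp (of_int \<lfloor>d a \<bullet> (t + m)\<rfloor> * pairing a z) *
        per_poly (n a) (pairing a z) (of_real (d a \<bullet> (t + m)) - of_int \<lfloor>d a \<bullet> (t + m)\<rfloor>)))
      / of_nat (card (reps K d))"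
proof -
  have finK: "finite K" using d dual_family_finite by blast
  define G where "G = reps K d"
  have finG: "finite G" and G0: "G \<noteq> {}"
    unfolding G_def using finite_reps[OF d(1)] zero_in_reps by auto
  then have cG: "of_nat (card G) \<noteq> (0 :: complex)" by simp
  have GM: "m \<in> M" if "m \<in> G" for m using that by (simp add: G_def reps_def)
  define S where "S = PiE K (\<lambda>_. UNIV :: int set)"
  define w where "w = (\<lambda>a j. wint (pairing a z) j)"
  \<comment> \<open>The term at the point \<open>Y j\<close> of the lattice dual to \<int>K, with t
    + m in place of t. It is a product over K of functions of single coordinates of j, so its sum
    over all j factors into one-variable series.\<close>
  define T where "T = (\<lambda>m j. \<Prod>a\<in>K. exp (of_real (d a \<bullet> (t + m)) * w a (j a)) * inverse (w a (j a)) ^ n a)"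
  define V where "V = (\<lambda>m. \<Prod>a\<in>K. exp (of_int \<lfloor>d a \<bullet> (t + m)\<rfloor> * pairing a z) *
        per_poly (n a) (pairing a z) (of_real (d a \<bullet> (t + m)) - of_int \<lfloor>d a \<bullet> (t + m)\<rfloor>))"
  define Y where "Y = (\<lambda>j. \<Sum>a\<in>K. of_int (j a) *\<^sub>R d a)"
  have Y: "a \<bullet> Y j = of_int (j a)" if "a \<in> K" for a j
    unfolding Y_def by (rule dual_family_inner_sum(1)[OF d(1) that])

  have Tsum: "(T m has_sum V m) S" if m: "m \<in> G" for m
  proof -
    have fac: "(\<lambda>j. norm (exp (of_real (d a \<bullet> (t + m)) * w a j) * inverse (w a j) ^ n a)) summable_on UNIV"
      if a: "a \<in> K" for a
    proof -
      have "norm (exp (of_real (d a \<bullet> (t + m)) * w a j)) = exp ((d a \<bullet> (t + m)) * Re (pairing a z))" for j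
        by (simp add: norm_exp_eq_Re w_def)
      moreover have "(\<lambda>j. exp ((d a \<bullet> (t + m)) * Re (pairing a z)) * norm (inverse (w a j) ^ n a)) summable_on UNIV"
        unfolding w_def
        by (intro summable_on_cmult_right summable_wint n a)
      ultimately show ?thesis by (simp only: norm_mult)
    qed
    have AS: "Infinite_Set_Sum.abs_summable_on (T m) S"
      unfolding T_def S_def
      by (rule abs_summable_on_prod_PiE[OF finK]) (use fac in \<open>simp_all only: abs_summable_equivalent countableI_type\<close>)
    have "T m summable_on S"
      by (rule abs_summable_summable) (use AS in \<open>simp only: abs_summable_equivalent\<close>)
    moreover have "infsum (T m) S = V m"
      unfolding T_def S_def V_def
    proof (subst infsum_prod_PiE_abs[OF finK])
      show "(\<Prod>a\<in>K. \<Sum>\<^sub>\<infinity>j. exp (of_real (d a \<bullet> (t + m)) * w a j) * inverse (w a j) ^ n a) =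
        (\<Prod>a\<in>K. exp (of_int \<lfloor>d a \<bullet> (t + m)\<rfloor> * pairing a z) *
        per_poly (n a) (pairing a z) (of_real (d a \<bullet> (t + m)) - of_int \<lfloor>d a \<bullet> (t + m)\<rfloor>))"
      proof (rule prod.cong[OF refl])
        fix a assume a: "a \<in> K"
        have "of_int \<lfloor>d a \<bullet> (t + m)\<rfloor> \<noteq> d a \<bullet> (t + m)"
          using ni[OF a GM[OF m]] by (metis Ints_of_int)
        then have "of_int \<lfloor>d a \<bullet> (t + m)\<rfloor> < d a \<bullet> (t + m)" "d a \<bullet> (t + m) < of_int \<lfloor>d a \<bullet> (t + m)\<rfloor> + 1"
          by linarith+
        from sum_wint[OF x[OF a] n[OF a] this]
        show "(\<Sum>\<^sub>\<infinity>j. exp (of_real (d a \<bullet> (t + m)) * w a j) * inverse (w a j) ^ n a) =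
          exp (of_int \<lfloor>d a \<bullet> (t + m)\<rfloor> * pairing a z) *
          per_poly (n a) (pairing a z) (of_real (d a \<bullet> (t + m)) - of_int \<lfloor>d a \<bullet> (t + m)\<rfloor>)"
          unfolding w_def .
      qed
    qed (rule fac)
    ultimately show ?thesis by (simp only: has_sum_infsum flip: \<open>infsum (T m) S = V m\<close>)
  qed

  \<comment> \<open>Replacing t by t + m multiplies the term at w = z + 2 pi i \<open>Y j\<close> by
    e^(\<open>pairing m w\<close>). Once e^(\<open>pairing m z\<close>) is removed, the character of
    \<open>Y j\<close> is left, and averaging it over m detects membership in
    \<open>N\<close>.\<close>
  have Tm: "exp (- pairing m z) * T m j = cis (2 * pi * (m \<bullet> Y j)) * T 0 j" for m j
  proof -
    have "(\<Sum>a\<in>K. of_real (d a \<bullet> m) * w a (j a)) =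
       (\<Sum>a\<in>K. of_real (d a \<bullet> m) * pairing a z) + 2 * of_real pi * \<i> * (\<Sum>a\<in>K. of_real (d a \<bullet> m) * of_int (j a))"
      unfolding sum_distrib_left sum.distrib[symmetric] by (rule sum.cong) (auto simp: w_def algebra_simps)
    also have "(\<Sum>a\<in>K. of_real (d a \<bullet> m) * pairing a z) = pairing m z"
    proof -
      have "pairing m z = pairing (\<Sum>a\<in>K. (d a \<bullet> m) *\<^sub>R a) z" by (simp only: dual_family_expand[OF d(1)])
      then show ?thesis by (simp add: pairing_sum_left pairing_scaleR_left)
    qed
    also have "(\<Sum>a\<in>K. of_real (d a \<bullet> m) * of_int (j a)) = complex_of_real (m \<bullet> Y j)"
      unfolding dual_family_inner[OF d(1), of m] of_real_sum
      by (rule sum.cong) (simp_all add: Y)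
    finally have e: "(\<Sum>a\<in>K. of_real (d a \<bullet> m) * w a (j a)) = pairing m z + 2 * of_real pi * \<i> * of_real (m \<bullet> Y j)" .
    have "T m j = (\<Prod>a\<in>K. exp (of_real (d a \<bullet> m) * w a (j a)) *
        (exp (of_real (d a \<bullet> (t + 0)) * w a (j a)) * inverse (w a (j a)) ^ n a))"
      unfolding T_def by (rule prod.cong) (auto simp: inner_add_right distrib_right exp_add)
    also have "\<dots> = exp (\<Sum>a\<in>K. of_real (d a \<bullet> m) * w a (j a)) * T 0 j"
      unfolding prod.distrib[of _ _ K] T_def exp_sum[OF finK] by (simp add: mult.assoc)
    also have "\<dots> = exp (pairing m z) * (cis (2 * pi * (m \<bullet> Y j)) * T 0 j)"
      unfolding e by (simp add: exp_add cis_conv_exp mult_ac)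
    finally show ?thesis by (simp add: exp_minus mult.assoc[symmetric])
  qed

  have char: "(\<Sum>m\<in>G. exp (- pairing m z) * T m j / of_nat (card G)) = (if Y j \<in> N then T 0 j else 0)" for j
  proof -
    have "(\<Sum>m\<in>G. exp (- pairing m z) * T m j / of_nat (card G)) =
        (\<Sum>m\<in>G. cis (2 * pi * (m \<bullet> Y j))) * T 0 j / of_nat (card G)"
      by (simp only: Tm sum_distrib_right sum_divide_distrib)
    also have "(\<Sum>m\<in>G. cis (2 * pi * (m \<bullet> Y j))) = (if Y j \<in> N then of_nat (card G) else 0)"
      unfolding G_def by (rule sum_characters[OF d]) (simp add: Y)
    finally show ?thesis using cG by simp
  qed

  have "((\<lambda>j. \<Sum>m\<in>G. exp (- pairing m z) / of_nat (card G) * T m j) has_sum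
      (\<Sum>m\<in>G. exp (- pairing m z) / of_nat (card G) * V m)) S"
    by (intro has_sum_finite_sum has_sum_cmult_right Tsum)
  then have total: "(\<Sum>\<^sub>\<infinity>j\<in>S. if Y j \<in> N then T 0 j else 0) = (\<Sum>m\<in>G. exp (- pairing m z) * V m) / of_nat (card G)"
    by (simp add: char[symmetric] infsumI sum_divide_distrib)

  have Yc: "Y (coords K y) = y" if y: "y \<in> N" for y
  proof (rule dual_family_eqI[OF d(1)])
    fix a assume a: "a \<in> K"
    then have "a \<bullet> y \<in> \<int>" using d(2) y M_int by blast
    then show "a \<bullet> Y (coords K y) = a \<bullet> y" using a by (simp add: Y coords_def of_int_floor)
  qed
  have "(\<Sum>\<^sub>\<infinity>y\<in>N. (\<Prod>a\<in>K. inverse (pairing a (shift z y)) ^ n a) * exp (pairing t (shift z y))) =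
      infsum (T 0 \<circ> coords K) N"
  proof (rule infsum_cong)
    fix y assume y: "y \<in> N"
    have ws: "w a (coords K y a) = pairing a (shift z y)" if "a \<in> K" for a
    proof -
      have "a \<in> M" using that d(2) by blast
      then have "real_of_int \<lfloor>a \<bullet> y\<rfloor> = a \<bullet> y" by (rule of_int_floor[OF M_int[OF _ y]])
      then have "complex_of_int \<lfloor>a \<bullet> y\<rfloor> = of_real (a \<bullet> y)" by (metis of_real_of_int_eq)
      then show ?thesis using that by (simp add: w_def coords_def pairing_shift)
    qed
    have "(T 0 \<circ> coords K) y = (\<Prod>a\<in>K. exp (of_real (d a \<bullet> t) * pairing a (shift z y)) * inverse (pairing a (shift z y)) ^ n a)"
      unfolding T_def o_def by (rule prod.cong) (auto simp: ws)
    also have "\<dots> = exp (\<Sum>a\<in>K. of_real (d a \<bullet> t) * pairing a (shift z y)) * (\<Prod>a\<in>K. inverse (pairing a (shift z y)) ^ n a)"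
      by (simp add: prod.distrib exp_sum[OF finK])
    also have "(\<Sum>a\<in>K. of_real (d a \<bullet> t) * pairing a (shift z y)) = pairing t (shift z y)"
    proof -
      have "pairing t (shift z y) = pairing (\<Sum>a\<in>K. (d a \<bullet> t) *\<^sub>R a) (shift z y)"
        by (simp only: dual_family_expand[OF d(1)])
      then show ?thesis by (simp add: pairing_sum_left pairing_scaleR_left)
    qed
    finally show "(\<Prod>a\<in>K. inverse (pairing a (shift z y)) ^ n a) * exp (pairing t (shift z y)) = (T 0 \<circ> coords K) y"
      by (simp add: mult.commute)
  qed
  also have "\<dots> = infsum (T 0) (coords K ` N)"
    by (rule infsum_reindex[OF inj_on_coords[OF d], symmetric])
  also have "\<dots> = (\<Sum>\<^sub>\<infinity>j\<in>S. if Y j \<in> N then T 0 j else 0)"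
  proof (rule infsum_cong_neutral)
    have sub: "coords K ` N \<subseteq> S" by (auto simp: coords_def S_def)
    then show "T 0 j = 0" if "j \<in> coords K ` N - S" for j using that by blast
    show "T 0 j = (if Y j \<in> N then T 0 j else 0)" if "j \<in> coords K ` N \<inter> S" for j
      using that Yc by auto
    show "(if Y j \<in> N then T 0 j else 0) = 0" if j: "j \<in> S - coords K ` N" for j
    proof -
      \<comment> \<open>Elements of S are \<open>undefined\<close> off K, so equality holds there
        too. Hence a j outside the image of \<open>N\<close> has \<open>Y j\<close> outside
        \<open>N\<close>.\<close>
      have "coords K (Y j) = j"
      proof (rule ext)
        fix a
        show "coords K (Y j) a = j a"
        proof (cases "a \<in> K")
          case False
          have "j \<in> PiE K (\<lambda>_. UNIV)" using j unfolding S_def by (rule DiffD1)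
          then have "j a = undefined" using False by (rule PiE_arb)
          then show ?thesis using False by (simp add: coords_def)
        qed (simp add: coords_def Y)
      qed
      then have "Y j \<notin> N" using j by (metis DiffD2 imageI)
      then show ?thesis by simp
    qed
  qed
  also note total
  finally show ?thesis unfolding V_def G_def .
qed

end

context arrangement
begin

text \<open>If the coordinate at a were the integer l, then t would lie in the span of K - {a}
  translated by l a - m, which is the translate of a wall by an element of \<open>M\<close>.\<close>

lemma basis_coord_not_int:
  assumes K: "K \<subseteq> \<Delta>" "independent K" "dual_family K d" "card K = CARD('n)"
    and t: "t \<in> A" and a: "a \<in> K" and m: "m \<in> M"
  shows "d a \<bullet> (t + m) \<notin> \<int>"
proof
  assume "d a \<bullet> (t + m) \<in> \<int>"
  then obtain l :: int where l: "d a \<bullet> (t + m) = of_int l" using Ints_cases by blast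
  have finK: "finite K" using K(3) by (rule dual_family_finite)
  have "t \<notin> A"
  proof (rule areg_avoids)
    show "K - {a} \<subseteq> \<Delta>" using K(1) by blast
    show "independent (K - {a})" using K(2) by (rule independent_mono) blast
    show "card (K - {a}) + 1 = CARD('n)" using K(4) a finK by (simp add: card_Diff_singleton)
    show "of_int l *\<^sub>R a - m \<in> M" using a K(1) \<Delta>_M by (intro M_diff M_scale m) auto
    have "t + m = of_int l *\<^sub>R a + (\<Sum>b\<in>K - {a}. (d b \<bullet> (t + m)) *\<^sub>R b)"
      using sum.remove[OF finK a, of "\<lambda>b. (d b \<bullet> (t + m)) *\<^sub>R b"]
      by (simp only: dual_family_expand[OF K(3)] l)
    moreover have "t - (X - m) = R" if "t + m = X + R" for X R
      using that by (simp add: algebra_simps)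
    ultimately have "t - (of_int l *\<^sub>R a - m) = (\<Sum>b\<in>K - {a}. (d b \<bullet> (t + m)) *\<^sub>R b)"
      by blast
    then show "t - (of_int l *\<^sub>R a - m) \<in> span (K - {a})"
      by (simp only:) (intro span_sum span_scale span_base)
  qed
  then show False using t by blast
qed

lemma good_basis:
  assumes K: "K \<subseteq> \<Delta>" "independent K" "span K = UNIV" and n: "\<And>a. a \<in> K \<Longrightarrow> n a \<ge> 2"
  shows "good (\<Sum>a\<in>K. int (n a) - 1) (\<lambda>z. \<Prod>a\<in>K. inverse (pairing a z) ^ n a)"
proof -
  obtain d where d: "dual_family K d" using dual_family_exists[OF K(2,3)] by blast
  have KM: "K \<subseteq> M" using K(1) \<Delta>_M by blast
  have cK: "card K = CARD('n)"
    using K(2,3) by (metis DIM_cart DIM_real basis_card_eq_dim dim_UNIV mult.right_neutral top_greatest)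
  define f where "f = (\<lambda>z. \<Prod>a\<in>K. inverse (pairing a z) ^ n a)"
  define G where "G = reps K d"
  have GM: "m \<in> M" if "m \<in> G" for m using that by (simp add: G_def reps_def)
  \<comment> \<open>The floors are replaced by free integer parameters l. For fixed l this is a
    polynomial in t with coefficients in \<open>RT\<close>; on one component of \<open>A\<close> the
    floors are constant, so F coincides with a single such polynomial.\<close>
  define P where "P = (\<lambda>l t z. (\<Sum>m\<in>G. exp (- pairing m z) * (\<Prod>a\<in>K. exp (of_int (l a m) * pairing a z) *
        per_poly (n a) (pairing a z) (of_real (d a \<bullet> (t + m)) - of_int (l a m)))) / of_nat (card G))"
  define F where "F = (\<lambda>t. P (\<lambda>a m. \<lfloor>d a \<bullet> (t + m)\<rfloor>) t)"
  have ni: "d a \<bullet> (t + m) \<notin> \<int>" if "t \<in> A" "a \<in> K" "m \<in> M" for t a m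
    by (rule basis_coord_not_int[OF K(1,2) d cK that])
  have polyP: "polyT RT (\<Sum>a\<in>K. int (n a) - 1) (P l)" for l :: "_ \<Rightarrow> _ \<Rightarrow> int"
  proof -
    have R1: "(\<lambda>z. 1) \<in> RT" by (rule RT_const)
    have lin: "polyT RT 1 (\<lambda>t z. of_real (d a \<bullet> (t + m)) - of_int (l a m))" for a m
    proof -
      have "polyT RT 1 (\<lambda>t z. of_real (d a \<bullet> t) + (of_real (d a \<bullet> m) - of_int (l a m)))"
        by (intro polyT.add polyT_inner RT_const polyT.const[where c = "\<lambda>z. of_real (d a \<bullet> m) - of_int (l a m)"]) auto
      then show ?thesis by (simp add: inner_add_right add_diff_eq)
    qed
    have fac: "polyT RT (0 + (int (n a) - 1)) (\<lambda>t z. exp (of_int (l a m) * pairing a z) *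
        per_poly (n a) (pairing a z) (of_real (d a \<bullet> (t + m)) - of_int (l a m)))" if a: "a \<in> K" for a m
    proof (rule polyT_mult[OF RT_mult])
      have "(\<lambda>z. exp (pairing (of_int (l a m) *\<^sub>R a) z)) \<in> RT"
        by (intro RT_exp M_scale) (use a KM in blast)
      then show "polyT RT 0 (\<lambda>t z. exp (of_int (l a m) * pairing a z))"
        by (intro polyT.const) (simp_all add: pairing_scaleR_left)
      show "polyT RT (int (n a) - 1)
        (\<lambda>t z. per_poly (n a) (pairing a z) (of_real (d a \<bullet> (t + m)) - of_int (l a m)))"
        unfolding per_poly_def
      proof (rule polyT_sum)
        fix i assume i: "i \<in> {..<n a}"
        have "polyT RT (0 + int i) (\<lambda>t z. per_coeff (pairing a z) (n a - i) / fact i *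
            (of_real (d a \<bullet> (t + m)) - of_int (l a m)) ^ i)"
        proof (rule polyT_mult[OF RT_mult])
          have "(\<lambda>z. inverse (fact i) * per_coeff (pairing a z) (n a - i)) \<in> RT"
            by (intro RT_cmult RT_per_coeff) (use a K in blast)
          then show "polyT RT 0 (\<lambda>t z. per_coeff (pairing a z) (n a - i) / fact i)"
            by (intro polyT.const) (simp_all add: divide_inverse mult.commute)
          show "polyT RT (int i) (\<lambda>t z. (of_real (d a \<bullet> (t + m)) - of_int (l a m)) ^ i)"
            by (rule polyT_power[OF RT_mult R1 lin])
        qed
        then show "polyT RT (int (n a) - 1) (\<lambda>t z. per_coeff (pairing a z) (n a - i) / fact i *
            (of_real (d a \<bullet> (t + m)) - of_int (l a m)) ^ i)"
          by (rule polyT_mono) (use i in auto)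
      qed
    qed
    have "polyT RT (0 + (\<Sum>a\<in>K. int (n a) - 1)) (\<lambda>t z. (inverse (of_nat (card G)) * exp (pairing (- m) z)) *
        (\<Prod>a\<in>K. exp (of_int (l a m) * pairing a z) *
        per_poly (n a) (pairing a z) (of_real (d a \<bullet> (t + m)) - of_int (l a m))))" if m: "m \<in> G" for m
      by (intro polyT_mult[OF RT_mult] polyT.const[OF order_refl] RT_cmult RT_exp M_minus GM m
          polyT_prod[OF RT_mult R1]) (use fac in auto)
    then have "polyT RT (0 + (\<Sum>a\<in>K. int (n a) - 1)) (\<lambda>t z. \<Sum>m\<in>G. (inverse (of_nat (card G)) * exp (pairing (- m) z)) *
        (\<Prod>a\<in>K. exp (of_int (l a m) * pairing a z) *
        per_poly (n a) (pairing a z) (of_real (d a \<bullet> (t + m)) - of_int (l a m))))"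
      by (rule polyT_sum)
    then show ?thesis
      unfolding P_def by (simp add: pairing_minus_left sum_distrib_left divide_inverse mult_ac)
  qed
  have pw: "piecewise (\<Sum>a\<in>K. int (n a) - 1) F"
    unfolding piecewise_def
  proof
    fix t0 assume t0: "t0 \<in> A"
    let ?C = "connected_component_set A t0"
    have "F t z = P (\<lambda>a m. \<lfloor>d a \<bullet> (t0 + m)\<rfloor>) t z" if t: "t \<in> ?C" for t z
    proof -
      have "\<lfloor>d a \<bullet> (t + m)\<rfloor> = \<lfloor>d a \<bullet> (t0 + m)\<rfloor>" if "a \<in> K" "m \<in> G" for a m
      proof (rule connected_floor_constant[where C = ?C and g = "\<lambda>t. d a \<bullet> (t + m)"])
        show "continuous_on ?C (\<lambda>t. d a \<bullet> (t + m))" by (intro continuous_intros)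
        show "d a \<bullet> (s + m) \<notin> \<int>" if "s \<in> ?C" for s
          using that connected_component_subset[of A t0]
          by (intro ni \<open>a \<in> K\<close> GM \<open>m \<in> G\<close>) blast
      qed (use t component_refl[OF t0] in auto)
      then show ?thesis unfolding F_def P_def by (auto intro!: sum.cong prod.cong arg_cong2[where f = "(/)"])
    qed
    then show "\<exists>p. polyT RT (\<Sum>a\<in>K. int (n a) - 1) p \<and> (\<forall>t\<in>?C. \<forall>z\<in>U. F t z = p t z)"
      using polyP by blast
  qed
  have "represents f F"
    unfolding represents_def
  proof (intro ballI)
    fix z \<phi> assume z: "z \<in> U" and \<phi>: "\<phi> \<in> test_functions A"
    have x: "exp (pairing a z) \<noteq> 1" if "a \<in> K" for a using z that K(1) by (auto simp: U_iff)
    have "(\<lambda>y. norm (\<Prod>a\<in>K. inverse (wint (pairing a z) \<lfloor>a \<bullet> y\<rfloor>) ^ n a)) summable_on N"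
      by (rule summable_prod_lattice[OF d KM n])
    moreover have "(\<Prod>a\<in>K. inverse (wint (pairing a z) \<lfloor>a \<bullet> y\<rfloor>) ^ n a) = f (shift z y)" if "y \<in> N" for y
      unfolding f_def by (rule prod.cong) (use pairing_shift_int that KM in auto)
    ultimately have "(\<lambda>y. norm (f (shift z y))) summable_on N" by (simp cong: summable_on_cong)
    then show "((\<lambda>n. f (shift z n) * laplace \<phi> (shift z n)) has_sum (LINT t|lborel. F t z * \<phi> t)) N"
    proof (rule has_sum_exchange[OF _ \<phi> piecewise_continuous[OF pw z]])
      fix t assume t: "t \<in> A"
      show "F t z = (\<Sum>\<^sub>\<infinity>n\<in>N. f (shift z n) * exp (pairing t (shift z n)))"
        unfolding f_def by (subst lattice_sum[OF d KM x n ni[OF t]]) (simp_all add: F_def P_def G_def)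
    qed
  qed
  with pw show ?thesis unfolding good_def f_def by blast
qed

end

section \<open>Partial fractions and decomposition by degree\<close>

text \<open>Subtracting 2^e0 times the relation at c from the relation at 2 c eliminates the
  exponent e0. The factors 2^e - 2^e0 that appear on the other terms are nonzero.\<close>

lemma powi_linear_independent:
  fixes h :: "int \<Rightarrow> complex"
  assumes "finite I" "\<And>c. c \<noteq> 0 \<Longrightarrow> (\<Sum>e\<in>I. c powi e * h e) = 0" "e \<in> I"
  shows "h e = 0"
  using assms
proof (induction I arbitrary: h e rule: finite_induct)
  case (insert e0 I)
  have two: "(2::complex) powi e = 2 powi e' \<longleftrightarrow> e = e'" for e e'
  proof
    assume "(2::complex) powi e = 2 powi e'"
    then have "norm ((2::complex) powi e) = norm ((2::complex) powi e')" by simp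
    then have "(2::real) powi e = 2 powi e'" by (simp add: norm_power_int)
    then show "e = e'"
      using power_int_strict_increasing[of e e' "2::real"] power_int_strict_increasing[of e' e "2::real"]
      by (cases e e' rule: linorder_cases) auto
  qed simp
  have I0: "h e = 0" if "e \<in> I" for e
  proof -
    have "(\<Sum>e\<in>I. c powi e * ((2 powi e - 2 powi e0) * h e)) = 0" if c: "c \<noteq> 0" for c
    proof -
      have "(\<Sum>e\<in>insert e0 I. (2 * c) powi e * h e) - 2 powi e0 * (\<Sum>e\<in>insert e0 I. c powi e * h e) = 0"
        using insert.prems(1)[of c] insert.prems(1)[of "2 * c"] c by simp
      then show ?thesis
        using insert.hyps
        by (simp add: power_int_mult_distrib algebra_simps sum_distrib_left sum_subtractf)
    qed
    from insert.IH[OF this that] have "(2 powi e - 2 powi e0) * h e = 0" .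
    moreover have "e \<noteq> e0" using that insert.hyps by blast
    ultimately show ?thesis using two[of e e0] by simp
  qed
  moreover have "h e0 = 0"
    using insert.prems(1)[of 1] insert.hyps I0 by simp
  ultimately show ?case using insert.prems(2) by blast
qed simp

context arrangement
begin

lemma good_sum:
  assumes "\<And>i. i \<in> I \<Longrightarrow> good D (f i)"
  shows "good D (\<lambda>z. \<Sum>i\<in>I. f i z)"
  using assms
proof (induction I rule: infinite_finite_induct)
  case (insert x F)
  then have "good D (\<lambda>z. f x z + (\<Sum>i\<in>F. f i z))" by (intro good_add) auto
  then show ?case using insert.hyps by simp
qed (simp_all add: good_zero)

lemma good_pairing_squares:
  assumes "finite K" "good D f"
  shows "good (D - 2 * int (card K)) (\<lambda>z. (\<Prod>a\<in>K. pairing a z ^ 2) * f z)"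
  using assms(1)
proof (induction K rule: finite_induct)
  case (insert a K)
  have "good (D - 2 * int (card K) - 1 - 1) (\<lambda>z. pairing a z * (pairing a z * ((\<Prod>a\<in>K. pairing a z ^ 2) * f z)))"
    by (intro good_pairing insert.IH)
  moreover have "D - 2 * int (card K) - 1 - 1 = D - 2 * int (card (insert a K))"
    using insert.hyps by simp
  moreover have "pairing a z * (pairing a z * ((\<Prod>a\<in>K. pairing a z ^ 2) * f z)) =
      (\<Prod>a\<in>insert a K. pairing a z ^ 2) * f z" for z
    using insert.hyps by (simp add: power2_eq_square mult.assoc)
  ultimately show ?case by (simp only:)
qed (use assms(2) in simp)

text \<open>Orders are a function on all of \<Delta>, with 0 for an absent pole, so that partial
  fractions become function updates.\<close>

definition reciprocal :: "(real^'n \<Rightarrow> nat) \<Rightarrow> complex^'n \<Rightarrow> complex" where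
  "reciprocal n z = (\<Prod>a\<in>\<Delta>. inverse (pairing a z) ^ n a)"

lemma reciprocal_add: "reciprocal (\<lambda>a. n a + m a) z = reciprocal n z * reciprocal m z"
  by (simp add: reciprocal_def power_add prod.distrib)

lemma reciprocal_incr:
  assumes "a \<in> \<Delta>" shows "reciprocal (n(a := Suc (n a))) z = inverse (pairing a z) * reciprocal n z"
proof -
  have "(\<Prod>b\<in>\<Delta> - {a}. inverse (pairing b z) ^ (n(a := Suc (n a))) b) = (\<Prod>b\<in>\<Delta> - {a}. inverse (pairing b z) ^ n b)"
    by (rule prod.cong) auto
  then show ?thesis
    unfolding reciprocal_def prod.remove[OF finite_\<Delta> assms] by (simp add: mult.assoc)
qed

lemma reciprocal_decr:
  assumes "a \<in> \<Delta>" "n a > 0" "pairing a z \<noteq> 0"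
  shows "pairing a z * reciprocal n z = reciprocal (n(a := n a - 1)) z"
proof -
  have "n = (n(a := n a - 1))(a := Suc ((n(a := n a - 1)) a))" using assms(2) by auto
  then have "reciprocal n z = inverse (pairing a z) * reciprocal (n(a := n a - 1)) z"
    using reciprocal_incr[OF assms(1), of "n(a := n a - 1)"] by simp
  then show ?thesis using assms(3) by simp
qed

text \<open>The existing wall shows that \<Delta> has rank at least r - 1, so a maximal independent
  subset of \<Delta> has r - 1 or r elements.\<close>

lemma extend_in_\<Delta>:
  assumes "S \<subseteq> \<Delta>" "independent S"
  obtains K where "S \<subseteq> K" "K \<subseteq> \<Delta>" "independent K" "finite K"
    "card K = CARD('n) \<and> span K = UNIV \<or> card K + 1 = CARD('n)"
proof -
  obtain K where K: "S \<subseteq> K" "K \<subseteq> \<Delta>" "independent K" "\<Delta> \<subseteq> span K"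
    using maximal_independent_subset_extend[OF assms] by blast
  have finK: "finite K" using K(2) finite_\<Delta> by (rule finite_subset)
  obtain H where "wall \<Delta> H" using wall_exists ..
  then obtain B where "B \<subseteq> \<Delta> \<and> independent B \<and> card B + 1 = CARD('n) \<and> H = span B"
    unfolding wall_def ..
  then have B: "B \<subseteq> \<Delta>" "independent B" "card B + 1 = CARD('n)" by auto
  have "B \<subseteq> span K" using B(1) K(4) by (rule subset_trans)
  then have "card B \<le> card K" using independent_span_bound[OF finK B(2)] by simp
  moreover have "card K \<le> CARD('n)" using independent_bound[OF K(3)] by simp
  moreover have "span K = UNIV" if "card K = CARD('n)"
  proof -
    have "UNIV \<subseteq> span K"
      by (rule card_ge_dim_independent) (use K(3) that in auto)
    then show ?thesis by (rule top.extremum_uniqueI)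
  qed
  ultimately have "card K = CARD('n) \<and> span K = UNIV \<or> card K + 1 = CARD('n)"
    using B(3) by linarith
  then show ?thesis by (rule that[OF K(1-3) finK])
qed

lemma good_reciprocal_independent:
  assumes ind: "independent {a \<in> \<Delta>. n a > 0}"
  shows "good (int (sum n \<Delta>) - int CARD('n)) (reciprocal n)"
proof -
  obtain K where K: "{a \<in> \<Delta>. n a > 0} \<subseteq> K" "K \<subseteq> \<Delta>" "independent K" "finite K"
    "card K = CARD('n) \<and> span K = UNIV \<or> card K + 1 = CARD('n)"
    by (rule extend_in_\<Delta>[OF _ ind]) auto
  have out: "n a = 0" if "a \<in> \<Delta> - K" for a using that K(1) by auto
  have sumK: "sum n \<Delta> = sum n K"
    by (rule sum.mono_neutral_right[OF finite_\<Delta> K(2)]) (use out in auto)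
  have recK: "reciprocal n z = (\<Prod>a\<in>K. inverse (pairing a z) ^ n a)" for z
    unfolding reciprocal_def
    by (rule prod.mono_neutral_right[OF finite_\<Delta> K(2)]) (use out in auto)
  \<comment> \<open>Two extra orders at every element of K: the adjoined poles get order 2 and the
    original ones at least 3, as \<open>good_basis\<close> and \<open>good_corank_one\<close>
    require. Multiplying by the squares afterwards lowers the degree by 2 \<open>card K\<close>
    again.\<close>
  define g where "g = (\<lambda>z. \<Prod>a\<in>K. inverse (pairing a z) ^ (n a + 2))"
  have "good (int (sum n \<Delta>) + 2 * int (card K) - int CARD('n)) g"
    using K(5)
  proof
    assume c: "card K = CARD('n) \<and> span K = UNIV"
    have "good (\<Sum>a\<in>K. int (n a + 2) - 1) g"
      unfolding g_def by (rule good_basis[OF K(2,3)]) (use c in auto)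
    moreover have "(\<Sum>a\<in>K. int (n a + 2) - 1) = int (sum n \<Delta>) + 2 * int (card K) - int CARD('n)"
      unfolding sumK using c by (simp add: sum.distrib sum_subtractf)
    ultimately show ?thesis by (simp only:)
  next
    assume c: "card K + 1 = CARD('n)"
    show ?thesis unfolding g_def by (rule good_corank_one[OF K(2,3) c]) simp
  qed
  from good_pairing_squares[OF K(4) this]
  have "good (int (sum n \<Delta>) - int CARD('n)) (\<lambda>z. (\<Prod>a\<in>K. pairing a z ^ 2) * g z)" by simp
  then show ?thesis
  proof (rule good_cong)
    fix z assume nz: "\<And>a. a \<in> \<Delta> \<Longrightarrow> pairing a z \<noteq> 0"
    show "(\<Prod>a\<in>K. pairing a z ^ 2) * g z = reciprocal n z"
      unfolding g_def recK prod.distrib[symmetric]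
    proof (rule prod.cong[OF refl])
      fix a assume "a \<in> K"
      then have "pairing a z \<noteq> 0" using nz K(2) by blast
      then have "(pairing a z * inverse (pairing a z)) ^ 2 = 1" by simp
      then show "pairing a z ^ 2 * inverse (pairing a z) ^ (n a + 2) = inverse (pairing a z) ^ n a"
        by (simp only: power_mult_distrib power_add mult.assoc[symmetric] mult.commute[of "inverse (pairing a z) ^ n a"] mult_1_left)
    qed
  qed
qed

text \<open>Partial fractions: a linear relation \<open>\<beta> = \<Sum> c\<^sub>\<alpha> \<alpha>\<close> among the poles moves multiplicity
  from the \<open>\<alpha>\<close> to \<open>\<beta>\<close> until some \<open>\<alpha>\<close> disappears.\<close>

lemma good_reciprocal: "good (int (sum n \<Delta>) - int CARD('n)) (reciprocal n)"
proof (induction "card {a \<in> \<Delta>. n a > 0}" arbitrary: n rule: less_induct)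
  case less
  note outer = less
  define S where "S = {a \<in> \<Delta>. n a > 0}"
  show ?case
  proof (cases "independent S")
    case True
    then show ?thesis unfolding S_def by (rule good_reciprocal_independent)
  next
    case False
    have finS: "finite S" and S\<Delta>: "S \<subseteq> \<Delta>" using finite_\<Delta> by (auto simp: S_def)
    obtain \<beta> where \<beta>: "\<beta> \<in> S" "\<beta> \<in> span (S - {\<beta>})"
      using False unfolding dependent_def by blast
    then obtain c where c: "\<beta> = (\<Sum>a\<in>S - {\<beta>}. c a *\<^sub>R a)"
      using finS by (auto simp: span_finite)
    \<comment> \<open>As long as the set S of poles is unchanged, the same relation c can be reused.
      The inner induction is on the total order off \<beta>; when some pole disappears, the outer
      hypothesis takes over.\<close>
    have "good (int (sum m \<Delta>) - int CARD('n)) (reciprocal m)" if "{a \<in> \<Delta>. m a > 0} = S" for m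
      using that
    proof (induction "sum m (S - {\<beta>})" arbitrary: m rule: less_induct)
      case (less m)
      \<comment> \<open>Writing 1 as the sum of the c a \<open>pairing a z\<close> /
        \<open>pairing \<beta> z\<close> expresses the reciprocal of m through those of
        \<open>m' a\<close>: the order at \<beta> rises by one and that at a falls by one, so the
        total order, and with it the degree bound, is kept.\<close>
      define m' where "m' = (\<lambda>a. (m(\<beta> := Suc (m \<beta>)))(a := m a - 1))"
      have good': "good (int (sum m \<Delta>) - int CARD('n)) (reciprocal (m' a))" if a: "a \<in> S - {\<beta>}" for a
      proof -
        have pos: "m a > 0" "a \<in> \<Delta>" "a \<noteq> \<beta>" "\<beta> \<in> \<Delta>" using a less.prems \<beta>(1) S\<Delta> by auto
        have "sum (m' a) \<Delta> = sum m \<Delta>"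
        proof -
          have "sum (m' a) \<Delta> = m' a a + (m' a \<beta> + sum (m' a) (\<Delta> - {a} - {\<beta>}))"
            using pos finite_\<Delta> by (simp add: sum.remove[of \<Delta> a] sum.remove[of "\<Delta> - {a}" \<beta>])
          also have "sum (m' a) (\<Delta> - {a} - {\<beta>}) = sum m (\<Delta> - {a} - {\<beta>})"
            by (rule sum.cong) (auto simp: m'_def)
          also have "m' a a + (m' a \<beta> + sum m (\<Delta> - {a} - {\<beta>})) = m a + (m \<beta> + sum m (\<Delta> - {a} - {\<beta>}))"
            using pos by (simp add: m'_def)
          also have "\<dots> = sum m \<Delta>"
            using pos finite_\<Delta> by (simp add: sum.remove[of \<Delta> a] sum.remove[of "\<Delta> - {a}" \<beta>])
          finally show ?thesis .
        qed
        moreover have "good (int (sum (m' a) \<Delta>) - int CARD('n)) (reciprocal (m' a))"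
        proof (cases "m a = 1")
          case True
          have "{b \<in> \<Delta>. m' a b > 0} = S - {a}"
            using True pos less.prems \<beta>(1) by (auto simp: m'_def)
          then have "card {b \<in> \<Delta>. m' a b > 0} < card S"
            using a finS by (simp only:) (intro psubset_card_mono, auto)
          then show ?thesis using outer unfolding S_def by blast
        next
          case False
          have "{b \<in> \<Delta>. m' a b > 0} = S"
            using False pos less.prems \<beta>(1) by (auto simp: m'_def)
          moreover have "sum (m' a) (S - {\<beta>}) < sum m (S - {\<beta>})"
            by (rule sum_strict_mono_ex1) (use a pos finS in \<open>auto simp: m'_def\<close>)
          ultimately show ?thesis using less.hyps by blast
        qed
        ultimately show ?thesis by (simp only:)
      qed
      have "good (int (sum m \<Delta>) - int CARD('n)) (\<lambda>z. \<Sum>a\<in>S - {\<beta>}. of_real (c a) * reciprocal (m' a) z)"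
        by (intro good_sum good_cmult good')
      then show ?case
      proof (rule good_cong)
        fix z assume nz: "\<And>a. a \<in> \<Delta> \<Longrightarrow> pairing a z \<noteq> 0"
        have \<beta>\<Delta>: "\<beta> \<in> \<Delta>" using \<beta>(1) S\<Delta> by blast
        have rm': "reciprocal (m' a) z = pairing a z * (inverse (pairing \<beta> z) * reciprocal m z)"
          if a: "a \<in> S - {\<beta>}" for a
        proof -
          have pos: "m a > 0" "a \<in> \<Delta>" "a \<noteq> \<beta>" using a less.prems by auto
          have "reciprocal (m' a) z = pairing a z * reciprocal (m(\<beta> := Suc (m \<beta>))) z"
            unfolding m'_def using reciprocal_decr[of a "m(\<beta> := Suc (m \<beta>))" z] pos nz by simp
          then show ?thesis by (simp only: reciprocal_incr[OF \<beta>\<Delta>])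
        qed
        have "pairing \<beta> z = (\<Sum>a\<in>S - {\<beta>}. of_real (c a) * pairing a z)"
        proof -
          have "pairing \<beta> z = pairing (\<Sum>a\<in>S - {\<beta>}. c a *\<^sub>R a) z" by (simp only: c[symmetric])
          then show ?thesis by (simp only: pairing_sum_left pairing_scaleR_left)
        qed
        moreover have "(\<Sum>a\<in>S - {\<beta>}. of_real (c a) * reciprocal (m' a) z) =
            (\<Sum>a\<in>S - {\<beta>}. of_real (c a) * pairing a z) * (inverse (pairing \<beta> z) * reciprocal m z)"
          unfolding sum_distrib_right by (rule sum.cong) (auto simp: rm' mult.assoc)
        ultimately have "(\<Sum>a\<in>S - {\<beta>}. of_real (c a) * reciprocal (m' a) z) =
            pairing \<beta> z * (inverse (pairing \<beta> z) * reciprocal m z)" by (simp only:)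
        then show "(\<Sum>a\<in>S - {\<beta>}. of_real (c a) * reciprocal (m' a) z) = reciprocal m z"
          using nz[OF \<beta>\<Delta>] by simp
      qed
    qed
    then show ?thesis by (simp add: S_def)
  qed
qed

section \<open>Homogeneous components\<close>

definition monomial :: "complex \<Rightarrow> (real^'n) list \<Rightarrow> (real^'n \<Rightarrow> nat) \<Rightarrow> complex^'n \<Rightarrow> complex" where
  "monomial c vs n z = c * (\<Prod>v\<leftarrow>vs. pairing v z) * reciprocal n z"

definition homogeneous_good :: "int \<Rightarrow> (complex^'n \<Rightarrow> complex) \<Rightarrow> bool" where
  "homogeneous_good d g \<longleftrightarrow> good (- d - int CARD('n)) g \<and> homogeneous_of_degree \<Delta> d g"

lemma good_monomial: "good (int (sum n \<Delta>) - int (length vs) - int CARD('n)) (monomial c vs n)"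
proof (induction vs)
  case Nil
  have "monomial c [] n = (\<lambda>z. c * reciprocal n z)" by (simp add: monomial_def fun_eq_iff)
  then show ?case using good_cmult[OF good_reciprocal] by simp
next
  case (Cons v vs)
  have "monomial c (v # vs) n = (\<lambda>z. pairing v z * monomial c vs n z)"
    by (simp add: monomial_def fun_eq_iff)
  then show ?case using good_pairing[OF Cons, of v] by (simp add: algebra_simps)
qed

lemma homogeneous_good_monomial:
  "homogeneous_good (int (length vs) - int (sum n \<Delta>)) (monomial c vs n)"
  unfolding homogeneous_good_def
proof
  show "good (- (int (length vs) - int (sum n \<Delta>)) - int CARD('n)) (monomial c vs n)"
    using good_monomial[of n vs c] by simp
  show "homogeneous_of_degree \<Delta> (int (length vs) - int (sum n \<Delta>)) (monomial c vs n)"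
    unfolding homogeneous_of_degree_def
  proof (intro allI impI)
    fix z and b :: complex assume b: "(\<forall>\<alpha>\<in>\<Delta>. pairing \<alpha> z \<noteq> 0) \<and> b \<noteq> 0"
    have 1: "(\<Prod>v\<leftarrow>vs. pairing v (b *s z)) = b ^ length vs * (\<Prod>v\<leftarrow>vs. pairing v z)"
      by (induction vs) (simp_all add: pairing_scale_right)
    have 2: "reciprocal n (b *s z) = inverse b ^ sum n \<Delta> * reciprocal n z"
      unfolding reciprocal_def pairing_scale_right inverse_mult_distrib power_mult_distrib prod.distrib
      by (simp add: power_sum)
    have 3: "b powi (int (length vs) - int (sum n \<Delta>)) = b ^ length vs * inverse b ^ sum n \<Delta>"
      using b by (simp add: power_int_diff divide_inverse power_inverse del: of_nat_sum)
    show "monomial c vs n (b *s z) = b powi (int (length vs) - int (sum n \<Delta>)) * monomial c vs n z"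
      unfolding monomial_def 1 2 3 by (simp add: mult_ac)
  qed
qed

inductive monomial_sum :: "(complex^'n \<Rightarrow> complex) \<Rightarrow> bool" where
  monomial: "monomial_sum (monomial c vs n)"
| add: "monomial_sum f \<Longrightarrow> monomial_sum g \<Longrightarrow> monomial_sum (\<lambda>z. f z + g z)"

lemma monomial_sum_mult:
  "monomial_sum f \<Longrightarrow> monomial_sum g \<Longrightarrow> monomial_sum (\<lambda>z. f z * g z)"
proof (induction rule: monomial_sum.induct)
  case (monomial c vs n)
  from monomial show ?case
  proof (induction rule: monomial_sum.induct)
    case (monomial c' vs' n')
    have "(\<lambda>z. monomial c vs n z * monomial c' vs' n' z) = monomial (c * c') (vs @ vs') (\<lambda>a. n a + n' a)"
      by (simp add: monomial_def reciprocal_add fun_eq_iff mult_ac)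
    then show ?case by (simp add: monomial_sum.monomial)
  next
    case (add f g)
    show ?case unfolding distrib_left by (rule monomial_sum.add[OF add.IH])
  qed
next
  case (add f g)
  show ?case unfolding distrib_right by (rule monomial_sum.add[OF add.IH(1)[OF add.prems] add.IH(2)[OF add.prems]])
qed

lemma R_Delta_monomial_sum: "f \<in> R_Delta \<Delta> \<Longrightarrow> monomial_sum f"
  unfolding R_Delta_def
proof (induction rule: generated_algebra.induct)
  have const: "monomial_sum (\<lambda>z. c)" for c
  proof -
    have "(\<lambda>z. c) = monomial c [] (\<lambda>_. 0)" by (simp add: monomial_def reciprocal_def fun_eq_iff)
    then show ?thesis by (simp add: monomial_sum.monomial)
  qed
  {
    case (const c)
    show ?case by (rule \<open>monomial_sum (\<lambda>z. c)\<close>)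
  next
    case (add f g)
    show ?case by (rule monomial_sum.add[OF add.IH])
  next
    case (mult f g)
    show ?case by (rule monomial_sum_mult[OF mult.IH])
  next
    case (gen g)
    have "monomial_sum g" if "g \<in> polynomial_ring"
      using that unfolding polynomial_ring_def
    proof (induction rule: generated_algebra.induct)
      case (gen g)
      then obtain v where "g = pairing v" by blast
      moreover have "pairing v = monomial 1 [v] (\<lambda>_. 0)" by (simp add: monomial_def reciprocal_def fun_eq_iff)
      ultimately show ?case by (simp add: monomial_sum.monomial)
    next
      case (const c)
      show ?case by (rule \<open>\<And>c. monomial_sum (\<lambda>z. c)\<close>)
    next
      case (add f g)
      show ?case by (rule monomial_sum.add[OF add.IH])
    next
      case (mult f g)
      show ?case by (rule monomial_sum_mult[OF mult.IH])
    qed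
    moreover have "monomial_sum (\<lambda>z. inverse (pairing \<alpha> z))" if \<alpha>: "\<alpha> \<in> \<Delta>" for \<alpha>
    proof -
      have "(\<lambda>z. inverse (pairing \<alpha> z)) = monomial 1 [] ((\<lambda>_. 0)(\<alpha> := Suc 0))"
        using reciprocal_incr[OF \<alpha>, of "\<lambda>_. 0"] by (simp add: monomial_def fun_eq_iff) (simp add: reciprocal_def)
      then show ?thesis by (simp add: monomial_sum.monomial)
    qed
    ultimately show ?case using gen by blast
  }
qed

lemma homogeneous_good_add:
  "homogeneous_good d f \<Longrightarrow> homogeneous_good d g \<Longrightarrow> homogeneous_good d (\<lambda>z. f z + g z)"
  unfolding homogeneous_good_def homogeneous_of_degree_def
  by (simp add: good_add distrib_left)

lemma homogeneous_good_zero: "homogeneous_good d (\<lambda>z. 0)"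
  by (simp add: homogeneous_good_def homogeneous_of_degree_def good_zero)

text \<open>The components are indexed by all integers and vanish off a finite set, so that two
  decompositions can be added over the union of their index sets.\<close>

lemma homogeneous_decomposition:
  assumes "monomial_sum f"
  shows "\<exists>I g. finite I \<and> (\<forall>d. homogeneous_good d (g d)) \<and> (\<forall>d. d \<notin> I \<longrightarrow> g d = (\<lambda>z. 0)) \<and>
    (\<forall>z. f z = (\<Sum>d\<in>I. g d z))"
  using assms
proof (induction rule: monomial_sum.induct)
  case (monomial c vs n)
  let ?d = "int (length vs) - int (sum n \<Delta>)"
  show ?case
    using homogeneous_good_monomial homogeneous_good_zero
    by (intro exI[of _ "{?d}"] exI[of _ "\<lambda>d. if d = ?d then monomial c vs n else (\<lambda>z. 0)"]) auto
next
  case (add f1 f2)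
  obtain I g where I: "finite I" "\<And>d. homogeneous_good d (g d)" "\<And>d. d \<notin> I \<Longrightarrow> g d = (\<lambda>z. 0)"
    "\<And>z. f1 z = (\<Sum>d\<in>I. g d z)" using add.IH(1) by metis
  obtain J h where J: "finite J" "\<And>d. homogeneous_good d (h d)" "\<And>d. d \<notin> J \<Longrightarrow> h d = (\<lambda>z. 0)"
    "\<And>z. f2 z = (\<Sum>d\<in>J. h d z)" using add.IH(2) by metis
  have "f1 z = (\<Sum>d\<in>I \<union> J. g d z)" for z
    unfolding I(4) by (rule sum.mono_neutral_left) (use I J in auto)
  moreover have "f2 z = (\<Sum>d\<in>I \<union> J. h d z)" for z
    unfolding J(4) by (rule sum.mono_neutral_left) (use I J in auto)
  ultimately have "f1 z + f2 z = (\<Sum>d\<in>I \<union> J. g d z + h d z)" for z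
    by (simp add: sum.distrib)
  then show ?case
    using I J homogeneous_good_add
    by (intro exI[of _ "I \<union> J"] exI[of _ "\<lambda>d z. g d z + h d z"]) auto
qed

lemma R_Delta_good:
  assumes "f \<in> R_Delta \<Delta>"
  shows "\<exists>D. good D f" and "homogeneous_of_degree \<Delta> d f \<Longrightarrow> good (- d - int CARD('n)) f"
proof -
  obtain I g where I: "finite I" "\<And>d. homogeneous_good d (g d)" "\<And>d. d \<notin> I \<Longrightarrow> g d = (\<lambda>z. 0)"
    and f: "\<And>z. f z = (\<Sum>d\<in>I. g d z)"
    using homogeneous_decomposition[OF R_Delta_monomial_sum[OF assms]] by metis
  \<comment> \<open>A common upper bound for the finitely many degree bounds of the
    components.\<close>
  define D where "D = (\<Sum>d\<in>I. \<bar>- d - int CARD('n)\<bar>)"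
  have "good D (g d)" if "d \<in> I" for d
  proof -
    have "- d - int CARD('n) \<le> \<bar>- d - int CARD('n)\<bar>" by simp
    also have "\<dots> \<le> D" unfolding D_def by (rule member_le_sum[OF that]) (use I(1) in auto)
    finally show ?thesis using good_mono I(2) unfolding homogeneous_good_def by blast
  qed
  then have "good D (\<lambda>z. \<Sum>d\<in>I. g d z)" by (rule good_sum)
  then show "\<exists>D. good D f" using good_cong[of D _ f] f by (metis (no_types, lifting))
  assume hom: "homogeneous_of_degree \<Delta> d f"
  have "good (- d - int CARD('n)) (g d)" using I(2) unfolding homogeneous_good_def by blast
  then show "good (- d - int CARD('n)) f"
  proof (rule good_cong)
    fix z assume nz: "\<And>\<alpha>. \<alpha> \<in> \<Delta> \<Longrightarrow> pairing \<alpha> z \<noteq> 0"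
    \<comment> \<open>Homogeneity of f and of its components gives \<Sum> c^e h(e) = 0 for every c
      \<noteq> 0, whence h(d) = 0. The index d is inserted because it need not occur in I, in which
      case the conclusion says that f is 0 away from the poles.\<close>
    define h where "h = (\<lambda>e. g e z - (if e = d then f z else 0))"
    have "(\<Sum>e\<in>insert d I. c powi e * h e) = 0" if c: "c \<noteq> 0" for c
    proof -
      have ge: "g e (c *s z) = c powi e * g e z" for e
        using I(2)[of e] nz c unfolding homogeneous_good_def homogeneous_of_degree_def by blast
      have "c powi d * f z = f (c *s z)"
        using hom nz c unfolding homogeneous_of_degree_def by simp
      also have "\<dots> = (\<Sum>e\<in>insert d I. c powi e * g e z)"
        unfolding f ge[symmetric] by (rule sum.mono_neutral_left) (use I in auto)
      finally have "(\<Sum>e\<in>insert d I. c powi e * g e z) = (\<Sum>e\<in>insert d I. if e = d then c powi d * f z else 0)"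
        using I(1) by simp
      then have "(\<Sum>e\<in>insert d I. c powi e * g e z - (if e = d then c powi d * f z else 0)) = 0"
        by (simp add: sum_subtractf)
      moreover have "c powi e * h e = c powi e * g e z - (if e = d then c powi d * f z else 0)" for e
        by (simp add: h_def right_diff_distrib)
      ultimately show ?thesis by (simp only:)
    qed
    from powi_linear_independent[OF _ this, of d] have "h d = 0" using I(1) by simp
    then show "g d z = f z" by (simp add: h_def)
  qed
qed

lemma E_sum_represents:
  assumes "represents f F" "z \<in> U" "\<phi> \<in> test_functions A"
  shows "E_sum N f z \<phi> = (LINT t|lborel. F t z * \<phi> t)"
proof -
  have "(LINT t|lborel. exp (pairing t w) * f w * \<phi> t) = f w * laplace \<phi> w" for w
  proof -
    have "(LINT t|lborel. exp (pairing t w) * f w * \<phi> t) = (LINT t|lborel. f w * (exp (pairing t w) * \<phi> t))"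
      by (simp add: mult_ac)
    then show ?thesis by (simp add: laplace_def)
  qed
  then show ?thesis
    unfolding E_sum_def using infsumI[OF representsD[OF assms]] by simp
qed

lemma alcove_polynomial:
  assumes "good D f" "alcove N \<Delta> \<aa>"
  shows "\<exists>c. (\<forall>k. c k \<in> RT) \<and> (\<forall>z\<in>U. gen_eq_on \<aa> (E_sum N f z) (\<lambda>t. poly_in_t D c t z))"
proof -
  obtain F where F: "piecewise D F" "represents f F" using assms(1) unfolding good_def by blast
  obtain t0 where t0: "t0 \<in> A" "\<aa> = connected_component_set A t0"
    using assms(2) unfolding alcove_def components_def by blast
  obtain p where p: "polyT RT D p" "\<And>t z. t \<in> \<aa> \<Longrightarrow> z \<in> U \<Longrightarrow> F t z = p t z"
    using F(1) t0 unfolding piecewise_def by blast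
  obtain c where c: "\<And>k. c k \<in> RT" "\<And>t z. p t z = poly_in_t D c t z"
    using polyT_imp_poly_in_t[OF RT_add RT_const p(1)] by blast
  have sub: "\<aa> \<subseteq> A" unfolding t0(2) by (rule connected_component_subset)
  have "gen_eq_on \<aa> (E_sum N f z) (\<lambda>t. poly_in_t D c t z)" if z: "z \<in> U" for z
    unfolding gen_eq_on_def
  proof
    fix \<phi> assume \<phi>: "\<phi> \<in> test_functions \<aa>"
    have eq: "F t z * \<phi> t = poly_in_t D c t z * \<phi> t" for t
      using p(2)[of t z] c(2) z test_functions_outside[OF \<phi>, of t] by (cases "t \<in> \<aa>") auto
    then show "E_sum N f z \<phi> = (LINT t|lborel. poly_in_t D c t z * \<phi> t)"
      using E_sum_represents[OF F(2) z test_functions_mono[OF sub \<phi>]] by (simp only: eq)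
  qed
  then show ?thesis using c(1) by blast
qed

end

theorem proposition15:
  fixes N \<Delta> :: "(real^'n) set" and f :: "complex^'n \<Rightarrow> complex"
  assumes "lattice_in N"
    and "finite \<Delta>" and "\<Delta> \<subseteq> dual_lattice N" and "0 \<notin> \<Delta>"
    and "\<forall>\<alpha>\<in>\<Delta>. indivisible_in (dual_lattice N) \<alpha>"
    and "\<exists>H. wall \<Delta> H"
    and "f \<in> R_Delta \<Delta>"
  shows "(\<exists>F :: real^'n \<Rightarrow> complex^'n \<Rightarrow> complex.
            smooth_on (areg N \<Delta> \<times> U_Delta N \<Delta>) (\<lambda>(t, z). F t z) \<and>
            (\<forall>z\<in>U_Delta N \<Delta>. gen_eq_on (areg N \<Delta>) (E_sum N f z) (\<lambda>t. F t z)))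
       \<and> (\<forall>\<aa> d. alcove N \<Delta> \<aa> \<and> homogeneous_of_degree \<Delta> d f \<longrightarrow>
            (\<exists>c. (\<forall>k. c k \<in> R_T_Delta N \<Delta>) \<and>
                 (\<forall>z\<in>U_Delta N \<Delta>. gen_eq_on \<aa> (E_sum N f z)
                    (\<lambda>t. poly_in_t (- d - int CARD('n)) c t z))))"
proof -
  interpret arrangement N \<Delta>
    using assms by unfold_locales
  show ?thesis
  proof (intro conjI allI impI)
    obtain D where "good D f" using R_Delta_good(1)[OF assms(7)] ..
    then obtain F where F: "piecewise D F \<and> represents f F" unfolding good_def ..
    have "smooth_on (areg N \<Delta> \<times> U_Delta N \<Delta>) (\<lambda>(t, z). F t z)"
      using F by (intro piecewise_smooth) blast
    moreover have "\<forall>z\<in>U_Delta N \<Delta>. gen_eq_on (areg N \<Delta>) (E_sum N f z) (\<lambda>t. F t z)"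
      unfolding gen_eq_on_def using F E_sum_represents by blast
    ultimately show "\<exists>F. smooth_on (areg N \<Delta> \<times> U_Delta N \<Delta>) (\<lambda>(t, z). F t z) \<and>
            (\<forall>z\<in>U_Delta N \<Delta>. gen_eq_on (areg N \<Delta>) (E_sum N f z) (\<lambda>t. F t z))" by blast
  next
    fix \<aa> d assume "alcove N \<Delta> \<aa> \<and> homogeneous_of_degree \<Delta> d f"
    then show "\<exists>c. (\<forall>k. c k \<in> R_T_Delta N \<Delta>) \<and>
                 (\<forall>z\<in>U_Delta N \<Delta>. gen_eq_on \<aa> (E_sum N f z)
                    (\<lambda>t. poly_in_t (- d - int CARD('n)) c t z))"
      using alcove_polynomial[OF R_Delta_good(2)[OF assms(7)]] by blast
  qed
qed

end
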